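(* (In $\mathsf{ZF}+\mathsf{DC}$.) Assume $\mathsf{BP}$, i.e. that every subset of $\omega^\omega$ has the Baire property in $\omega^\omega$. Then every separable metrizable topological group $G$ is Effros.
   Context: The base theory is $\mathsf{ZF}+\mathsf{DC}$ (no Axiom of Choice beyond Dependent Choices). All spaces and topological groups are separable and metrizable. "Group" means topological group (with its algebraic and topological structure), and all group actions $G\times X\to X$ of a group on a space are continuous. A space is non-meager if it is not a countable union of nowhere dense subsets of itself. An action of $G$ on $X$ is transitive if for all $x,y\in X$ there is $g\in G$ with $gx=y$. For $S\subseteq G$ and $x\in X$, $Sx=\{gx:g\in S\}$. The action is micro-transitive if $Ux$ is a neighborhood of $x$ in $X$ for every $x\in X$ and every neighborhood $U$ of the identity in $G$. A group $G$ is Effros if every transitive (continuous) action of $G$ on a non-meager (separable metrizable) space is micro-transitive. A subset of a space $X$ has the Baire property in $X$ if it differs from some open subset of $X$ by a meager subset of $X$. *)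

theory Defs
  imports "HOL-Algebra.Ring"
begin

text \<open>
  Isabelle/HOL proves the Axiom of Choice, hence refutes the hypothesis BP for the type
  \<^typ>\<open>nat \<Rightarrow> nat\<close>. A theorem of ZF+DC is therefore rendered semantically: by the completeness
  theorem, ZF+DC+BP proves a sentence iff the sentence holds in every structure \<open>(M, \<epsilon>)\<close>
  that satisfies the axioms of ZF, DC and the sentence BP. The structure is a type \<open>'m\<close> with a
  binary relation \<open>\<epsilon>\<close>; it need not be transitive, well-founded or uncountable.

  Everything below is the usual set-theoretic notion read inside \<open>(M, \<epsilon>)\<close>. To keep it
  first-order over \<open>(M, \<epsilon>)\<close>, all quantifiers range over \<open>'m\<close>: subsets, functions, sequences,
  topologies, groups and metrics are elements of \<open>'m\<close>. HOL sets of type \<open>'m set\<close> and HOL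
  functions on \<open>'m\<close> occur only as notation for definable classes and class functions and are
  never quantified over; definite descriptions are only used for objects that ZF proves to
  exist uniquely.
\<close>

datatype fm = Mem nat nat | Eq nat nat | Neg fm | Conj fm fm | Forall nat fm

primrec sat :: "('m \<Rightarrow> 'm \<Rightarrow> bool) \<Rightarrow> fm \<Rightarrow> (nat \<Rightarrow> 'm) \<Rightarrow> bool" where
  "sat E (Mem i j) v \<longleftrightarrow> E (v i) (v j)"
| "sat E (Eq i j) v \<longleftrightarrow> v i = v j"
| "sat E (Neg p) v \<longleftrightarrow> \<not> sat E p v"
| "sat E (Conj p q) v \<longleftrightarrow> sat E p v \<and> sat E q v"
| "sat E (Forall i p) v \<longleftrightarrow> (\<forall>a. sat E p (v(i := a)))"

locale set_structure =
  fixes mem :: "'m \<Rightarrow> 'm \<Rightarrow> bool" (infix "\<epsilon>" 50)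
begin

definition ext :: "'m \<Rightarrow> 'm set" where
  "ext a = {x. x \<epsilon> a}"

definition set_of :: "'m set \<Rightarrow> 'm" where
  "set_of A = (THE a. ext a = A)"

definition pair :: "'m \<Rightarrow> 'm \<Rightarrow> 'm" where
  "pair a b = set_of {set_of {a}, set_of {a, b}}"

definition cprod :: "'m \<Rightarrow> 'm \<Rightarrow> 'm" where
  "cprod A B = set_of {p. \<exists>a\<in>ext A. \<exists>b\<in>ext B. p = pair a b}"

definition pow :: "'m \<Rightarrow> 'm" where
  "pow A = set_of {B. ext B \<subseteq> ext A}"

definition is_fun :: "'m \<Rightarrow> 'm \<Rightarrow> 'm \<Rightarrow> bool" where
  "is_fun f A B \<longleftrightarrow> ext f \<subseteq> ext (cprod A B) \<and> (\<forall>a\<in>ext A. \<exists>!b. pair a b \<epsilon> f)"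

definition app :: "'m \<Rightarrow> 'm \<Rightarrow> 'm" where
  "app f a = (THE b. pair a b \<epsilon> f)"

definition app2 :: "'m \<Rightarrow> 'm \<Rightarrow> 'm \<Rightarrow> 'm" where
  "app2 f a b = app f (pair a b)"

definition funs :: "'m \<Rightarrow> 'm \<Rightarrow> 'm" where
  "funs A B = set_of {f. is_fun f A B}"

definition is_inductive :: "'m \<Rightarrow> bool" where
  "is_inductive w \<longleftrightarrow>
     (\<exists>z\<in>ext w. ext z = {}) \<and> (\<forall>n\<in>ext w. \<exists>s\<in>ext w. ext s = insert n (ext n))"

definition succ :: "'m \<Rightarrow> 'm" where
  "succ n = set_of (insert n (ext n))"

definition omega :: 'm where
  "omega = set_of {n. \<forall>w. is_inductive w \<longrightarrow> n \<epsilon> w}"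

definition countable_set :: "'m \<Rightarrow> bool" where
  "countable_set D \<longleftrightarrow> (\<exists>f. is_fun f D omega \<and> inj_on (app f) (ext D))"


definition cl :: "'m \<Rightarrow> 'm \<Rightarrow> 'm \<Rightarrow> 'm set" where
  "cl X T A = {x \<in> ext X. \<forall>U\<in>ext T. x \<epsilon> U \<longrightarrow> ext U \<inter> ext A \<noteq> {}}"

definition nhood :: "'m \<Rightarrow> 'm \<Rightarrow> 'm \<Rightarrow> 'm set \<Rightarrow> bool" where
  "nhood X T x N \<longleftrightarrow> N \<subseteq> ext X \<and> (\<exists>W\<in>ext T. x \<epsilon> W \<and> ext W \<subseteq> N)"

definition nowhere_dense :: "'m \<Rightarrow> 'm \<Rightarrow> 'm \<Rightarrow> bool" where
  "nowhere_dense X T N \<longleftrightarrow>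
     ext N \<subseteq> ext X \<and> \<not> (\<exists>U\<in>ext T. ext U \<noteq> {} \<and> ext U \<subseteq> cl X T N)"

definition meager :: "'m \<Rightarrow> 'm \<Rightarrow> 'm \<Rightarrow> bool" where
  "meager X T A \<longleftrightarrow>
     (\<exists>s. is_fun s omega (pow X) \<and> (\<forall>n\<in>ext omega. nowhere_dense X T (app s n)) \<and>
          ext A = (\<Union>n\<in>ext omega. ext (app s n)))"

definition baire_property :: "'m \<Rightarrow> 'm \<Rightarrow> 'm \<Rightarrow> bool" where
  "baire_property X T A \<longleftrightarrow>
     ext A \<subseteq> ext X \<and>
     (\<exists>U\<in>ext T. \<exists>D. ext D = (ext A - ext U) \<union> (ext U - ext A) \<and> meager X T D)"

definition continuous :: "'m \<Rightarrow> 'm \<Rightarrow> 'm \<Rightarrow> ('m \<Rightarrow> 'm) \<Rightarrow> bool" where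
  "continuous X S T f \<longleftrightarrow>
     (\<forall>x\<in>ext X. \<forall>W\<in>ext T. f x \<epsilon> W \<longrightarrow> (\<exists>U\<in>ext S. x \<epsilon> U \<and> (\<forall>x'\<in>ext U. f x' \<epsilon> W)))"

text \<open>Continuity for the product topology on the domain, tested on basic open boxes.\<close>

definition continuous2 ::
  "'m \<Rightarrow> 'm \<Rightarrow> 'm \<Rightarrow> 'm \<Rightarrow> 'm \<Rightarrow> ('m \<Rightarrow> 'm \<Rightarrow> 'm) \<Rightarrow> bool" where
  "continuous2 X S Y T R f \<longleftrightarrow>
     (\<forall>x\<in>ext X. \<forall>y\<in>ext Y. \<forall>W\<in>ext R. f x y \<epsilon> W \<longrightarrow>
        (\<exists>U\<in>ext S. \<exists>V\<in>ext T. x \<epsilon> U \<and> y \<epsilon> V \<and>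
           (\<forall>x'\<in>ext U. \<forall>y'\<in>ext V. f x' y' \<epsilon> W)))"


text \<open>
  The real numbers of the structure are characterized as a Dedekind-complete ordered field; ZF
  proves that there is one and that it is unique up to isomorphism. Note that completeness
  refers only to subsets that are elements of \<open>'m\<close>. The order \<open>l\<close> is a set of pairs.
\<close>

definition ring_of :: "'m \<Rightarrow> 'm \<Rightarrow> 'm \<Rightarrow> 'm \<Rightarrow> 'm \<Rightarrow> 'm ring" where
  "ring_of R a m z u =
     \<lparr>carrier = ext R, monoid.mult = app2 m, one = u, zero = z, add = app2 a\<rparr>"

definition le :: "'m \<Rightarrow> 'm \<Rightarrow> 'm \<Rightarrow> bool" where
  "le l x y \<longleftrightarrow> pair x y \<epsilon> l"

definition less :: "'m \<Rightarrow> 'm \<Rightarrow> 'm \<Rightarrow> bool" where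
  "less l x y \<longleftrightarrow> le l x y \<and> x \<noteq> y"

definition complete_ordered_field ::
  "'m \<Rightarrow> 'm \<Rightarrow> 'm \<Rightarrow> 'm \<Rightarrow> 'm \<Rightarrow> 'm \<Rightarrow> bool" where
  "complete_ordered_field R a m z u l \<longleftrightarrow>
     is_fun a (cprod R R) R \<and> is_fun m (cprod R R) R \<and> field (ring_of R a m z u) \<and>
     ext l \<subseteq> ext (cprod R R) \<and>
     (\<forall>x\<in>ext R. le l x x) \<and>
     (\<forall>x\<in>ext R. \<forall>y\<in>ext R. le l x y \<and> le l y x \<longrightarrow> x = y) \<and>
     (\<forall>x\<in>ext R. \<forall>y\<in>ext R. \<forall>w\<in>ext R. le l x y \<and> le l y w \<longrightarrow> le l x w) \<and>
     (\<forall>x\<in>ext R. \<forall>y\<in>ext R. le l x y \<or> le l y x) \<and>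
     (\<forall>x\<in>ext R. \<forall>y\<in>ext R. \<forall>w\<in>ext R. le l x y \<longrightarrow> le l (app2 a x w) (app2 a y w)) \<and>
     (\<forall>x\<in>ext R. \<forall>y\<in>ext R. le l z x \<and> le l z y \<longrightarrow> le l z (app2 m x y)) \<and>
     (\<forall>B. ext B \<subseteq> ext R \<and> ext B \<noteq> {} \<and> (\<exists>c\<in>ext R. \<forall>x\<in>ext B. le l x c) \<longrightarrow>
        (\<exists>s\<in>ext R. (\<forall>x\<in>ext B. le l x s) \<and>
           (\<forall>c\<in>ext R. (\<forall>x\<in>ext B. le l x c) \<longrightarrow> le l s c)))"

definition metric_on :: "'m \<Rightarrow> 'm \<Rightarrow> 'm \<Rightarrow> 'm \<Rightarrow> 'm \<Rightarrow> 'm \<Rightarrow> bool" where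
  "metric_on R a z l X d \<longleftrightarrow>
     is_fun d (cprod X X) R \<and>
     (\<forall>x\<in>ext X. \<forall>y\<in>ext X. le l z (app2 d x y)) \<and>
     (\<forall>x\<in>ext X. \<forall>y\<in>ext X. app2 d x y = z \<longleftrightarrow> x = y) \<and>
     (\<forall>x\<in>ext X. \<forall>y\<in>ext X. app2 d x y = app2 d y x) \<and>
     (\<forall>x\<in>ext X. \<forall>y\<in>ext X. \<forall>w\<in>ext X.
        le l (app2 d x w) (app2 a (app2 d x y) (app2 d y w)))"

definition metric_topology :: "'m \<Rightarrow> 'm \<Rightarrow> 'm \<Rightarrow> 'm \<Rightarrow> 'm \<Rightarrow> 'm \<Rightarrow> bool" where
  "metric_topology R z l X d T \<longleftrightarrow>
     (\<forall>U. U \<epsilon> T \<longleftrightarrow>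
        ext U \<subseteq> ext X \<and>
        (\<forall>x\<in>ext U. \<exists>r\<in>ext R. less l z r \<and>
           (\<forall>y\<in>ext X. less l (app2 d x y) r \<longrightarrow> y \<epsilon> U)))"

definition metrizable :: "'m \<Rightarrow> 'm \<Rightarrow> bool" where
  "metrizable X T \<longleftrightarrow>
     (\<exists>R a m z u l d. complete_ordered_field R a m z u l \<and> metric_on R a z l X d \<and>
        metric_topology R z l X d T)"

definition separable :: "'m \<Rightarrow> 'm \<Rightarrow> bool" where
  "separable X T \<longleftrightarrow> (\<exists>D. ext D \<subseteq> ext X \<and> countable_set D \<and> cl X T D = ext X)"


definition group_of :: "'m \<Rightarrow> 'm \<Rightarrow> 'm \<Rightarrow> 'm monoid" where
  "group_of G m e = \<lparr>carrier = ext G, monoid.mult = app2 m, one = e\<rparr>"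

definition topological_group :: "'m \<Rightarrow> 'm \<Rightarrow> 'm \<Rightarrow> 'm \<Rightarrow> bool" where
  "topological_group G T m e \<longleftrightarrow>
     is_fun m (cprod G G) G \<and> group (group_of G m e) \<and>
     continuous2 G T G T T (app2 m) \<and>
     continuous G T T (\<lambda>g. inv\<^bsub>group_of G m e\<^esub> g)"

definition continuous_action ::
  "'m \<Rightarrow> 'm \<Rightarrow> 'm \<Rightarrow> 'm \<Rightarrow> 'm \<Rightarrow> 'm \<Rightarrow> 'm \<Rightarrow> bool" where
  "continuous_action G T m e X S \<alpha> \<longleftrightarrow>
     is_fun \<alpha> (cprod G X) X \<and>
     (\<forall>x\<in>ext X. app2 \<alpha> e x = x) \<and>
     (\<forall>g\<in>ext G. \<forall>h\<in>ext G. \<forall>x\<in>ext X.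
        app2 \<alpha> (app2 m g h) x = app2 \<alpha> g (app2 \<alpha> h x)) \<and>
     continuous2 G T X S S (app2 \<alpha>)"

definition transitive :: "'m \<Rightarrow> 'm \<Rightarrow> 'm \<Rightarrow> bool" where
  "transitive G X \<alpha> \<longleftrightarrow> (\<forall>x\<in>ext X. \<forall>y\<in>ext X. \<exists>g\<in>ext G. app2 \<alpha> g x = y)"

definition micro_transitive :: "'m \<Rightarrow> 'm \<Rightarrow> 'm \<Rightarrow> 'm \<Rightarrow> 'm \<Rightarrow> 'm \<Rightarrow> bool" where
  "micro_transitive G T e X S \<alpha> \<longleftrightarrow>
     (\<forall>x\<in>ext X. \<forall>U. nhood G T e (ext U) \<longrightarrow>
        nhood X S x ((\<lambda>g. app2 \<alpha> g x) ` ext U))"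

definition effros :: "'m \<Rightarrow> 'm \<Rightarrow> 'm \<Rightarrow> 'm \<Rightarrow> bool" where
  "effros G T m e \<longleftrightarrow>
     (\<forall>X S \<alpha>. separable X S \<and> metrizable X S \<and> \<not> meager X S X \<and>
        continuous_action G T m e X S \<alpha> \<and> transitive G X \<alpha> \<longrightarrow>
        micro_transitive G T e X S \<alpha>)"


definition baire_space :: 'm where
  "baire_space = funs omega omega"

text \<open>
  The product topology of discrete copies of \<open>\<omega>\<close>, generated by the sets of all functions
  extending a given finite sequence. Recall \<open>n = {0, \<dots>, n - 1}\<close> for \<open>n \<in> \<omega>\<close>.
\<close>

definition baire_topology :: 'm where
  "baire_topology = set_of {U. ext U \<subseteq> ext baire_space \<and>
     (\<forall>f\<in>ext U. \<exists>n\<in>ext omega. \<forall>g\<in>ext baire_space.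
        (\<forall>k\<in>ext n. app g k = app f k) \<longrightarrow> g \<epsilon> U)}"

definition BP :: bool where
  "BP \<longleftrightarrow> (\<forall>A. ext A \<subseteq> ext baire_space \<longrightarrow> baire_property baire_space baire_topology A)"

end

text \<open>
  In the two schemas, the valuation \<open>v\<close> supplies the parameters; variable 0 (and 1, in
  Replacement) of the formula is the distinguished one.
\<close>

locale ZF = set_structure mem for mem :: "'m \<Rightarrow> 'm \<Rightarrow> bool" (infix "\<epsilon>" 50) +
  assumes Extensionality: "\<forall>a b. ext a = ext b \<longrightarrow> a = b"
    and Foundation: "\<forall>a. ext a \<noteq> {} \<longrightarrow> (\<exists>x\<in>ext a. ext x \<inter> ext a = {})"
    and Pairing: "\<forall>a b. \<exists>c. ext c = {a, b}"
    and Union: "\<forall>a. \<exists>b. ext b = (\<Union>x\<in>ext a. ext x)"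
    and Powerset: "\<forall>a. \<exists>b. ext b = {x. ext x \<subseteq> ext a}"
    and Infinity: "\<exists>w. is_inductive w"
    and Separation: "\<forall>p v a. \<exists>b. ext b = {x \<in> ext a. sat (\<epsilon>) p (v(0 := x))}"
    and Replacement: "\<forall>p v a. (\<forall>x\<in>ext a. \<exists>!y. sat (\<epsilon>) p (v(0 := x, 1 := y))) \<longrightarrow>
      (\<exists>b. ext b = {y. \<exists>x\<in>ext a. sat (\<epsilon>) p (v(0 := x, 1 := y))})"

locale ZF_DC = ZF mem for mem :: "'m \<Rightarrow> 'm \<Rightarrow> bool" (infix "\<epsilon>" 50) +
  assumes DC: "\<forall>A r. ext A \<noteq> {} \<and> (\<forall>x\<in>ext A. \<exists>y\<in>ext A. pair x y \<epsilon> r) \<longrightarrow>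
    (\<exists>f. is_fun f omega A \<and> (\<forall>n\<in>ext omega. pair (app f n) (app f (succ n)) \<epsilon> r))"

end

theory Submission
  imports Defs
begin

text \<open>
  Let \<open>X\<close> be separable metrizable with basic open sets \<open>B\<^sub>0, B\<^sub>1, \<dots>\<close>. A sequence
  \<open>f \<in> \<omega>\<^sup>\<omega>\<close> codes a decreasing sequence of nonempty open sets, in which \<open>f n\<close> cuts the current
  set down to its intersection with \<open>B\<^bsub>f n\<^esub>\<close> unless that is empty. For \<open>A \<subseteq> X\<close> let \<open>A*\<close> be the set
  of all \<open>f\<close> whose coded open sets intersect in exactly one point, which lies in \<open>A\<close>. If \<open>M\<close> is
  meager in \<open>\<omega>\<^sup>\<omega>\<close>, then all but a meager set of points \<open>x\<close> have a code \<open>f \<notin> M\<close> that singles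
  out \<open>x\<close>, and \<open>f\<close> can extend any finite sequence whose open set contains \<open>x\<close>. Hence the Baire
  property of \<open>A*\<close> shows that a nonmeager \<open>A\<close> is comeager in some nonempty open subset of \<open>X\<close>.

  Now let \<open>G\<close> act on a nonmeager \<open>X\<close>. For a neighborhood \<open>V\<close> of \<open>e\<close>, countably many translates of
  \<open>V x\<close> cover \<open>X\<close>, so \<open>V x\<close> is nonmeager and hence comeager in some open \<open>W\<close>. For \<open>q \<in> W\<close> a
  smaller \<open>V' q \<subseteq> W\<close> is comeager in some open \<open>W' \<subseteq> W\<close>, so it meets \<open>V x\<close>. Thus
  \<open>W \<subseteq> V\<inverse> V x\<close>, and a translate of \<open>W\<close> by the inverse of an element of \<open>V\<close> is a neighborhood
  of \<open>x\<close> inside \<open>V\<inverse> V\<inverse> V x\<close>.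
\<close>

section \<open>Definable classes\<close>

text \<open>\<open>BP\<close> speaks only of omega^omega, while X need not be complete, so X cannot
  simply be presented as a continuous image of omega^omega. A code whose open sets have no common
  point, or more than one, is left out of A*; this does no harm because the transfer runs from
  points to codes: almost every point has a code outside a given meager set. Every finite sequence
  names a nonempty open set, so category arguments can run in X and in omega^omega at once.

  Choice is available only as \<open>DC\<close>. Countable unions of rare sets are therefore formed
  only from families given uniformly by one definable relation, and finite sequences are represented
  by an explicit countable list of elements of omega^omega. \<open>DC\<close> enters once, to build
  the code of a single point.

  The structure may be nonstandard: its omega need not be the natural numbers of HOL, and only
  definable subclasses of a set are known to be sets. Separation, induction and recursion thus hold
  just for predicates with a defining formula, and the closure rules in \<open>dfn_intros\<close>
  supply such formulas from the shape of a predicate.\<close>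

primrec rename :: "(nat \<Rightarrow> nat) \<Rightarrow> fm \<Rightarrow> fm" where
  "rename r (Mem i j) = Mem (r i) (r j)"
| "rename r (Eq i j) = Eq (r i) (r j)"
| "rename r (Neg p) = Neg (rename r p)"
| "rename r (Conj p q) = Conj (rename r p) (rename r q)"
| "rename r (Forall i p) = Forall (r i) (rename r p)"

text \<open>Injectivity prevents capture: two variables sent to the same one would both change when
  a quantifier updates it.\<close>

lemma sat_rename:
  assumes "inj r"
  shows "sat E (rename r p) v \<longleftrightarrow> sat E p (v \<circ> r)"
proof (induction p arbitrary: v)
  case (Forall i p)
  have "(v(r i := a)) \<circ> r = (v \<circ> r)(i := a)" for a
    using assms by (auto simp: fun_eq_iff dest: injD)
  then have "sat E (rename r p) (v(r i := a)) \<longleftrightarrow> sat E p ((v \<circ> r)(i := a))" for a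
    by (simp only: Forall.IH)
  then show ?case by (simp only: rename.simps sat.simps)
qed (simp_all add: comp_def)

definition merge :: "(nat \<Rightarrow> 'a) \<Rightarrow> (nat \<Rightarrow> 'a) \<Rightarrow> nat \<Rightarrow> 'a" where
  "merge f g i = (if even i then f (i div 2) else g (i div 2))"

lemma merge_even: "merge f g (2 * i) = f i"
  and merge_odd: "merge f g (Suc (2 * i)) = g i"
  by (simp_all add: merge_def)

lemma merge_comp: "h \<circ> merge f g = merge (\<lambda>i. h (f i)) (\<lambda>i. h (g i))"
  by (auto simp: merge_def)

lemma inj_merge:
  assumes "inj f" "inj g" "\<And>i j. f i \<noteq> g j"
  shows "inj (merge f g)"
proof (rule injI)
  fix x y assume "merge f g x = merge f g y"
  then have "x div 2 = y div 2 \<and> (even x \<longleftrightarrow> even y)"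
    unfolding merge_def using injD[OF assms(1)] injD[OF assms(2)] assms(3) by metis
  then show "x = y" by (metis dvd_mult_div_cancel odd_two_times_div_two_succ)
qed

context set_structure
begin

text \<open>Even variables form the environment, odd ones hold the parameters of the class. A closure
  rule for a binder has the bound variable as variable 0 of its premise, de Bruijn style.\<close>

definition dfn :: "((nat \<Rightarrow> 'm) \<Rightarrow> bool) \<Rightarrow> bool" where
  "dfn P \<longleftrightarrow> (\<exists>p c. \<forall>v. P v \<longleftrightarrow> sat (\<epsilon>) p (merge v c))"

text \<open>The formulas have no terms, so definability of a class function means definability of
  its graph, with the value in variable 0 and the arguments moved up by one.\<close>

definition dft :: "((nat \<Rightarrow> 'm) \<Rightarrow> 'm) \<Rightarrow> bool" where
  "dft t \<longleftrightarrow> dfn (\<lambda>v. v 0 = t (\<lambda>i. v (Suc i)))"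

named_theorems dfn_intros

lemma dfn_not [dfn_intros]: "dfn P \<Longrightarrow> dfn (\<lambda>v. \<not> P v)"
  unfolding dfn_def by (metis sat.simps(3))

lemma dfn_and [dfn_intros]:
  assumes "dfn P" "dfn Q"
  shows "dfn (\<lambda>v. P v \<and> Q v)"
proof -
  obtain p c where p: "\<And>v. P v \<longleftrightarrow> sat (\<epsilon>) p (merge v c)" using assms(1) dfn_def by auto
  obtain q d where q: "\<And>v. Q v \<longleftrightarrow> sat (\<epsilon>) q (merge v d)" using assms(2) dfn_def by auto
  \<comment> \<open>The two formulas come with separate parameters. Both renamings fix the even
    variables; the parameters go to the variables 4i+1 for \<open>p\<close> and 4i+3 for
    \<open>q\<close>, where interleaving \<open>c\<close> and \<open>d\<close> puts them.\<close>
  define r1 :: "nat \<Rightarrow> nat" where "r1 = merge (\<lambda>i. 2 * i) (\<lambda>i. Suc (2 * (2 * i)))"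
  define r2 :: "nat \<Rightarrow> nat" where "r2 = merge (\<lambda>i. 2 * i) (\<lambda>i. Suc (2 * Suc (2 * i)))"
  have ne: "2 * i \<noteq> Suc (2 * j)" for i j :: nat by presburger
  have i1: "inj r1" and i2: "inj r2"
    unfolding r1_def r2_def by (intro inj_merge ne; simp add: inj_def)+
  define e where "e = merge c d"
  have "merge v e \<circ> r1 = merge v c" for v
    unfolding r1_def merge_comp merge_even merge_odd e_def ..
  moreover have "merge v e \<circ> r2 = merge v d" for v
    unfolding r2_def merge_comp merge_even merge_odd e_def ..
  ultimately have "P v \<and> Q v \<longleftrightarrow> sat (\<epsilon>) (Conj (rename r1 p) (rename r2 q)) (merge v e)" for v
    by (simp add: sat_rename[OF i1] sat_rename[OF i2] p q)
  then show ?thesis unfolding dfn_def by blast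
qed

lemma dfn_all [dfn_intros]:
  assumes "dfn (\<lambda>v. Q (v 0) (\<lambda>i. v (Suc i)))"
  shows "dfn (\<lambda>v. \<forall>x. Q x v)"
proof -
  obtain p c where p: "\<And>v. Q (v 0) (\<lambda>i. v (Suc i)) \<longleftrightarrow> sat (\<epsilon>) p (merge v c)"
    using assms dfn_def by auto
  \<comment> \<open>The bound variable 0 moves to the odd variable 1, the rest of the environment
    moves down by one place, and the parameters make room by moving up to the next odd
    variable.\<close>
  define r :: "nat \<Rightarrow> nat" where
    "r = merge (case_nat 1 (\<lambda>i. 2 * i)) (\<lambda>i. Suc (2 * Suc i))"
  have i: "inj r"
    unfolding r_def
  proof (rule inj_merge)
    show "case_nat 1 (\<lambda>i. 2 * i) i \<noteq> Suc (2 * Suc j)" for i j :: nat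
      by (cases i) (simp, simp only: nat.case, presburger)
  qed (auto simp: inj_def split: nat.splits)
  \<comment> \<open>Variable 1 is always overwritten by the quantified value, so the filler
    \<open>undefined\<close> is never read.\<close>
  define e where "e = case_nat undefined c"
  have "((merge v e)(1 := x)) \<circ> r = merge (case_nat x v) c" for v x
  proof -
    have "((merge v e)(1 := x)) (case_nat 1 (\<lambda>i. 2 * i) i) = case_nat x v i" for i
      by (cases i) (auto simp: merge_even)
    moreover have "((merge v e)(1 := x)) (Suc (2 * Suc i)) = c i" for i
      unfolding fun_upd_apply merge_odd by (simp add: e_def)
    ultimately show ?thesis unfolding r_def merge_comp by presburger
  qed
  then have "Q x v \<longleftrightarrow> sat (\<epsilon>) (rename r p) ((merge v e)(1 := x))" for v x
    using p[of "case_nat x v"] by (simp add: sat_rename[OF i])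
  then have "(\<forall>x. Q x v) \<longleftrightarrow> sat (\<epsilon>) (Forall 1 (rename r p)) (merge v e)" for v by simp
  then show ?thesis unfolding dfn_def by blast
qed

lemma dfn_renaming:
  assumes "inj r" "dfn P"
  shows "dfn (\<lambda>v. P (\<lambda>i. v (r i)))"
proof -
  obtain p c where p: "\<And>v. P v \<longleftrightarrow> sat (\<epsilon>) p (merge v c)" using assms(2) dfn_def by auto
  define s :: "nat \<Rightarrow> nat" where "s = merge (\<lambda>i. 2 * r i) (\<lambda>i. Suc (2 * i))"
  have "2 * i \<noteq> Suc (2 * j)" for i j :: nat by presburger
  then have "inj s"
    unfolding s_def using assms(1) by (intro inj_merge) (auto simp: inj_def)
  moreover have "merge v c \<circ> s = merge (\<lambda>i. v (r i)) c" for v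
    unfolding s_def merge_comp merge_even merge_odd ..
  ultimately show ?thesis
    unfolding dfn_def using p sat_rename[of s] by metis
qed

lemma dfn_const [dfn_intros]: "dfn (\<lambda>v. P)"
proof -
  have "dfn (\<lambda>v. True)" unfolding dfn_def
    by (rule exI[of _ "Eq 0 0"]) simp
  then show ?thesis using dfn_not[of "\<lambda>v. True"] by (cases P) auto
qed

lemma dft_var [dfn_intros]: "dft (\<lambda>v. v i)"
  unfolding dft_def dfn_def
  by (rule exI[of _ "Eq 0 (2 * Suc i)"]) (simp add: merge_def)

lemma dft_const [dfn_intros]: "dft (\<lambda>v. a)"
  unfolding dft_def dfn_def
  by (rule exI[of _ "Eq 0 1"], rule exI[of _ "\<lambda>_. a"]) (simp add: merge_def)

lemma dfn_or [dfn_intros]: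
  assumes "dfn P" "dfn Q"
  shows "dfn (\<lambda>v. P v \<or> Q v)"
proof -
  have "dfn (\<lambda>v. \<not> (\<not> P v \<and> \<not> Q v))" by (intro dfn_not dfn_and assms)
  then show ?thesis by simp
qed

lemma dfn_imp [dfn_intros]:
  assumes "dfn P" "dfn Q"
  shows "dfn (\<lambda>v. P v \<longrightarrow> Q v)"
  unfolding imp_conv_disj by (intro dfn_or dfn_not assms)

lemma dfn_iff [dfn_intros]:
  assumes "dfn P" "dfn Q"
  shows "dfn (\<lambda>v. P v \<longleftrightarrow> Q v)"
  unfolding iff_conv_conj_imp by (intro dfn_and dfn_imp assms)

lemma dfn_ex [dfn_intros]:
  assumes "dfn (\<lambda>v. Q (v 0) (\<lambda>i. v (Suc i)))"
  shows "dfn (\<lambda>v. \<exists>x. Q x v)"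
proof -
  have "dfn (\<lambda>v. \<not> (\<forall>x. \<not> Q x v))" by (intro dfn_not dfn_all assms)
  then show ?thesis by simp
qed

lemma dft_renaming:
  assumes "inj r" "dft t"
  shows "dft (\<lambda>v. t (\<lambda>i. v (r i)))"
proof -
  have "inj (case_nat 0 (\<lambda>i. Suc (r i)))"
    using assms(1) by (intro injI) (auto dest: injD split: nat.split_asm)
  then show ?thesis
    using dfn_renaming[OF _ assms(2)[unfolded dft_def]] unfolding dft_def by fastforce
qed

lemma dft_shift: "dft t \<Longrightarrow> dft (\<lambda>v. t (\<lambda>i. v (Suc i)))"
  by (rule dft_renaming) simp_all

text \<open>Substitution of terms, done by naming their values with quantifiers. The value of
  \<open>t\<close> is named under one more binder than that of \<open>s\<close>, so \<open>t\<close>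
  is shifted once more.\<close>

lemma dfn_lift2:
  assumes R: "dfn (\<lambda>v. R (v 0) (v 1))" and t: "dft t" and s: "dft s"
  shows "dfn (\<lambda>v. R (t v) (s v))"
proof -
  have "dfn (\<lambda>v. \<exists>y. y = s v \<and> (\<exists>x. x = t v \<and> R x y))"
    by (intro dfn_ex dfn_and)
      (use R s dft_shift[OF t] in \<open>simp_all add: dft_def\<close>)
  then show ?thesis by simp
qed

lemma dfn_lift3:
  assumes R: "dfn (\<lambda>v. R (v 0) (v 1) (v 2))" and t: "dft t" and s: "dft s" and u: "dft u"
  shows "dfn (\<lambda>v. R (t v) (s v) (u v))"
proof -
  have "dfn (\<lambda>v. \<exists>z. z = u v \<and> (\<exists>y. y = s v \<and> (\<exists>x. x = t v \<and> R x y z)))"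
    by (intro dfn_ex dfn_and)
      (use R u dft_shift[OF s] dft_shift[OF dft_shift[OF t]] in
        \<open>simp_all add: dft_def numeral_2_eq_2\<close>)
  then show ?thesis by simp
qed

lemma dft_lift2:
  assumes f: "dfn (\<lambda>v. v 0 = f (v 1) (v 2))" and t: "dft t" and s: "dft s"
  shows "dft (\<lambda>v. f (t v) (s v))"
  unfolding dft_def
  by (rule dfn_lift3[of "\<lambda>z x y. z = f x y", OF f dft_var[of 0]
      dft_renaming[of Suc, OF _ t] dft_renaming[of Suc, OF _ s]]) simp_all

lemma dfn_mem [dfn_intros]: "dft t \<Longrightarrow> dft s \<Longrightarrow> dfn (\<lambda>v. t v \<epsilon> s v)"
proof (rule dfn_lift2[of "(\<epsilon>)"])
  show "dfn (\<lambda>v. v 0 \<epsilon> v 1)" unfolding dfn_def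
    by (rule exI[of _ "Mem 0 2"]) (simp add: merge_def)
qed

lemma dfn_eq [dfn_intros]: "dft t \<Longrightarrow> dft s \<Longrightarrow> dfn (\<lambda>v. t v = s v)"
proof (rule dfn_lift2[of "(=)"])
  show "dfn (\<lambda>v. v 0 = v 1)" unfolding dfn_def
    by (rule exI[of _ "Eq 0 2"]) (simp add: merge_def)
qed

lemma dfn_in_ext [dfn_intros]: "dft t \<Longrightarrow> dft s \<Longrightarrow> dfn (\<lambda>v. t v \<in> ext (s v))"
  unfolding ext_def by (simp add: dfn_mem)

lemma dfn_ball [dfn_intros]:
  "dft s \<Longrightarrow> dfn (\<lambda>v. Q (v 0) (\<lambda>i. v (Suc i))) \<Longrightarrow> dfn (\<lambda>v. \<forall>x\<in>ext (s v). Q x v)"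
  unfolding Ball_def by (intro dfn_intros dft_shift)

lemma dfn_bex [dfn_intros]:
  "dft s \<Longrightarrow> dfn (\<lambda>v. Q (v 0) (\<lambda>i. v (Suc i))) \<Longrightarrow> dfn (\<lambda>v. \<exists>x\<in>ext (s v). Q x v)"
  unfolding Bex_def by (intro dfn_intros dft_shift)

lemma dfn_subset [dfn_intros]: "dft s \<Longrightarrow> dft t \<Longrightarrow> dfn (\<lambda>v. ext (s v) \<subseteq> ext (t v))"
  unfolding subset_eq by (intro dfn_intros dft_shift)

lemma inj_case_nat: "inj (case_nat 0 (\<lambda>i. Suc (Suc i)))"
  by (rule injI) (auto split: nat.splits)

lemma dfn_ex1 [dfn_intros]:
  assumes "dfn (\<lambda>v. Q (v 0) (\<lambda>i. v (Suc i)))"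
  shows "dfn (\<lambda>v. \<exists>!x. Q x v)"
proof -
  \<comment> \<open>Under the two binders of \<open>\<exists>x. \<forall>y\<close>, the predicate
    \<open>Q\<close> sees \<open>y\<close> as variable 0 and has to skip \<open>x\<close>, hence the
    renaming that jumps over 1.\<close>
  have "dfn (\<lambda>v. Q (v 0) (\<lambda>i. v (Suc (Suc i))))"
    using dfn_renaming[of "case_nat 0 (\<lambda>i. Suc (Suc i))", OF inj_case_nat assms]
    by (simp only: nat.case)
  then have "dfn (\<lambda>v. \<exists>x. \<forall>y. Q y v \<longleftrightarrow> y = x)"
    by (intro dfn_ex dfn_all dfn_iff dfn_eq dft_var)
  moreover have "(\<exists>!x. Q x v) \<longleftrightarrow> (\<exists>x. \<forall>y. Q y v \<longleftrightarrow> y = x)" for v by (auto 4 3)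
  ultimately show ?thesis by simp
qed

end

section \<open>Sets, functions and natural numbers of the structure\<close>

context ZF
begin

lemma mem_ext [simp]: "x \<in> ext a \<longleftrightarrow> x \<epsilon> a"
  by (simp add: ext_def)

lemma ext_inject [simp]: "ext a = ext b \<longleftrightarrow> a = b"
  using Extensionality by blast

lemma extensionality: "(\<And>x. x \<epsilon> a \<longleftrightarrow> x \<epsilon> b) \<Longrightarrow> a = b"
  using Extensionality by (auto simp: ext_def)

lemma set_of_ext [simp]: "set_of (ext a) = a"
  unfolding set_of_def by (rule the_equality) auto

lemma ext_set_of: "ext a = A \<Longrightarrow> ext (set_of A) = A"
  using set_of_ext by auto

section \<open>Separation for definable predicates\<close>

lemma separation:
  assumes "dfn (\<lambda>v. Q (v 0) (\<lambda>i. v (Suc i)))"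
  shows "\<exists>b. ext b = {x \<in> ext a. Q x v}"
proof -
  obtain p c where p: "\<And>v. Q (v 0) (\<lambda>i. v (Suc i)) \<longleftrightarrow> sat (\<epsilon>) p (merge v c)"
    using assms unfolding dfn_def by auto
  have "(merge (case_nat a v) c)(0 := x) = merge (case_nat x v) c" for x
    by (auto simp: fun_eq_iff merge_def elim!: evenE split: nat.split)
  then have "Q x v \<longleftrightarrow> sat (\<epsilon>) p ((merge (case_nat a v) c)(0 := x))" for x
    using p[of "case_nat x v"] by simp
  then show ?thesis using Separation[rule_format, of a p "merge (case_nat a v) c"] by simp
qed

text \<open>Used only with definable \<open>P\<close>; otherwise the class may have no counterpart
  among the elements, and \<open>set_of\<close> would be unspecified.\<close>

definition Sep :: "'m \<Rightarrow> ('m \<Rightarrow> bool) \<Rightarrow> 'm" where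
  "Sep a P = set_of {x \<in> ext a. P x}"

lemma mem_Sep_env:
  assumes "dfn (\<lambda>v. Q (v 0) (\<lambda>i. v (Suc i)))"
  shows "x \<epsilon> Sep a (\<lambda>x. Q x v) \<longleftrightarrow> x \<epsilon> a \<and> Q x v"
proof -
  obtain b where "ext b = {x \<in> ext a. Q x v}" using separation[OF assms] by blast
  then have "ext (Sep a (\<lambda>x. Q x v)) = {x \<in> ext a. Q x v}" unfolding Sep_def by (rule ext_set_of)
  then show ?thesis using mem_ext by blast
qed

lemma mem_Sep: "dfn (\<lambda>v. P (v 0)) \<Longrightarrow> x \<epsilon> Sep a P \<longleftrightarrow> x \<epsilon> a \<and> P x"
  using mem_Sep_env[of "\<lambda>x v. P x"] by simp

lemma dft_Sep [dfn_intros]: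
  assumes "dft s" and Q: "dfn (\<lambda>v. Q (v 0) (\<lambda>i. v (Suc i)))"
  shows "dft (\<lambda>v. Sep (s v) (\<lambda>z. Q z v))"
proof -
  have "y = Sep (s v) (\<lambda>z. Q z v) \<longleftrightarrow> (\<forall>z. z \<epsilon> y \<longleftrightarrow> z \<epsilon> s v \<and> Q z v)" for y v
    using mem_Sep_env[OF Q, of _ "s v" v] extensionality[of y] by blast
  moreover have "dfn (\<lambda>v. \<forall>z. z \<epsilon> v 0 \<longleftrightarrow> z \<epsilon> s (\<lambda>i. v (Suc i)) \<and> Q z (\<lambda>i. v (Suc i)))"
    using dfn_renaming[OF inj_case_nat Q]
    by (intro dfn_all dfn_iff dfn_and dfn_mem dft_var dft_shift assms(1)) simp
  ultimately show ?thesis unfolding dft_def by simp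
qed

section \<open>Pairs, power sets and products\<close>

lemma ext_upair [simp]: "ext (set_of {a, b}) = {a, b}"
  using Pairing ext_set_of by blast

lemma ext_single [simp]: "ext (set_of {a}) = {a}"
  using ext_upair[of a a] by simp

lemma upair_eq: "set_of {a, b} = set_of {c, d} \<longleftrightarrow> {a, b} = {c, d}"
  using ext_upair by metis

lemma pair_eq [simp]: "pair a b = pair c d \<longleftrightarrow> a = c \<and> b = d"
proof -
  have 0: "set_of {a} = set_of {c} \<longleftrightarrow> a = c" for a c
    using upair_eq[of a a c c] by auto
  have 1: "set_of {a} = set_of {c, d} \<longleftrightarrow> a = c \<and> a = d" for a c d
    using upair_eq[of a a c d] by auto
  have 2: "set_of {a, b} = set_of {c} \<longleftrightarrow> a = c \<and> b = c" for a b c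
    using upair_eq[of a b c c] by auto
  have 3: "set_of {a, b} = set_of {c, d} \<longleftrightarrow> a = c \<and> b = d \<or> a = d \<and> b = c"
    unfolding upair_eq doubleton_eq_iff ..
  have "pair a b = pair c d \<longleftrightarrow> set_of {a} = set_of {c} \<and> set_of {a, b} = set_of {c, d} \<or>
      set_of {a} = set_of {c, d} \<and> set_of {a, b} = set_of {c}"
    unfolding pair_def upair_eq doubleton_eq_iff ..
  then show ?thesis unfolding 0 1 2 3 by blast
qed

lemma mem_upair: "z = set_of {a, b} \<longleftrightarrow> (\<forall>w. w \<epsilon> z \<longleftrightarrow> w = a \<or> w = b)"
  by (metis ext_upair extensionality insert_iff mem_ext singletonD)

text \<open>Unfolds Kuratowski pairs into a formula in membership alone, since the
  \<open>set_of\<close> in \<open>pair\<close> is not itself expressible as a term of a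
  formula.\<close>

lemma pair_graph:
  "p = pair a b \<longleftrightarrow> (\<forall>z. z \<epsilon> p \<longleftrightarrow> (\<forall>w. w \<epsilon> z \<longleftrightarrow> w = a) \<or> (\<forall>w. w \<epsilon> z \<longleftrightarrow> w = a \<or> w = b))"
  unfolding pair_def mem_upair[of p] using mem_upair mem_upair[of _ a a, simplified] by simp

lemma dft_pair [dfn_intros]: "dft t \<Longrightarrow> dft s \<Longrightarrow> dft (\<lambda>v. pair (t v) (s v))"
proof (rule dft_lift2[of pair])
  show "dfn (\<lambda>v. v 0 = pair (v 1) (v 2))"
    unfolding pair_graph by (intro dfn_intros)
qed

lemma ext_pow [simp]: "ext (pow A) = {B. ext B \<subseteq> ext A}"
  unfolding pow_def using Powerset ext_set_of by blast

lemma mem_pow [simp]: "B \<epsilon> pow A \<longleftrightarrow> ext B \<subseteq> ext A"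
  using ext_pow mem_ext by blast

lemma ext_cprod: "ext (cprod A B) = {p. \<exists>a\<in>ext A. \<exists>b\<in>ext B. p = pair a b}"
proof -
  obtain u where u: "ext u = ext A \<union> ext B"
    using Union[rule_format, of "set_of {A, B}"] by auto
  \<comment> \<open>Kuratowski pairs over \<open>A\<close> and \<open>B\<close> live two power sets
    above the union \<open>u\<close>, which bounds the class so that Separation applies.\<close>
  have "pair a b \<epsilon> pow (pow u)" if "a \<epsilon> A" "b \<epsilon> B" for a b
  proof -
    have "ext (pair a b) = {set_of {a}, set_of {a, b}}" by (simp add: pair_def)
    then show ?thesis using that u by auto
  qed
  moreover have "\<exists>c. ext c = {p \<in> ext (pow (pow u)). \<exists>a\<in>ext A. \<exists>b\<in>ext B. p = pair a b}"
    by (rule separation[of "\<lambda>p v. \<exists>a\<in>ext A. \<exists>b\<in>ext B. p = pair a b"]) (intro dfn_intros)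
  ultimately have "\<exists>c. ext c = {p. \<exists>a\<in>ext A. \<exists>b\<in>ext B. p = pair a b}"
    by (smt (verit) Collect_cong mem_ext)
  then show ?thesis unfolding cprod_def using ext_set_of by blast
qed

lemma mem_cprod: "p \<epsilon> cprod A B \<longleftrightarrow> (\<exists>a b. a \<epsilon> A \<and> b \<epsilon> B \<and> p = pair a b)"
  using ext_cprod[of A B] mem_ext by blast

lemma pair_mem_cprod [simp]: "pair a b \<epsilon> cprod A B \<longleftrightarrow> a \<epsilon> A \<and> b \<epsilon> B"
  using mem_cprod by auto

lemma dft_cprod [dfn_intros]: "dft t \<Longrightarrow> dft s \<Longrightarrow> dft (\<lambda>v. cprod (t v) (s v))"
proof (rule dft_lift2[of cprod])
  have "c = cprod A B \<longleftrightarrow> (\<forall>p. p \<epsilon> c \<longleftrightarrow> (\<exists>a b. a \<epsilon> A \<and> b \<epsilon> B \<and> p = pair a b))" for c A B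
    using mem_cprod extensionality by metis
  then show "dfn (\<lambda>v. v 0 = cprod (v 1) (v 2))"
    by (simp only:) (intro dfn_intros)
qed

section \<open>Relations and functions as elements of the structure\<close>

definition rel :: "'m \<Rightarrow> 'm \<Rightarrow> ('m \<Rightarrow> 'm \<Rightarrow> bool) \<Rightarrow> 'm" where
  "rel A B R = Sep (cprod A B) (\<lambda>p. \<exists>a b. p = pair a b \<and> R a b)"

lemma mem_rel:
  assumes "dfn (\<lambda>v. R (v 0) (v 1))"
  shows "p \<epsilon> rel A B R \<longleftrightarrow> (\<exists>a b. p = pair a b \<and> a \<epsilon> A \<and> b \<epsilon> B \<and> R a b)"
proof -
  have "dfn (\<lambda>v. \<exists>a b. v 0 = pair a b \<and> R a b)"
    by (intro dfn_intros dfn_lift2[of R, OF assms])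
  from mem_Sep[OF this] show ?thesis unfolding rel_def mem_cprod by auto
qed

lemma pair_mem_rel:
  "dfn (\<lambda>v. R (v 0) (v 1)) \<Longrightarrow> pair a b \<epsilon> rel A B R \<longleftrightarrow> a \<epsilon> A \<and> b \<epsilon> B \<and> R a b"
  using mem_rel by auto

lemma dfn_is_fun [dfn_intros]:
  "dft f \<Longrightarrow> dft A \<Longrightarrow> dft B \<Longrightarrow> dfn (\<lambda>v. is_fun (f v) (A v) (B v))"
  unfolding is_fun_def by (intro dfn_intros dft_shift)

text \<open>Where \<open>f\<close> is not single-valued, \<open>app f a\<close> is an unspecified and hence not definable value.\<close>

definition ap :: "'m \<Rightarrow> 'm \<Rightarrow> 'm" where
  "ap f a = (if \<exists>!b. pair a b \<epsilon> f then app f a else f)"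

lemma dft_ap [dfn_intros]: "dft t \<Longrightarrow> dft s \<Longrightarrow> dft (\<lambda>v. ap (t v) (s v))"
proof (rule dft_lift2[of ap])
  have "y = ap f a \<longleftrightarrow> (if \<exists>!b. pair a b \<epsilon> f then pair a y \<epsilon> f else y = f)" for y f a
    unfolding ap_def app_def using theI'[of "\<lambda>b. pair a b \<epsilon> f"] by auto
  then have "y = ap f a \<longleftrightarrow>
      (\<exists>!b. pair a b \<epsilon> f) \<and> pair a y \<epsilon> f \<or> \<not> (\<exists>!b. pair a b \<epsilon> f) \<and> y = f" for y f a
    by simp
  then show "dfn (\<lambda>v. v 0 = ap (v 1) (v 2))" by (simp only:) (intro dfn_intros)
qed

lemma is_fun_ap:
  assumes "is_fun f A B" "a \<epsilon> A"
  shows "app f a = ap f a" "ap f a \<epsilon> B" "pair a b \<epsilon> f \<longleftrightarrow> b = ap f a"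
proof -
  have ex: "\<exists>!b. pair a b \<epsilon> f" using assms by (simp add: is_fun_def)
  then show 1: "app f a = ap f a" by (simp add: ap_def)
  show "pair a b \<epsilon> f \<longleftrightarrow> b = ap f a" for b
    unfolding 1[symmetric] app_def using theI'[OF ex] ex by blast
  then have "pair a (ap f a) \<epsilon> f" by blast
  then have "pair a (ap f a) \<in> ext (cprod A B)" using assms(1) unfolding is_fun_def by auto
  then show "ap f a \<epsilon> B" by simp
qed

lemma is_fun_mem:
  assumes "is_fun f A B"
  shows "pair a b \<epsilon> f \<longleftrightarrow> a \<epsilon> A \<and> b = ap f a"
proof -
  have "a \<epsilon> A" if "pair a b \<epsilon> f"
  proof -
    have "pair a b \<in> ext (cprod A B)" using that assms unfolding is_fun_def by auto
    then show ?thesis by simp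
  qed
  then show ?thesis using is_fun_ap(3)[OF assms] by blast
qed

lemma is_fun_rel:
  assumes "dfn (\<lambda>v. R (v 0) (v 1))" "\<And>a. a \<epsilon> A \<Longrightarrow> \<exists>!b. b \<epsilon> B \<and> R a b"
  shows "is_fun (rel A B R) A B"
  unfolding is_fun_def using assms(2) by (auto simp: mem_rel[OF assms(1)])

definition lam :: "'m \<Rightarrow> 'm \<Rightarrow> ('m \<Rightarrow> 'm) \<Rightarrow> 'm" where
  "lam A B F = rel A B (\<lambda>a b. b = F a)"

lemma
  assumes "dft (\<lambda>v. F (v 0))" and F: "\<And>a. a \<epsilon> A \<Longrightarrow> F a \<epsilon> B"
  shows is_fun_lam: "is_fun (lam A B F) A B" and ap_lam: "a \<epsilon> A \<Longrightarrow> ap (lam A B F) a = F a"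
proof -
  have d: "dfn (\<lambda>v. v 1 = F (v 0))" by (intro dfn_intros assms)
  show f: "is_fun (lam A B F) A B"
    unfolding lam_def by (rule is_fun_rel[OF d]) (use F in auto)
  show "ap (lam A B F) a = F a" if "a \<epsilon> A"
    using is_fun_ap(3)[OF f that, of "F a"] that F by (simp add: lam_def pair_mem_rel[OF d])
qed

lemma fun_ext:
  assumes "is_fun f A B" "is_fun g A C" "\<And>a. a \<epsilon> A \<Longrightarrow> ap f a = ap g a"
  shows "f = g"
proof (rule extensionality)
  have *: "pair a b \<epsilon> f \<longleftrightarrow> pair a b \<epsilon> g" for a b
    unfolding is_fun_mem[OF assms(1)] is_fun_mem[OF assms(2)] using assms(3) by auto
  have "\<exists>a b. p = pair a b" if "p \<epsilon> h" "is_fun h A D" for p h D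
  proof -
    have "p \<in> ext h" "ext h \<subseteq> ext (cprod A D)" using that by (simp_all add: is_fun_def)
    then have "p \<in> ext (cprod A D)" by (rule subsetD[rotated])
    then show ?thesis unfolding mem_ext mem_cprod by blast
  qed
  from this[OF _ assms(1)] this[OF _ assms(2)] show "p \<epsilon> f \<longleftrightarrow> p \<epsilon> g" for p
    using * by blast
qed

lemma mem_funs: "f \<epsilon> funs A B \<longleftrightarrow> is_fun f A B"
proof -
  have "\<exists>c. ext c = {f \<in> ext (pow (cprod A B)). is_fun f A B}"
    by (rule separation[of "\<lambda>f v. is_fun f A B"]) (intro dfn_intros)
  moreover have "{f \<in> ext (pow (cprod A B)). is_fun f A B} = {f. is_fun f A B}"
    by (auto simp: is_fun_def)
  ultimately have "ext (funs A B) = {f. is_fun f A B}"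
    unfolding funs_def using ext_set_of by metis
  then show ?thesis using mem_ext by blast
qed

section \<open>Natural numbers of the structure\<close>

lemma mem_succ [simp]: "k \<epsilon> succ n \<longleftrightarrow> k = n \<or> k \<epsilon> n"
proof -
  obtain u where "ext u = ext n \<union> ext (set_of {n})"
    using Union[rule_format, of "set_of {n, set_of {n}}"] by auto
  then have "ext u = insert n (ext n)" by auto
  then have "ext (succ n) = insert n (ext n)" unfolding succ_def by (rule ext_set_of)
  then show ?thesis using mem_ext by blast
qed

lemma ext_succ: "ext (succ n) = insert n (ext n)" by auto

lemma dft_succ [dfn_intros]:
  assumes "dft t"
  shows "dft (\<lambda>v. succ (t v))"
proof -
  have "y = succ n \<longleftrightarrow> (\<forall>k. k \<epsilon> y \<longleftrightarrow> k = n \<or> k \<epsilon> n)" for y n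
    using extensionality by (metis mem_succ)
  then show ?thesis
    unfolding dft_def by (simp only:) (intro dfn_intros dft_shift assms)
qed

definition nought :: 'm where
  "nought = set_of {}"

lemma not_mem_zero [simp]: "\<not> x \<epsilon> nought"
proof -
  obtain b :: 'm where "ext b = {x \<in> ext undefined. False}"
    using separation[of "\<lambda>x v. False"] dfn_const by blast
  then have "ext b = {}" by simp
  then have "ext nought = {}" unfolding nought_def by (rule ext_set_of)
  then show ?thesis using mem_ext[of x nought] by simp
qed

lemma ext_empty: "ext z = {} \<longleftrightarrow> z = nought"
  by (metis empty_iff extensionality mem_ext not_mem_zero subsetI subset_empty)

lemma is_inductive_iff: "is_inductive w \<longleftrightarrow> nought \<epsilon> w \<and> (\<forall>n. n \<epsilon> w \<longrightarrow> succ n \<epsilon> w)"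
  unfolding is_inductive_def ext_empty ext_succ[symmetric] ext_inject by auto

lemma mem_omega: "n \<epsilon> omega \<longleftrightarrow> (\<forall>w. is_inductive w \<longrightarrow> n \<epsilon> w)"
proof -
  obtain w where w: "is_inductive w" using Infinity by blast
  have "\<exists>c. ext c = {n \<in> ext w. \<forall>w. is_inductive w \<longrightarrow> n \<epsilon> w}"
    unfolding is_inductive_iff
    by (rule separation[of "\<lambda>n v. \<forall>w. nought \<epsilon> w \<and> (\<forall>n. n \<epsilon> w \<longrightarrow> succ n \<epsilon> w) \<longrightarrow> n \<epsilon> w"])
      (intro dfn_intros)
  moreover have "{n \<in> ext w. \<forall>w. is_inductive w \<longrightarrow> n \<epsilon> w} = {n. \<forall>w. is_inductive w \<longrightarrow> n \<epsilon> w}"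
    using w by auto
  ultimately have "ext omega = {n. \<forall>w. is_inductive w \<longrightarrow> n \<epsilon> w}"
    unfolding omega_def using ext_set_of by metis
  then show ?thesis using mem_ext by blast
qed

lemma zero_omega [simp]: "nought \<epsilon> omega" and succ_omega [simp]: "n \<epsilon> omega \<Longrightarrow> succ n \<epsilon> omega"
  unfolding mem_omega is_inductive_iff by auto

text \<open>The elements of \<open>omega\<close> that satisfy \<open>P\<close> form an inductive
  set, which exists because \<open>P\<close> is definable. For undefinable \<open>P\<close> the rule
  can fail, as \<open>omega\<close> may have nonstandard elements.\<close>

lemma omega_induct [consumes 2, case_names zero succ]:
  assumes "dfn (\<lambda>v. P (v 0))" "n \<epsilon> omega"
    and "P nought" "\<And>n. n \<epsilon> omega \<Longrightarrow> P n \<Longrightarrow> P (succ n)"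
  shows "P n"
proof -
  note m = mem_Sep[OF assms(1)]
  have "is_inductive (Sep omega P)" unfolding is_inductive_iff m using assms(3,4) by auto
  then show ?thesis using assms(2) mem_omega m by blast
qed

lemma omega_trans:
  assumes "n \<epsilon> omega" "m \<epsilon> n"
  shows "k \<epsilon> m \<Longrightarrow> k \<epsilon> n" "m \<epsilon> omega"
proof -
  have "\<forall>m. m \<epsilon> n \<longrightarrow> m \<epsilon> omega \<and> (\<forall>k. k \<epsilon> m \<longrightarrow> k \<epsilon> n)"
    by (rule omega_induct[OF _ assms(1)]) (intro dfn_intros, auto)
  then show "k \<epsilon> m \<Longrightarrow> k \<epsilon> n" "m \<epsilon> omega" using assms by auto
qed

lemma not_mem_self [simp]: "\<not> x \<epsilon> x"
proof
  assume h: "x \<epsilon> x"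
  then show False using Foundation[rule_format, of "set_of {x}"] by auto
qed

lemma not_mem_sym: "x \<epsilon> y \<Longrightarrow> \<not> y \<epsilon> x"
  using Foundation[rule_format, of "set_of {x, y}"] by auto

lemma succ_neq_zero [simp]: "succ n \<noteq> nought" "nought \<noteq> succ n"
  by (metis mem_succ not_mem_zero)+

lemma succ_inject [simp]: "succ m = succ n \<longleftrightarrow> m = n"
  by (metis mem_succ not_mem_sym)

lemma omega_cases: "n \<epsilon> omega \<Longrightarrow> n = nought \<or> (\<exists>m. m \<epsilon> omega \<and> n = succ m)"
  by (rule omega_induct[of "\<lambda>n. n = nought \<or> (\<exists>m. m \<epsilon> omega \<and> n = succ m)"])
    (intro dfn_intros, auto)

lemma omega_zero_mem: "n \<epsilon> omega \<Longrightarrow> n = nought \<or> nought \<epsilon> n"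
  by (rule omega_induct[of "\<lambda>n. n = nought \<or> nought \<epsilon> n"]) (intro dfn_intros, auto)

lemma omega_succ_mem: "n \<epsilon> omega \<Longrightarrow> m \<epsilon> n \<Longrightarrow> succ m = n \<or> succ m \<epsilon> n"
proof -
  assume "n \<epsilon> omega"
  then have "\<forall>m. m \<epsilon> n \<longrightarrow> succ m = n \<or> succ m \<epsilon> n"
    by (rule omega_induct[of "\<lambda>n. \<forall>m. m \<epsilon> n \<longrightarrow> succ m = n \<or> succ m \<epsilon> n", rotated])
      (auto intro!: dfn_intros)
  then show "m \<epsilon> n \<Longrightarrow> succ m = n \<or> succ m \<epsilon> n" by blast
qed

lemma omega_linear:
  assumes "n \<epsilon> omega" "m \<epsilon> omega"
  shows "m \<epsilon> n \<or> m = n \<or> n \<epsilon> m"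
proof -
  have "\<forall>m. m \<epsilon> omega \<longrightarrow> m \<epsilon> n \<or> m = n \<or> n \<epsilon> m"
  proof (rule omega_induct[OF _ assms(1)])
    show "dfn (\<lambda>v. \<forall>m. m \<epsilon> omega \<longrightarrow> m \<epsilon> v 0 \<or> m = v 0 \<or> v 0 \<epsilon> m)" by (intro dfn_intros)
    show "\<forall>m. m \<epsilon> omega \<longrightarrow> m \<epsilon> nought \<or> m = nought \<or> nought \<epsilon> m" using omega_zero_mem by auto
    show "\<forall>m. m \<epsilon> omega \<longrightarrow> m \<epsilon> succ n \<or> m = succ n \<or> succ n \<epsilon> m"
      if "n \<epsilon> omega" "\<forall>m. m \<epsilon> omega \<longrightarrow> m \<epsilon> n \<or> m = n \<or> n \<epsilon> m" for n
      using that omega_succ_mem by auto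
  qed
  then show ?thesis using assms by blast
qed

lemma omega_total:
  assumes "n \<epsilon> omega" "m \<epsilon> omega"
  shows "(\<forall>k. k \<epsilon> n \<longrightarrow> k \<epsilon> m) \<or> (\<forall>k. k \<epsilon> m \<longrightarrow> k \<epsilon> n)"
proof -
  consider "m \<epsilon> n" | "m = n" | "n \<epsilon> m" using omega_linear[OF assms] by auto
  then show ?thesis
    by cases (simp_all add: omega_trans(1)[OF assms(1)] omega_trans(1)[OF assms(2)])
qed

lemma omega_subset:
  assumes "n \<epsilon> omega" "m \<epsilon> omega" "\<And>k. k \<epsilon> m \<Longrightarrow> k \<epsilon> n"
  shows "m = n \<or> m \<epsilon> n"
  using omega_linear[OF assms(1,2)] assms(3)[of n] not_mem_self by auto

text \<open>The graph is the smallest relation between \<open>omega\<close> and \<open>A\<close>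
  that contains the start and is closed under the step. Minimality yields uniqueness of values:
  deleting a pair other than the required one would leave a smaller closed relation.\<close>

lemma omega_recursion:
  assumes dF: "dft (\<lambda>v. F (v 0) (v 1))" and a: "a \<epsilon> A"
    and F: "\<And>n x. n \<epsilon> omega \<Longrightarrow> x \<epsilon> A \<Longrightarrow> F n x \<epsilon> A"
  obtains h where "is_fun h omega A" "ap h nought = a"
    "\<And>n. n \<epsilon> omega \<Longrightarrow> ap h (succ n) = F n (ap h n)"
proof -
  define cld where "cld I \<longleftrightarrow> pair nought a \<epsilon> I \<and>
    (\<forall>n x. n \<epsilon> omega \<and> x \<epsilon> A \<and> pair n x \<epsilon> I \<longrightarrow> pair (succ n) (F n x) \<epsilon> I)" for I
  have dF': "dft t \<Longrightarrow> dft s \<Longrightarrow> dft (\<lambda>v. F (t v) (s v))" for t s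
  proof (rule dft_lift2[of F])
    show "dfn (\<lambda>v. v 0 = F (v 1) (v 2))"
      using dF unfolding dft_def by (simp add: numeral_2_eq_2)
  qed
  define H where "H = Sep (cprod omega A) (\<lambda>p. \<forall>I. cld I \<longrightarrow> p \<epsilon> I)"
  have mH: "p \<epsilon> H \<longleftrightarrow> p \<epsilon> cprod omega A \<and> (\<forall>I. cld I \<longrightarrow> p \<epsilon> I)" for p
    unfolding H_def cld_def by (rule mem_Sep) (intro dfn_intros dF')
  have H: "cld H" unfolding cld_def mH using a F by (auto simp: cld_def)
  have un: "\<exists>!y. pair n y \<epsilon> H" if n: "n \<epsilon> omega" for n
  proof (rule omega_induct[OF _ n])
    show "dfn (\<lambda>v. \<exists>!y. pair (v 0) y \<epsilon> H)" by (intro dfn_intros)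
    have mS: "p \<epsilon> Sep H (\<lambda>p. p \<noteq> q) \<longleftrightarrow> p \<epsilon> H \<and> p \<noteq> q" for p q
      by (rule mem_Sep) (intro dfn_intros)
    have rm: "\<not> q \<epsilon> H" if "cld (Sep H (\<lambda>p. p \<noteq> q))" for q
      using that mH[of q] mS[of q q] by blast
    show "\<exists>!y. pair nought y \<epsilon> H"
    proof (rule ex1I[of _ a])
      show "y = a" if "pair nought y \<epsilon> H" for y
        using rm[of "pair nought y"] H that unfolding cld_def mS by auto
    qed (use H cld_def in auto)
    show "\<exists>!y. pair (succ n) y \<epsilon> H" if n: "n \<epsilon> omega" and ex: "\<exists>!y. pair n y \<epsilon> H" for n
    proof -
      obtain x where x: "pair n x \<epsilon> H" using ex by blast
      show ?thesis
      proof (rule ex1I[of _ "F n x"])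
        show "pair (succ n) (F n x) \<epsilon> H" using H x n mH unfolding cld_def by auto
        show "y = F n x" if "pair (succ n) y \<epsilon> H" for y
          using rm[of "pair (succ n) y"] H that x ex unfolding cld_def mS by auto
      qed
    qed
  qed
  have fH: "is_fun H omega A"
    unfolding is_fun_def using mH un by auto
  show ?thesis
  proof (rule that[OF fH])
    show "ap H nought = a" using is_fun_mem[OF fH, of nought a] H unfolding cld_def by auto
    show "ap H (succ n) = F n (ap H n)" if "n \<epsilon> omega" for n
      using is_fun_mem[OF fH, of "succ n" "F n (ap H n)"] is_fun_mem[OF fH, of n "ap H n"]
        H that is_fun_ap(2)[OF fH that] unfolding cld_def by auto
  qed
qed


lemma ball_ext [simp]: "(\<forall>x\<in>ext a. P x) \<longleftrightarrow> (\<forall>x. x \<epsilon> a \<longrightarrow> P x)"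
  and bex_ext [simp]: "(\<exists>x\<in>ext a. P x) \<longleftrightarrow> (\<exists>x. x \<epsilon> a \<and> P x)"
  unfolding Ball_def Bex_def mem_ext by (rule refl)+

lemma ext_subset [simp]: "ext a \<subseteq> S \<longleftrightarrow> (\<forall>x. x \<epsilon> a \<longrightarrow> x \<in> S)"
  unfolding subset_eq by simp

section \<open>Enumerating pairs of natural numbers\<close>

lemma square_enumeration:
  obtains c where "is_fun c omega (cprod omega omega)"
    "\<And>i j. i \<epsilon> omega \<Longrightarrow> j \<epsilon> omega \<Longrightarrow> \<exists>k. k \<epsilon> omega \<and> ap c k = pair i j"
proof -
  text \<open>The walk goes through the shells \<open>max i j = n\<close>, each one from \<open>(n, 0)\<close> up to
    \<open>(n, n)\<close> and then down to \<open>(0, n)\<close>.\<close>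
  let ?S = "\<lambda>p q. \<exists>i j. p = pair i j \<and> (j \<epsilon> i \<and> q = pair i (succ j) \<or>
    \<not> j \<epsilon> i \<and> (\<exists>i'. i = succ i' \<and> q = pair i' j) \<or>
    i = nought \<and> q = pair (succ j) nought)"
  have d: "dfn (\<lambda>v. ?S (v 0) (v 1))" by (intro dfn_intros)
  let ?W = "cprod omega omega"
  define st where "st = rel ?W ?W ?S"
  have st: "is_fun st ?W ?W" unfolding st_def
  proof (rule is_fun_rel[OF d])
    fix p assume "p \<epsilon> ?W"
    then obtain i j where p: "p = pair i j" "i \<epsilon> omega" "j \<epsilon> omega" unfolding mem_cprod by blast
    show "\<exists>!q. q \<epsilon> ?W \<and> ?S p q"
      using omega_cases[OF p(2)] p omega_trans[OF p(2)] by (cases "j \<epsilon> i") auto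
  qed
  have ap_st: "ap st p = q" if "p \<epsilon> ?W" "q \<epsilon> ?W" "?S p q" for p q
    using is_fun_ap(3)[OF st that(1), of q] that mem_rel[OF d, of "pair p q" ?W ?W]
    unfolding st_def by blast
  obtain c where c: "is_fun c omega ?W" "ap c nought = pair nought nought"
    "\<And>n. n \<epsilon> omega \<Longrightarrow> ap c (succ n) = ap st (ap c n)"
    by (rule omega_recursion[of "\<lambda>n. ap st" "pair nought nought" ?W])
      (use is_fun_ap(2)[OF st] in \<open>auto intro!: dfn_intros\<close>)
  define R where "R p \<longleftrightarrow> (\<exists>k. k \<epsilon> omega \<and> ap c k = p)" for p
  have dR: "dft t \<Longrightarrow> dfn (\<lambda>v. R (t v))" for t
    unfolding R_def by (intro dfn_intros dft_shift)
  have R_step: "R q" if h: "R p" "q \<epsilon> ?W" "?S p q" for p q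
  proof -
    obtain k where k: "k \<epsilon> omega" "ap c k = p" using h(1) unfolding R_def by blast
    have "p \<epsilon> ?W" using is_fun_ap(2)[OF c(1) k(1)] k(2) by simp
    then have "ap st p = q" by (rule ap_st[OF _ h(2,3)])
    then have "ap c (succ k) = q" using c(3)[OF k(1)] k(2) by simp
    then show ?thesis unfolding R_def using succ_omega[OF k(1)] by blast
  qed
  \<comment> \<open>From one visited point \<open>(i, n)\<close> on the descending side of shell
    \<open>n\<close>, the walk goes on through all \<open>(k, n)\<close> with \<open>k\<close> below
    \<open>i\<close> and reaches \<open>(0, n)\<close>. The ascending side is
    \<open>up\<close>.\<close>
  have down: "i \<epsilon> omega \<Longrightarrow> i = n \<or> i \<epsilon> n \<Longrightarrow> R (pair i n) \<Longrightarrow>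
      R (pair nought n) \<and> (\<forall>k. k \<epsilon> i \<longrightarrow> R (pair k n))" if n: "n \<epsilon> omega" for i n
  proof -
    assume i: "i \<epsilon> omega" and h: "i = n \<or> i \<epsilon> n" "R (pair i n)"
    have "(i = n \<or> i \<epsilon> n) \<and> R (pair i n) \<longrightarrow>
      R (pair nought n) \<and> (\<forall>k. k \<epsilon> i \<longrightarrow> R (pair k n))"
    proof (rule omega_induct[OF _ i])
      show "dfn (\<lambda>v. (v 0 = n \<or> v 0 \<epsilon> n) \<and> R (pair (v 0) n) \<longrightarrow>
        R (pair nought n) \<and> (\<forall>k. k \<epsilon> v 0 \<longrightarrow> R (pair k n)))"
        by (intro dfn_intros dR)
      fix i assume i: "i \<epsilon> omega" and IH: "(i = n \<or> i \<epsilon> n) \<and> R (pair i n) \<longrightarrow>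
        R (pair nought n) \<and> (\<forall>k. k \<epsilon> i \<longrightarrow> R (pair k n))"
      show "(succ i = n \<or> succ i \<epsilon> n) \<and> R (pair (succ i) n) \<longrightarrow>
        R (pair nought n) \<and> (\<forall>k. k \<epsilon> succ i \<longrightarrow> R (pair k n))"
      proof (intro impI, elim conjE)
        assume h: "succ i = n \<or> succ i \<epsilon> n" "R (pair (succ i) n)"
        then have "i \<epsilon> n" using omega_trans(1)[OF n, of "succ i" i] by auto
        moreover from this have "\<not> n \<epsilon> succ i" using not_mem_sym[of i n] by auto
        ultimately have "R (pair i n)" using R_step[OF h(2), of "pair i n"] i n by auto
        then show "R (pair nought n) \<and> (\<forall>k. k \<epsilon> succ i \<longrightarrow> R (pair k n))"
          using IH \<open>i \<epsilon> n\<close> by auto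
      qed
    qed simp
    then show ?thesis using h by blast
  qed
  have up: "R (pair n j)" if n: "n \<epsilon> omega" and j: "j \<epsilon> omega" "j = n \<or> j \<epsilon> n"
    and R0: "R (pair n nought)" for n j
  proof -
    have "j = n \<or> j \<epsilon> n \<longrightarrow> R (pair n j)"
    proof (rule omega_induct[OF _ j(1)])
      show "dfn (\<lambda>v. v 0 = n \<or> v 0 \<epsilon> n \<longrightarrow> R (pair n (v 0)))" by (intro dfn_intros dR)
      show "nought = n \<or> nought \<epsilon> n \<longrightarrow> R (pair n nought)" using R0 by blast
      fix j assume j: "j \<epsilon> omega" and IH: "j = n \<or> j \<epsilon> n \<longrightarrow> R (pair n j)"
      show "succ j = n \<or> succ j \<epsilon> n \<longrightarrow> R (pair n (succ j))"
      proof
        assume "succ j = n \<or> succ j \<epsilon> n"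
        then have "j \<epsilon> n" using omega_trans(1)[OF n, of "succ j" j] by auto
        then show "R (pair n (succ j))"
          using R_step[of "pair n j" "pair n (succ j)"] IH j n by auto
      qed
    qed
    then show ?thesis using j by blast
  qed
  have R0: "R (pair n nought)" if "n \<epsilon> omega" for n
  proof (rule omega_induct[OF _ that])
    show "dfn (\<lambda>v. R (pair (v 0) nought))" by (intro dfn_intros dR)
    show "R (pair nought nought)" unfolding R_def using c(2) zero_omega by blast
    fix n assume n: "n \<epsilon> omega" and "R (pair n nought)"
    then have "R (pair n n)" using up by blast
    then have "R (pair nought n)" using down[OF n n] by blast
    then show "R (pair (succ n) nought)"
      using R_step[of "pair nought n" "pair (succ n) nought"] n by auto
  qed
  show thesis
  proof (rule that[OF c(1)])
    fix i j assume i: "i \<epsilon> omega" and j: "j \<epsilon> omega"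
    have "R (pair i j)"
    proof (cases "i \<epsilon> j")
      case True
      then show ?thesis using down[OF j j] up[OF j j _ R0[OF j]] by blast
    next
      case False
      then show ?thesis using up[OF i j _ R0[OF i]] omega_linear[OF i j] by blast
    qed
    then show "\<exists>k. k \<epsilon> omega \<and> ap c k = pair i j" unfolding R_def .
  qed
qed

text \<open>Choice in HOL costs nothing here: existence is proved in the structure, and the chosen
  element then serves as a parameter of formulas.\<close>

definition unpair :: 'm where
  "unpair = (SOME c. is_fun c omega (cprod omega omega) \<and>
    (\<forall>i j. i \<epsilon> omega \<and> j \<epsilon> omega \<longrightarrow> (\<exists>k. k \<epsilon> omega \<and> ap c k = pair i j)))"

lemma unpair: "is_fun unpair omega (cprod omega omega)"
  and unpair_surj: "i \<epsilon> omega \<Longrightarrow> j \<epsilon> omega \<Longrightarrow> \<exists>k. k \<epsilon> omega \<and> ap unpair k = pair i j"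
proof -
  have "\<exists>c. is_fun c omega (cprod omega omega) \<and>
    (\<forall>i j. i \<epsilon> omega \<and> j \<epsilon> omega \<longrightarrow> (\<exists>k. k \<epsilon> omega \<and> ap c k = pair i j))"
    by (rule square_enumeration) blast
  from someI_ex[OF this, folded unpair_def]
  show "is_fun unpair omega (cprod omega omega)"
    and "i \<epsilon> omega \<Longrightarrow> j \<epsilon> omega \<Longrightarrow> \<exists>k. k \<epsilon> omega \<and> ap unpair k = pair i j"
    by blast+
qed

end

section \<open>Category in a topological space of the structure\<close>

locale topology = ZF mem for mem :: "'m \<Rightarrow> 'm \<Rightarrow> bool" (infix "\<epsilon>" 50) +
  fixes X T :: 'm
  assumes open_subset: "U \<epsilon> T \<Longrightarrow> x \<epsilon> U \<Longrightarrow> x \<epsilon> X"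
    and open_space: "X \<epsilon> T"
    and open_local: "(\<And>x. x \<epsilon> S \<Longrightarrow> \<exists>U. U \<epsilon> T \<and> x \<epsilon> U \<and> (\<forall>y. y \<epsilon> U \<longrightarrow> y \<epsilon> S)) \<Longrightarrow> S \<epsilon> T"
    and open_inter: "U \<epsilon> T \<Longrightarrow> V \<epsilon> T \<Longrightarrow> x \<epsilon> U \<Longrightarrow> x \<epsilon> V \<Longrightarrow>
      \<exists>W. W \<epsilon> T \<and> x \<epsilon> W \<and> (\<forall>y. y \<epsilon> W \<longrightarrow> y \<epsilon> U \<and> y \<epsilon> V)"
begin

text \<open>Nowhere density stated without closures, and for classes that need not be
  elements.\<close>

definition rare :: "'m set \<Rightarrow> bool" where
  "rare A \<longleftrightarrow> (\<forall>U x. U \<epsilon> T \<and> x \<epsilon> U \<longrightarrow>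
    (\<exists>V y. V \<epsilon> T \<and> y \<epsilon> V \<and> (\<forall>z. z \<epsilon> V \<longrightarrow> z \<epsilon> U \<and> z \<notin> A)))"

text \<open>One element \<open>r\<close> codes the whole sequence of rare sets by its sections, so a
  family given uniformly needs no choice. Inclusion instead of equality lets \<open>A\<close> be any
  class and makes passing to subsets trivial.\<close>

definition mgr :: "'m set \<Rightarrow> bool" where
  "mgr A \<longleftrightarrow> A \<subseteq> ext X \<and> (\<exists>r. (\<forall>n. n \<epsilon> omega \<longrightarrow> rare {x. pair n x \<epsilon> r}) \<and>
     A \<subseteq> {x. \<exists>n. n \<epsilon> omega \<and> pair n x \<epsilon> r})"

lemma rare_subset: "rare A \<Longrightarrow> B \<subseteq> A \<Longrightarrow> rare B"
  unfolding rare_def by (meson subsetD)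

lemma rare_empty: "rare {}"
  unfolding rare_def by blast

lemma nowhere_dense_iff: "nowhere_dense X T N \<longleftrightarrow> ext N \<subseteq> ext X \<and> rare (ext N)"
proof -
  have "(\<exists>U\<in>ext T. ext U \<noteq> {} \<and> ext U \<subseteq> cl X T N) \<longleftrightarrow> \<not> rare (ext N)" if N: "ext N \<subseteq> ext X"
  proof
    assume "\<exists>U\<in>ext T. ext U \<noteq> {} \<and> ext U \<subseteq> cl X T N"
    then obtain U x where U: "U \<epsilon> T" "x \<epsilon> U" and cl: "ext U \<subseteq> cl X T N" by auto
    show "\<not> rare (ext N)"
    proof
      assume "rare (ext N)"
      then obtain V y where "V \<epsilon> T" "y \<epsilon> V" and V: "\<forall>z. z \<epsilon> V \<longrightarrow> z \<epsilon> U \<and> z \<notin> ext N"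
        using U unfolding rare_def by blast
      moreover have "y \<in> cl X T N" using \<open>y \<epsilon> V\<close> V cl by auto
      ultimately have "ext V \<inter> ext N \<noteq> {}" unfolding cl_def by auto
      then show False using V by auto
    qed
  next
    assume "\<not> rare (ext N)"
    then obtain U x where U: "U \<epsilon> T" "x \<epsilon> U"
      and no: "\<And>V y. V \<epsilon> T \<Longrightarrow> y \<epsilon> V \<Longrightarrow> \<exists>z. z \<epsilon> V \<and> (z \<epsilon> U \<longrightarrow> z \<epsilon> N)"
      unfolding rare_def mem_ext by blast
    have "ext U \<subseteq> cl X T N"
    proof
      fix y assume "y \<in> ext U"
      then have y: "y \<epsilon> U" by simp
      have "ext V \<inter> ext N \<noteq> {}" if V: "V \<epsilon> T" "y \<epsilon> V" for V
      proof -
        obtain W where "W \<epsilon> T" "y \<epsilon> W" "\<forall>z. z \<epsilon> W \<longrightarrow> z \<epsilon> U \<and> z \<epsilon> V"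
          using open_inter[OF U(1) V(1) y V(2)] by blast
        then show ?thesis using no by fastforce
      qed
      then show "y \<in> cl X T N" unfolding cl_def using open_subset[OF U(1) y] by simp
    qed
    moreover have "U \<in> ext T" "ext U \<noteq> {}" using U by auto
    ultimately show "\<exists>U\<in>ext T. ext U \<noteq> {} \<and> ext U \<subseteq> cl X T N" by blast
  qed
  then show ?thesis unfolding nowhere_dense_def by blast
qed

lemma meager_iff: "meager X T A \<longleftrightarrow> mgr (ext A)"
proof
  assume "meager X T A"
  then obtain s where s: "is_fun s omega (pow X)" and
    n: "\<And>n. n \<epsilon> omega \<Longrightarrow> nowhere_dense X T (ap s n)" and
    A: "ext A = (\<Union>n\<in>ext omega. ext (app s n))"
    unfolding meager_def using is_fun_ap(1) by (metis mem_ext)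
  define r where "r = rel omega X (\<lambda>n x. x \<epsilon> ap s n)"
  have r: "pair n x \<epsilon> r \<longleftrightarrow> n \<epsilon> omega \<and> x \<epsilon> X \<and> x \<epsilon> ap s n" for n x
    unfolding r_def by (rule pair_mem_rel) (intro dfn_intros)
  have sX: "x \<epsilon> X" if "x \<epsilon> ap s n" "n \<epsilon> omega" for x n
    using is_fun_ap(2)[OF s that(2)] that(1) by auto
  show "mgr (ext A)"
    unfolding mgr_def
  proof (intro conjI exI[of _ r] allI impI)
    show "ext A \<subseteq> ext X" unfolding A using sX is_fun_ap(1)[OF s] by auto
    show "rare {x. pair n x \<epsilon> r}" if "n \<epsilon> omega" for n
      using n[OF that] unfolding nowhere_dense_iff
      by (auto elim!: rare_subset simp: r)
    show "ext A \<subseteq> {x. \<exists>n. n \<epsilon> omega \<and> pair n x \<epsilon> r}"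
      unfolding A using sX is_fun_ap(1)[OF s] by (auto simp: r)
  qed
next
  assume "mgr (ext A)"
  then obtain r where A: "ext A \<subseteq> ext X" and r: "\<And>n. n \<epsilon> omega \<Longrightarrow> rare {x. pair n x \<epsilon> r}"
    and Ar: "ext A \<subseteq> {x. \<exists>n. n \<epsilon> omega \<and> pair n x \<epsilon> r}"
    unfolding mgr_def by blast
  \<comment> \<open>The sections of \<open>r\<close> are cut down to \<open>A\<close>, so that they
    become elements whose union is exactly \<open>A\<close>.\<close>
  define F where "F n = Sep A (\<lambda>x. pair n x \<epsilon> r)" for n
  have F: "x \<epsilon> F n \<longleftrightarrow> x \<epsilon> A \<and> pair n x \<epsilon> r" for x n
    unfolding F_def by (rule mem_Sep) (intro dfn_intros)
  have dF: "dft (\<lambda>v. F (v 0))" unfolding F_def by (intro dfn_intros)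
  have FX: "F n \<epsilon> pow X" for n using A F by auto
  note l = is_fun_lam[OF dF FX] ap_lam[OF dF FX]
  show "meager X T A" unfolding meager_def
  proof (intro exI[of _ "lam omega (pow X) F"] conjI ballI)
    show "is_fun (lam omega (pow X) F) omega (pow X)" by (rule l(1))
    show "nowhere_dense X T (app (lam omega (pow X) F) n)" if "n \<in> ext omega" for n
    proof -
      have n: "n \<epsilon> omega" using that by simp
      have "rare (ext (F n))" by (rule rare_subset[OF r[OF n]]) (auto simp: F)
      moreover have "ext (F n) \<subseteq> ext X" using FX[of n] by simp
      ultimately show ?thesis unfolding is_fun_ap(1)[OF l(1) n] l(2)[OF n] nowhere_dense_iff by simp
    qed
    have "app (lam omega (pow X) F) n = F n" if "n \<epsilon> omega" for n
      using is_fun_ap(1)[OF l(1) that] l(2)[OF that] by simp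
    then show "ext A = (\<Union>n\<in>ext omega. ext (app (lam omega (pow X) F) n))"
      using Ar by (auto simp: F)
  qed
qed

lemma mgr_subset: "mgr A \<Longrightarrow> B \<subseteq> A \<Longrightarrow> mgr B"
  unfolding mgr_def by (meson subset_trans)

text \<open>Decoding one index by \<open>unpair\<close> turns the double family into the sections of
  a single element. Because \<open>R\<close> is one definable relation, no covers have to be
  chosen.\<close>

lemma mgr_family2:
  assumes d: "dfn (\<lambda>v. R (v 0) (v 1) (v 2))"
    and r: "\<And>k n. k \<epsilon> omega \<Longrightarrow> n \<epsilon> omega \<Longrightarrow> rare {x. R k n x}"
    and A: "A \<subseteq> {x \<in> ext X. \<exists>k n. k \<epsilon> omega \<and> n \<epsilon> omega \<and> R k n x}"
  shows "mgr A"
proof -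
  define Q where "Q m x \<longleftrightarrow> (\<exists>k n. ap unpair m = pair k n \<and> R k n x)" for m x
  have "dfn (\<lambda>v. Q (v 0) (v 1))"
    unfolding Q_def by (intro dfn_intros dfn_lift3[OF d])
  note q = pair_mem_rel[OF this, of _ _ omega X]
  show ?thesis unfolding mgr_def
  proof (intro conjI exI[of _ "rel omega X Q"] allI impI)
    show "A \<subseteq> ext X" using A by auto
    show "A \<subseteq> {x. \<exists>m. m \<epsilon> omega \<and> pair m x \<epsilon> rel omega X Q}"
      using A unpair_surj unfolding q Q_def by fastforce
    fix m assume "m \<epsilon> omega"
    then have "ap unpair m \<epsilon> cprod omega omega" by (rule is_fun_ap(2)[OF unpair])
    then obtain k n where "k \<epsilon> omega" "n \<epsilon> omega" "ap unpair m = pair k n"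
      unfolding mem_cprod by blast
    then show "rare {x. pair m x \<epsilon> rel omega X Q}"
      using r[of k n] by (auto simp: q Q_def elim!: rare_subset)
  qed
qed

lemma mgr_family3:
  assumes d: "\<And>a b c d. dft a \<Longrightarrow> dft b \<Longrightarrow> dft c \<Longrightarrow> dft d \<Longrightarrow> dfn (\<lambda>v. R (a v) (b v) (c v) (d v))"
    and r: "\<And>k n m. k \<epsilon> omega \<Longrightarrow> n \<epsilon> omega \<Longrightarrow> m \<epsilon> omega \<Longrightarrow> rare {x. R k n m x}"
    and A: "A \<subseteq> {x \<in> ext X. \<exists>k n m. k \<epsilon> omega \<and> n \<epsilon> omega \<and> m \<epsilon> omega \<and> R k n m x}"
  shows "mgr A"
proof (rule mgr_family2)
  let ?R = "\<lambda>i m x. \<exists>k n. ap unpair i = pair k n \<and> R k n m x"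
  show "dfn (\<lambda>v. ?R (v 0) (v 1) (v 2))" by (intro dfn_intros d)
  show "A \<subseteq> {x \<in> ext X. \<exists>i m. i \<epsilon> omega \<and> m \<epsilon> omega \<and> ?R i m x}"
    using A unpair_surj by fastforce
  fix i m assume i: "i \<epsilon> omega" and m: "m \<epsilon> omega"
  obtain k n where "k \<epsilon> omega" "n \<epsilon> omega" "ap unpair i = pair k n"
    using is_fun_ap(2)[OF unpair i] unfolding mem_cprod by blast
  then show "rare {x. ?R i m x}"
    using r[of k n m] m by (auto elim!: rare_subset)
qed

lemma mgr_union:
  assumes "mgr A" "mgr B"
  shows "mgr (A \<union> B)"
proof -
  obtain r where A: "A \<subseteq> ext X" and r: "\<And>n. n \<epsilon> omega \<Longrightarrow> rare {x. pair n x \<epsilon> r}"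
    and Ar: "A \<subseteq> {x. \<exists>n. n \<epsilon> omega \<and> pair n x \<epsilon> r}"
    using assms(1) unfolding mgr_def by blast
  obtain s where B: "B \<subseteq> ext X" and s: "\<And>n. n \<epsilon> omega \<Longrightarrow> rare {x. pair n x \<epsilon> s}"
    and Bs: "B \<subseteq> {x. \<exists>n. n \<epsilon> omega \<and> pair n x \<epsilon> s}"
    using assms(2) unfolding mgr_def by blast
  \<comment> \<open>The first index only selects which of the two covers is meant: zero for
    \<open>r\<close>, anything else for \<open>s\<close>.\<close>
  let ?R = "\<lambda>k n x. k = nought \<and> pair n x \<epsilon> r \<or> k \<noteq> nought \<and> pair n x \<epsilon> s"
  show ?thesis
  proof (rule mgr_family2)
    show "dfn (\<lambda>v. ?R (v 0) (v 1) (v 2))" by (intro dfn_intros)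
    show "rare {x. ?R k n x}" if "n \<epsilon> omega" for k n
      using r[OF that] s[OF that] by (cases "k = nought") simp_all
    show "A \<union> B \<subseteq> {x \<in> ext X. \<exists>k n. k \<epsilon> omega \<and> n \<epsilon> omega \<and> ?R k n x}"
    proof
      fix x assume "x \<in> A \<union> B"
      then show "x \<in> {x \<in> ext X. \<exists>k n. k \<epsilon> omega \<and> n \<epsilon> omega \<and> ?R k n x}"
      proof
        assume "x \<in> A"
        then obtain n where "x \<in> ext X" "n \<epsilon> omega" "pair n x \<epsilon> r" using A Ar by blast
        moreover have "nought \<epsilon> omega" by simp
        ultimately show ?thesis by blast
      next
        assume "x \<in> B"
        then obtain n where "x \<in> ext X" "n \<epsilon> omega" "pair n x \<epsilon> s" using B Bs by blast
        moreover have "succ nought \<epsilon> omega" "succ nought \<noteq> nought" by simp_all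
        ultimately show ?thesis by blast
      qed
    qed
  qed
qed

end

section \<open>The Baire space\<close>

context ZF
begin

definition agree :: "'m \<Rightarrow> 'm \<Rightarrow> 'm \<Rightarrow> bool" where
  "agree f g n \<longleftrightarrow> (\<forall>k. k \<epsilon> n \<longrightarrow> ap f k = ap g k)"

lemma dfn_agree [dfn_intros]:
  "dft f \<Longrightarrow> dft g \<Longrightarrow> dft n \<Longrightarrow> dfn (\<lambda>v. agree (f v) (g v) (n v))"
  unfolding agree_def by (intro dfn_intros dft_shift)

lemma agree_refl [simp]: "agree f f n"
  by (simp add: agree_def)

lemma agree_sym: "agree f g n \<Longrightarrow> agree g f n"
  by (simp add: agree_def)

lemma agree_trans: "agree f g n \<Longrightarrow> agree g h n \<Longrightarrow> agree f h n"
  by (simp add: agree_def)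

lemma agree_nought [simp]: "agree f g nought"
  by (simp add: agree_def)

lemma mem_baire_space: "f \<epsilon> baire_space \<longleftrightarrow> is_fun f omega omega"
  by (simp add: baire_space_def mem_funs)

lemma mem_baire_topology:
  "U \<epsilon> baire_topology \<longleftrightarrow> (\<forall>f. f \<epsilon> U \<longrightarrow> f \<epsilon> baire_space) \<and>
    (\<forall>f. f \<epsilon> U \<longrightarrow> (\<exists>n. n \<epsilon> omega \<and> (\<forall>g. g \<epsilon> baire_space \<longrightarrow> agree f g n \<longrightarrow> g \<epsilon> U)))"
proof -
  let ?P = "\<lambda>U. (\<forall>f. f \<epsilon> U \<longrightarrow> (\<exists>n. n \<epsilon> omega \<and> (\<forall>g. g \<epsilon> baire_space \<longrightarrow> agree f g n \<longrightarrow> g \<epsilon> U)))"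
  have eq: "(\<forall>k\<in>ext n. app g k = app f k) \<longleftrightarrow> agree f g n"
    if "f \<epsilon> baire_space" "g \<epsilon> baire_space" "n \<epsilon> omega" for f g n
    using is_fun_ap(1)[of f omega omega] is_fun_ap(1)[of g omega omega] omega_trans(2)[of n] that
    unfolding agree_def mem_baire_space by (metis mem_ext)
  have "(ext U \<subseteq> ext baire_space \<and> (\<forall>f\<in>ext U. \<exists>n\<in>ext omega. \<forall>g\<in>ext baire_space.
       (\<forall>k\<in>ext n. app g k = app f k) \<longrightarrow> g \<epsilon> U)) \<longleftrightarrow> U \<epsilon> pow baire_space \<and> ?P U" for U
  proof -
    have "(\<exists>n\<in>ext omega. \<forall>g\<in>ext baire_space. (\<forall>k\<in>ext n. app g k = app f k) \<longrightarrow> g \<epsilon> U) \<longleftrightarrow>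
      (\<exists>n. n \<epsilon> omega \<and> (\<forall>g. g \<epsilon> baire_space \<longrightarrow> agree f g n \<longrightarrow> g \<epsilon> U))"
      if "f \<epsilon> baire_space" for f
      using eq[OF that] by (metis mem_ext)
    then show ?thesis by auto
  qed
  then have *: "baire_topology = set_of {U. U \<epsilon> pow baire_space \<and> ?P U}"
    unfolding baire_topology_def by presburger
  have "dfn (\<lambda>v. ?P (v 0))" by (intro dfn_intros)
  then have "U \<epsilon> baire_topology \<longleftrightarrow> U \<epsilon> pow baire_space \<and> ?P U"
    unfolding * using mem_Sep[of ?P U "pow baire_space"] unfolding Sep_def by (simp only: mem_ext)
  then show ?thesis by auto
qed

lemma topology_baire: "topology mem baire_space baire_topology"
proof
  show "x \<epsilon> baire_space" if "U \<epsilon> baire_topology" "x \<epsilon> U" for U x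
    using that mem_baire_topology by blast
  show "baire_space \<epsilon> baire_topology"
    unfolding mem_baire_topology using zero_omega by blast
  show "S \<epsilon> baire_topology"
    if S: "\<And>x. x \<epsilon> S \<Longrightarrow> \<exists>U. U \<epsilon> baire_topology \<and> x \<epsilon> U \<and> (\<forall>y. y \<epsilon> U \<longrightarrow> y \<epsilon> S)" for S
    unfolding mem_baire_topology using S[unfolded mem_baire_topology] by meson
  show "\<exists>W. W \<epsilon> baire_topology \<and> f \<epsilon> W \<and> (\<forall>y. y \<epsilon> W \<longrightarrow> y \<epsilon> U \<and> y \<epsilon> V)"
    if UV: "U \<epsilon> baire_topology" "V \<epsilon> baire_topology" "f \<epsilon> U" "f \<epsilon> V" for U V f
  proof (intro exI conjI)
    have m: "h \<epsilon> Sep U (\<lambda>h. h \<epsilon> V) \<longleftrightarrow> h \<epsilon> U \<and> h \<epsilon> V" for h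
      by (rule mem_Sep) (intro dfn_intros)
    show "f \<epsilon> Sep U (\<lambda>h. h \<epsilon> V)" "\<forall>y. y \<epsilon> Sep U (\<lambda>h. h \<epsilon> V) \<longrightarrow> y \<epsilon> U \<and> y \<epsilon> V"
      using UV m by auto
    show "Sep U (\<lambda>h. h \<epsilon> V) \<epsilon> baire_topology"
      unfolding mem_baire_topology m
    proof (intro conjI allI impI)
      fix g assume g: "g \<epsilon> U \<and> g \<epsilon> V"
      show "g \<epsilon> baire_space" using g UV(1) mem_baire_topology by blast
      obtain n where n: "n \<epsilon> omega" "\<And>h. h \<epsilon> baire_space \<Longrightarrow> agree g h n \<Longrightarrow> h \<epsilon> U"
        using g UV(1) mem_baire_topology by blast
      obtain m where m: "m \<epsilon> omega" "\<And>h. h \<epsilon> baire_space \<Longrightarrow> agree g h m \<Longrightarrow> h \<epsilon> V"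
        using g UV(2) mem_baire_topology by blast
      from omega_total[OF n(1) m(1)]
      show "\<exists>n. n \<epsilon> omega \<and> (\<forall>h. h \<epsilon> baire_space \<longrightarrow> agree g h n \<longrightarrow> h \<epsilon> U \<and> h \<epsilon> V)"
      proof
        assume "\<forall>k. k \<epsilon> n \<longrightarrow> k \<epsilon> m"
        then have "agree g h m \<Longrightarrow> agree g h n" for h by (simp add: agree_def)
        then show ?thesis using n m by blast
      next
        assume "\<forall>k. k \<epsilon> m \<longrightarrow> k \<epsilon> n"
        then have "agree g h n \<Longrightarrow> agree g h m" for h by (simp add: agree_def)
        then show ?thesis using n m by blast
      qed
    qed
  qed
qed

text \<open>The cylinder fixed by the first \<open>n\<close> values of \<open>f\<close> is open, so
  it contains a smaller cylinder that misses the rare set. Its length is enlarged to at least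
  \<open>n\<close>, so that it extends the given finite sequence.\<close>

lemma rare_baire:
  assumes "topology.rare mem baire_topology A" "f \<epsilon> baire_space" "n \<epsilon> omega"
  shows "\<exists>g m. g \<epsilon> baire_space \<and> m \<epsilon> omega \<and> agree f g n \<and> (\<forall>k. k \<epsilon> n \<longrightarrow> k \<epsilon> m) \<and>
    (\<forall>h. h \<epsilon> baire_space \<longrightarrow> agree g h m \<longrightarrow> h \<notin> A)"
proof -
  interpret baire: topology mem baire_space baire_topology by (rule topology_baire)
  define U where "U = Sep baire_space (\<lambda>g. agree f g n)"
  have U: "g \<epsilon> U \<longleftrightarrow> g \<epsilon> baire_space \<and> agree f g n" for g
    unfolding U_def by (rule mem_Sep) (intro dfn_intros)
  have "U \<epsilon> baire_topology" unfolding mem_baire_topology U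
    using agree_trans assms(3) by blast
  moreover have "f \<epsilon> U" unfolding U using assms(2) by simp
  ultimately obtain V g where V: "V \<epsilon> baire_topology" "g \<epsilon> V"
    "\<And>h. h \<epsilon> V \<Longrightarrow> h \<epsilon> U \<and> h \<notin> A"
    using assms(1) unfolding baire.rare_def by blast
  obtain m where m: "m \<epsilon> omega" "\<And>h. h \<epsilon> baire_space \<Longrightarrow> agree g h m \<Longrightarrow> h \<epsilon> V"
    using V(1,2) mem_baire_topology by blast
  have g: "g \<epsilon> baire_space" "agree f g n" using V(2,3) U by blast+
  from omega_total[OF assms(3) m(1)] show ?thesis
  proof
    assume 2: "\<forall>k. k \<epsilon> n \<longrightarrow> k \<epsilon> m"
    have "h \<notin> A" if "h \<epsilon> baire_space" "agree g h m" for h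
      using m(2)[OF that] V(3) by blast
    then show ?thesis using g m(1) 2 by blast
  next
    assume "\<forall>k. k \<epsilon> m \<longrightarrow> k \<epsilon> n"
    then have "agree g h n \<Longrightarrow> agree g h m" for h by (simp add: agree_def)
    then have "h \<notin> A" if "h \<epsilon> baire_space" "agree g h n" for h
      using m(2) that V(3) by blast
    then show ?thesis using g assms(3) by blast
  qed
qed

definition upd :: "'m \<Rightarrow> 'm \<Rightarrow> 'm \<Rightarrow> 'm" where
  "upd f n a = rel omega omega (\<lambda>k y. k = n \<and> y = a \<or> k \<noteq> n \<and> y = ap f k)"

lemma
  assumes f: "f \<epsilon> baire_space" and a: "a \<epsilon> omega"
  shows upd_baire: "upd f n a \<epsilon> baire_space"
    and ap_upd: "k \<epsilon> omega \<Longrightarrow> ap (upd f n a) k = (if k = n then a else ap f k)"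
proof -
  have d: "dfn (\<lambda>v. v 0 = n \<and> v 1 = a \<or> v 0 \<noteq> n \<and> v 1 = ap f (v 0))" by (intro dfn_intros)
  have fk: "ap f k \<epsilon> omega" if "k \<epsilon> omega" for k
    using is_fun_ap(2) f that unfolding mem_baire_space by blast
  have u: "is_fun (upd f n a) omega omega"
    unfolding upd_def
    by (rule is_fun_rel[OF d]) (use fk a in auto)
  then show "upd f n a \<epsilon> baire_space" by (simp add: mem_baire_space)
  show "ap (upd f n a) k = (if k = n then a else ap f k)" if k: "k \<epsilon> omega"
  proof -
    have "pair k (if k = n then a else ap f k) \<epsilon> upd f n a"
      unfolding upd_def pair_mem_rel[OF d] using k fk a by auto
    then show ?thesis using is_fun_mem[OF u, of k] by simp
  qed
qed

lemma agree_upd: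
  assumes "f \<epsilon> baire_space" "a \<epsilon> omega" "n \<epsilon> omega"
  shows "agree f (upd f n a) n"
  unfolding agree_def using ap_upd[OF assms(1,2)] omega_trans(2)[OF assms(3)] by auto

text \<open>Stands in for an enumeration of finite sequences. In the construction,
  \<open>Q n k q\<close> says that \<open>q\<close> is the \<open>k\<close>-th sequence in a list of
  those that vanish from \<open>n\<close> on, and \<open>q\<close> represents its first
  \<open>n\<close> values. Later, exceptional sets attached to finite sequences can thus be indexed
  by two numbers.\<close>

lemma countable_dense_baire:
  obtains Q where
    "\<And>n k f. dft n \<Longrightarrow> dft k \<Longrightarrow> dft f \<Longrightarrow> dfn (\<lambda>v. Q (n v) (k v) (f v))"
    "\<And>n k f g. n \<epsilon> omega \<Longrightarrow> k \<epsilon> omega \<Longrightarrow> Q n k f \<Longrightarrow> Q n k g \<Longrightarrow> f = g"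
    "\<And>n k f. n \<epsilon> omega \<Longrightarrow> k \<epsilon> omega \<Longrightarrow> Q n k f \<Longrightarrow> f \<epsilon> baire_space"
    "\<And>n f. n \<epsilon> omega \<Longrightarrow> f \<epsilon> baire_space \<Longrightarrow>
      \<exists>k q. k \<epsilon> omega \<and> Q n k q \<and> agree f q n"
proof -
  define A where "A = pow (cprod omega baire_space)"
  \<comment> \<open>Index \<open>k\<close> decodes to \<open>(k1, k2)\<close>: take the
    \<open>k1\<close>-th sequence of the previous list and set its value at \<open>n\<close> to
    \<open>k2\<close>.\<close>
  define F where "F n e = rel omega baire_space (\<lambda>k g. \<exists>k1 k2 g0. ap unpair k = pair k1 k2 \<and>
    pair k1 g0 \<epsilon> e \<and> ap g n = k2 \<and> (\<forall>i. i \<epsilon> omega \<and> i \<noteq> n \<longrightarrow> ap g i = ap g0 i))" for n e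
  have dF: "dft (\<lambda>v. F (v 0) (v 1))"
    unfolding F_def rel_def by (intro dfn_intros)
  have mF: "pair k g \<epsilon> F n e \<longleftrightarrow> k \<epsilon> omega \<and> g \<epsilon> baire_space \<and> (\<exists>k1 k2 g0. ap unpair k = pair k1 k2 \<and>
    pair k1 g0 \<epsilon> e \<and> ap g n = k2 \<and> (\<forall>i. i \<epsilon> omega \<and> i \<noteq> n \<longrightarrow> ap g i = ap g0 i))" for k g n e
    unfolding F_def by (rule pair_mem_rel) (intro dfn_intros)
  define e0 where "e0 = rel omega baire_space (\<lambda>k g. \<forall>i. i \<epsilon> omega \<longrightarrow> ap g i = nought)"
  have me0: "pair k g \<epsilon> e0 \<longleftrightarrow> k \<epsilon> omega \<and> g \<epsilon> baire_space \<and> (\<forall>i. i \<epsilon> omega \<longrightarrow> ap g i = nought)" for k g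
    unfolding e0_def by (rule pair_mem_rel) (intro dfn_intros)
  have relA: "dfn (\<lambda>v. R (v 0) (v 1)) \<Longrightarrow> rel omega baire_space R \<epsilon> A" for R
    unfolding A_def using mem_rel[of R] by auto
  have e0A: "e0 \<epsilon> A" unfolding e0_def by (intro relA dfn_intros)
  have FA: "F n x \<epsilon> A" for n x unfolding F_def by (intro relA dfn_intros)
  have "\<exists>h. is_fun h omega A \<and> ap h nought = e0 \<and>
      (\<forall>n. n \<epsilon> omega \<longrightarrow> ap h (succ n) = F n (ap h n))"
    by (rule omega_recursion[OF dF e0A FA]) blast
  then obtain h where h: "is_fun h omega A" "ap h nought = e0"
    "\<And>n. n \<epsilon> omega \<Longrightarrow> ap h (succ n) = F n (ap h n)"
    by blast
  let ?Q = "\<lambda>n k f. pair k f \<epsilon> ap h n"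
  have dom: "k \<epsilon> omega \<and> f \<epsilon> baire_space" if "n \<epsilon> omega" "?Q n k f" for n k f
    using is_fun_ap(2)[OF h(1) that(1)] that(2) unfolding A_def by auto
  have baire_ext: "f = g" if "f \<epsilon> baire_space" "g \<epsilon> baire_space"
    "\<And>i. i \<epsilon> omega \<Longrightarrow> ap f i = ap g i" for f g
    using fun_ext that unfolding mem_baire_space by blast
  have uniq: "\<forall>k f g. ?Q n k f \<and> ?Q n k g \<longrightarrow> f = g" if n: "n \<epsilon> omega" for n
  proof (rule omega_induct[OF _ n])
    show "dfn (\<lambda>v. \<forall>k f g. ?Q (v 0) k f \<and> ?Q (v 0) k g \<longrightarrow> f = g)" by (intro dfn_intros)
    show "\<forall>k f g. ?Q nought k f \<and> ?Q nought k g \<longrightarrow> f = g"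
      unfolding h(2) me0 using baire_ext by auto
    fix n assume n: "n \<epsilon> omega" and IH: "\<forall>k f g. ?Q n k f \<and> ?Q n k g \<longrightarrow> f = g"
    show "\<forall>k f g. ?Q (succ n) k f \<and> ?Q (succ n) k g \<longrightarrow> f = g"
      unfolding h(3)[OF n] mF
    proof (intro allI impI, elim conjE exE)
      fix k f g k1 k2 g0 k1' k2' g0'
      assume 1: "f \<epsilon> baire_space" "g \<epsilon> baire_space" "ap unpair k = pair k1 k2" "?Q n k1 g0"
        "ap f n = k2" "\<forall>i. i \<epsilon> omega \<and> i \<noteq> n \<longrightarrow> ap f i = ap g0 i"
        "ap unpair k = pair k1' k2'" "?Q n k1' g0'"
        "ap g n = k2'" "\<forall>i. i \<epsilon> omega \<and> i \<noteq> n \<longrightarrow> ap g i = ap g0' i"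
      have "pair k1 k2 = pair k1' k2'" by (rule trans[OF 1(3)[symmetric] 1(7)])
      then have k: "k1 = k1'" "k2 = k2'" by simp_all
      have g0: "g0 = g0'" using IH 1(4) 1(8)[folded k] by blast
      show "f = g"
      proof (rule baire_ext[OF 1(1,2)])
        fix i assume "i \<epsilon> omega"
        then show "ap f i = ap g i"
          using 1(5,6,9,10) k g0 by (cases "i = n") simp_all
      qed
    qed
  qed
  have dense: "\<forall>f. f \<epsilon> baire_space \<longrightarrow> (\<exists>k q. k \<epsilon> omega \<and> ?Q n k q \<and> agree f q n)" if n: "n \<epsilon> omega" for n
  proof (rule omega_induct[OF _ n])
    show "dfn (\<lambda>v. \<forall>f. f \<epsilon> baire_space \<longrightarrow> (\<exists>k q. k \<epsilon> omega \<and> ?Q (v 0) k q \<and> agree f q (v 0)))"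
      by (intro dfn_intros)
    have d0: "dft (\<lambda>v. nought)" by (intro dfn_intros)
    have "lam omega omega (\<lambda>_. nought) \<epsilon> baire_space"
      "\<forall>i. i \<epsilon> omega \<longrightarrow> ap (lam omega omega (\<lambda>_. nought)) i = nought"
      using is_fun_lam[OF d0] ap_lam[OF d0] unfolding mem_baire_space by simp_all
    then have "?Q nought nought (lam omega omega (\<lambda>_. nought))" unfolding h(2) me0 by simp
    then show "\<forall>f. f \<epsilon> baire_space \<longrightarrow> (\<exists>k q. k \<epsilon> omega \<and> ?Q nought k q \<and> agree f q nought)"
      using agree_nought zero_omega by blast
    fix n assume n: "n \<epsilon> omega"
      and IH: "\<forall>f. f \<epsilon> baire_space \<longrightarrow> (\<exists>k q. k \<epsilon> omega \<and> ?Q n k q \<and> agree f q n)"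
    show "\<forall>f. f \<epsilon> baire_space \<longrightarrow> (\<exists>k q. k \<epsilon> omega \<and> ?Q (succ n) k q \<and> agree f q (succ n))"
    proof (intro allI impI)
      fix f assume f: "f \<epsilon> baire_space"
      obtain k1 q where kq: "k1 \<epsilon> omega" "?Q n k1 q" "agree f q n" using IH f by blast
      have q: "q \<epsilon> baire_space" using dom[OF n kq(2)] by blast
      have fn: "ap f n \<epsilon> omega" using f n is_fun_ap(2) unfolding mem_baire_space by blast
      obtain k where k: "k \<epsilon> omega" "ap unpair k = pair k1 (ap f n)"
        using unpair_surj[OF kq(1) fn] by blast
      note u = upd_baire[OF q fn, of n] ap_upd[OF q fn, of _ n]
      have "?Q (succ n) k (upd q n (ap f n))"
        unfolding h(3)[OF n] mF using k kq(2) u n by auto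
      moreover have "agree f (upd q n (ap f n)) (succ n)"
        using kq(3) n omega_trans(2)[OF n] u(2) unfolding agree_def by auto
      ultimately show "\<exists>k q. k \<epsilon> omega \<and> ?Q (succ n) k q \<and> agree f q (succ n)"
        using k(1) by blast
    qed
  qed
  show thesis
  proof (rule that[of ?Q])
    show "dfn (\<lambda>v. pair (k v) (f v) \<epsilon> ap h (n v))" if "dft n" "dft k" "dft f" for n k f
      by (intro dfn_intros that)
  qed (use dom uniq dense in blast)+
qed

end

section \<open>Coding second countable spaces by the Baire space\<close>

context ZF_DC
begin

lemma DC_ap:
  assumes "a \<epsilon> A" "\<And>x. x \<epsilon> A \<Longrightarrow> \<exists>y. y \<epsilon> A \<and> R x y" "dfn (\<lambda>v. R (v 0) (v 1))"
  shows "\<exists>f. is_fun f omega A \<and> (\<forall>n. n \<epsilon> omega \<longrightarrow> R (ap f n) (ap f (succ n)))"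
proof -
  note m = pair_mem_rel[OF assms(3), of _ _ A A]
  have "ext A \<noteq> {}" using assms(1) by auto
  moreover have "\<forall>x\<in>ext A. \<exists>y\<in>ext A. pair x y \<epsilon> rel A A R" using assms(2) m by simp
  ultimately obtain f where f: "is_fun f omega A"
    "\<forall>n\<in>ext omega. pair (app f n) (app f (succ n)) \<epsilon> rel A A R" using DC by blast
  have "R (ap f n) (ap f (succ n))" if "n \<epsilon> omega" for n
    using f(2) that is_fun_ap(1)[OF f(1)] m by auto
  then show ?thesis using f(1) by blast
qed

end

text \<open>The \<open>n\<close>-th section of \<open>b\<close> is the basic open set
  \<open>B_n\<close>. The whole base is one element, so that the codes are definable from it as a
  parameter.\<close>

locale coded_space = topology mem X T + ZF_DC mem
  for mem :: "'m \<Rightarrow> 'm \<Rightarrow> bool" (infix "\<epsilon>" 50) and X T +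
  fixes b :: 'm
  assumes separated: "x \<epsilon> X \<Longrightarrow> y \<epsilon> X \<Longrightarrow> x \<noteq> y \<Longrightarrow> \<exists>U. U \<epsilon> T \<and> x \<epsilon> U \<and> \<not> y \<epsilon> U"
    and base_open: "pair n x \<epsilon> b \<Longrightarrow> \<exists>U. U \<epsilon> T \<and> x \<epsilon> U \<and> (\<forall>y. y \<epsilon> U \<longrightarrow> pair n y \<epsilon> b)"
    and base: "U \<epsilon> T \<Longrightarrow> x \<epsilon> U \<Longrightarrow>
      \<exists>n. n \<epsilon> omega \<and> pair n x \<epsilon> b \<and> (\<forall>y. pair n y \<epsilon> b \<longrightarrow> y \<epsilon> U)"
begin

definition extend :: "'m \<Rightarrow> 'm \<Rightarrow> 'm" where
  "extend n E = Sep E (\<lambda>p. \<exists>f x. p = pair f x \<and>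
    (pair (ap f n) x \<epsilon> b \<or> \<not> (\<exists>y. pair f y \<epsilon> E \<and> pair (ap f n) y \<epsilon> b)))"

text \<open>The pair \<open>(f, x)\<close> belongs to \<open>ap codes n\<close> iff \<open>x\<close> lies in the open set coded by the first
  \<open>n\<close> values of \<open>f\<close>: a value cuts down to a basic open set unless the result would be empty.
  Hence every finite sequence codes a nonempty open set.\<close>

definition codes :: 'm where
  "codes = (SOME h. is_fun h omega (pow (cprod baire_space X)) \<and>
    ap h nought = cprod baire_space X \<and> (\<forall>n. n \<epsilon> omega \<longrightarrow> ap h (succ n) = extend n (ap h n)))"

abbreviation coded :: "'m \<Rightarrow> 'm \<Rightarrow> 'm \<Rightarrow> bool" where
  "coded n f x \<equiv> pair f x \<epsilon> ap codes n"

lemma codes: "is_fun codes omega (pow (cprod baire_space X)) \<and>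
    ap codes nought = cprod baire_space X \<and>
    (\<forall>n. n \<epsilon> omega \<longrightarrow> ap codes (succ n) = extend n (ap codes n))"
  unfolding codes_def
proof (rule someI_ex)
  let ?A = "pow (cprod baire_space X)"
  have m: "p \<epsilon> extend n E \<Longrightarrow> p \<epsilon> E" for p n E
    unfolding extend_def by (subst (asm) mem_Sep) (auto intro!: dfn_intros)
  have d: "dft (\<lambda>v. extend (v 0) (v 1))" unfolding extend_def by (intro dfn_intros)
  have 0: "cprod baire_space X \<epsilon> ?A" by simp
  have 1: "extend n E \<epsilon> ?A" if "E \<epsilon> ?A" for n E using that m by auto
  show "\<exists>h. is_fun h omega ?A \<and> ap h nought = cprod baire_space X \<and>
    (\<forall>n. n \<epsilon> omega \<longrightarrow> ap h (succ n) = extend n (ap h n))"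
    by (rule omega_recursion[OF d 0 1]) blast+
qed

lemma coded_nought: "coded nought f x \<longleftrightarrow> f \<epsilon> baire_space \<and> x \<epsilon> X"
  using codes by simp

lemma coded_succ: "n \<epsilon> omega \<Longrightarrow> coded (succ n) f x \<longleftrightarrow> coded n f x \<and>
    (pair (ap f n) x \<epsilon> b \<or> \<not> (\<exists>y. coded n f y \<and> pair (ap f n) y \<epsilon> b))"
proof -
  assume n: "n \<epsilon> omega"
  have "p \<epsilon> extend n E \<longleftrightarrow> p \<epsilon> E \<and> (\<exists>f x. p = pair f x \<and>
    (pair (ap f n) x \<epsilon> b \<or> \<not> (\<exists>y. pair f y \<epsilon> E \<and> pair (ap f n) y \<epsilon> b)))" for p E
    unfolding extend_def by (rule mem_Sep) (intro dfn_intros)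
  then show ?thesis using codes n by auto
qed

lemma coded_dom: "n \<epsilon> omega \<Longrightarrow> coded n f x \<Longrightarrow> f \<epsilon> baire_space \<and> x \<epsilon> X"
  using codes is_fun_ap(2)[of codes omega "pow (cprod baire_space X)" n] by auto

lemma coded_nonempty:
  assumes n: "n \<epsilon> omega" and "f \<epsilon> baire_space" "x \<epsilon> X"
  shows "\<exists>y. coded n f y"
proof (rule omega_induct[OF _ n])
  show "dfn (\<lambda>v. \<exists>y. coded (v 0) f y)" by (intro dfn_intros)
  show "\<exists>y. coded nought f y" using assms coded_nought by blast
  show "\<exists>y. coded (succ n) f y" if "n \<epsilon> omega" "\<exists>y. coded n f y" for n
    using that coded_succ by blast
qed

lemma coded_open:
  assumes n: "n \<epsilon> omega" and "coded n f x"
  shows "\<exists>U. U \<epsilon> T \<and> x \<epsilon> U \<and> (\<forall>y. y \<epsilon> U \<longrightarrow> coded n f y)"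
proof -
  have "\<forall>x. coded n f x \<longrightarrow> (\<exists>U. U \<epsilon> T \<and> x \<epsilon> U \<and> (\<forall>y. y \<epsilon> U \<longrightarrow> coded n f y))"
  proof (rule omega_induct[OF _ n])
    show "dfn (\<lambda>v. \<forall>x. coded (v 0) f x \<longrightarrow>
      (\<exists>U. U \<epsilon> T \<and> x \<epsilon> U \<and> (\<forall>y. y \<epsilon> U \<longrightarrow> coded (v 0) f y)))" by (intro dfn_intros)
    show "\<forall>x. coded nought f x \<longrightarrow> (\<exists>U. U \<epsilon> T \<and> x \<epsilon> U \<and> (\<forall>y. y \<epsilon> U \<longrightarrow> coded nought f y))"
      unfolding coded_nought using open_space by blast
    fix n assume n: "n \<epsilon> omega" and
      IH: "\<forall>x. coded n f x \<longrightarrow> (\<exists>U. U \<epsilon> T \<and> x \<epsilon> U \<and> (\<forall>y. y \<epsilon> U \<longrightarrow> coded n f y))"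
    show "\<forall>x. coded (succ n) f x \<longrightarrow>
      (\<exists>U. U \<epsilon> T \<and> x \<epsilon> U \<and> (\<forall>y. y \<epsilon> U \<longrightarrow> coded (succ n) f y))"
    proof (intro allI impI)
      fix x assume c: "coded (succ n) f x"
      then have "coded n f x" using coded_succ[OF n] by blast
      then obtain U where U: "U \<epsilon> T" "x \<epsilon> U" "\<forall>y. y \<epsilon> U \<longrightarrow> coded n f y" using IH by blast
      show "\<exists>U. U \<epsilon> T \<and> x \<epsilon> U \<and> (\<forall>y. y \<epsilon> U \<longrightarrow> coded (succ n) f y)"
      proof (cases "pair (ap f n) x \<epsilon> b")
        case True
        then obtain V where V: "V \<epsilon> T" "x \<epsilon> V" "\<forall>y. y \<epsilon> V \<longrightarrow> pair (ap f n) y \<epsilon> b"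
          using base_open by blast
        obtain W where W: "W \<epsilon> T" "x \<epsilon> W" "\<forall>y. y \<epsilon> W \<longrightarrow> y \<epsilon> U \<and> y \<epsilon> V"
          using open_inter U V by blast
        then have "\<forall>y. y \<epsilon> W \<longrightarrow> coded (succ n) f y"
          unfolding coded_succ[OF n] using U(3) V(3) by blast
        then show ?thesis using W by blast
      next
        \<comment> \<open>Since \<open>x\<close> survives this stage without lying in the basic set,
          that set misses the current open set, and the value \<open>ap f n\<close> cuts nothing
          away.\<close>
        case False
        then have "\<forall>y. y \<epsilon> U \<longrightarrow> coded (succ n) f y"
          using U(3) c unfolding coded_succ[OF n] by blast
        then show ?thesis using U by blast
      qed
    qed
  qed
  then show ?thesis using assms by blast
qed

lemma coded_agree:
  assumes n: "n \<epsilon> omega" and "f \<epsilon> baire_space" "g \<epsilon> baire_space" "agree f g n"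
  shows "coded n f x \<longleftrightarrow> coded n g x"
proof -
  have "agree f g n \<longrightarrow> (\<forall>x. coded n f x \<longleftrightarrow> coded n g x)"
  proof (rule omega_induct[OF _ n])
    show "dfn (\<lambda>v. agree f g (v 0) \<longrightarrow> (\<forall>x. coded (v 0) f x \<longleftrightarrow> coded (v 0) g x))"
      by (intro dfn_intros)
    show "agree f g nought \<longrightarrow> (\<forall>x. coded nought f x \<longleftrightarrow> coded nought g x)"
      unfolding coded_nought using assms(2,3) by blast
    fix n assume n: "n \<epsilon> omega" and IH: "agree f g n \<longrightarrow> (\<forall>x. coded n f x \<longleftrightarrow> coded n g x)"
    show "agree f g (succ n) \<longrightarrow> (\<forall>x. coded (succ n) f x \<longleftrightarrow> coded (succ n) g x)"
    proof
      assume "agree f g (succ n)"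
      then have "agree f g n" "ap f n = ap g n" by (simp_all add: agree_def)
      then show "\<forall>x. coded (succ n) f x \<longleftrightarrow> coded (succ n) g x"
        unfolding coded_succ[OF n] using IH by simp
    qed
  qed
  then show ?thesis using assms by blast
qed

lemma coded_antimono:
  assumes n: "n \<epsilon> omega" "m \<epsilon> omega" and sub: "\<And>k. k \<epsilon> m \<Longrightarrow> k \<epsilon> n" and c: "coded n f x"
  shows "coded m f x"
proof -
  have "coded n f x \<longrightarrow> (\<forall>m. m \<epsilon> n \<longrightarrow> coded m f x)"
  proof (rule omega_induct[OF _ n(1)])
    show "dfn (\<lambda>v. coded (v 0) f x \<longrightarrow> (\<forall>m. m \<epsilon> v 0 \<longrightarrow> coded m f x))" by (intro dfn_intros)
    show "coded (succ n) f x \<longrightarrow> (\<forall>m. m \<epsilon> succ n \<longrightarrow> coded m f x)"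
      if "n \<epsilon> omega" "coded n f x \<longrightarrow> (\<forall>m. m \<epsilon> n \<longrightarrow> coded m f x)" for n
      using that coded_succ by auto
  qed simp
  moreover have "m \<epsilon> n \<or> m = n"
    using omega_linear[OF n] sub[of n] not_mem_self by auto
  ultimately show ?thesis using c by auto
qed

text \<open>The point \<open>y\<close> witnesses that the new value does not empty the set, so it
  really cuts down.\<close>

lemma coded_upd:
  assumes f: "f \<epsilon> baire_space" and a: "a \<epsilon> omega" and n: "n \<epsilon> omega"
    and y: "coded n f y" "pair a y \<epsilon> b"
  shows "coded (succ n) (upd f n a) x \<longleftrightarrow> coded n f x \<and> pair a x \<epsilon> b"
proof -
  have "coded n (upd f n a) z \<longleftrightarrow> coded n f z" for z
    using coded_agree[OF n upd_baire[OF f a] f agree_sym[OF agree_upd[OF f a n]]] .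
  moreover have "ap (upd f n a) n = a" using ap_upd[OF f a n] by simp
  ultimately show ?thesis unfolding coded_succ[OF n] using y by auto
qed

text \<open>Bad points for the first \<open>n\<close> values of \<open>q\<close> lie in the open set
  coded by them but drop out of it in every extension whose cylinder misses \<open>M\<close>. Given
  such a point in \<open>U\<close>, append a basic set inside \<open>U\<close> and then extend to a
  cylinder that misses \<open>M\<close>: its nonempty open set lies in \<open>U\<close> and contains
  no bad point.\<close>

lemma rare_bad:
  assumes Q: "\<And>k f g. k \<epsilon> omega \<Longrightarrow> Q k f \<Longrightarrow> Q k g \<Longrightarrow> f = g"
    and M: "topology.rare mem baire_topology M" and n: "n \<epsilon> omega" and k: "k \<epsilon> omega"
  shows "rare {x. \<exists>q. Q k q \<and> coded n q x \<and> \<not> (\<exists>f j. f \<epsilon> baire_space \<and> j \<epsilon> omega \<and>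
    (\<forall>i. i \<epsilon> n \<longrightarrow> i \<epsilon> j) \<and> agree q f n \<and> coded j f x \<and>
    (\<forall>h. h \<epsilon> baire_space \<longrightarrow> agree f h j \<longrightarrow> h \<notin> M))}"
    (is "rare ?K")
  unfolding rare_def
proof (intro allI impI, elim conjE)
  fix U x assume U: "U \<epsilon> T" "x \<epsilon> U"
  show "\<exists>V y. V \<epsilon> T \<and> y \<epsilon> V \<and> (\<forall>z. z \<epsilon> V \<longrightarrow> z \<epsilon> U \<and> z \<notin> ?K)"
  proof (cases "\<exists>y. y \<epsilon> U \<and> y \<in> ?K")
    case False
    then show ?thesis using U by blast
  next
    case True
    then obtain y q where y: "y \<epsilon> U" "Q k q" "coded n q y" by blast
    have q: "q \<epsilon> baire_space" "y \<epsilon> X" using coded_dom[OF n y(3)] by auto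
    obtain V where V: "V \<epsilon> T" "y \<epsilon> V" "\<forall>z. z \<epsilon> V \<longrightarrow> coded n q z"
      using coded_open[OF n y(3)] by blast
    obtain W where W: "W \<epsilon> T" "y \<epsilon> W" "\<forall>z. z \<epsilon> W \<longrightarrow> z \<epsilon> U \<and> z \<epsilon> V"
      using open_inter[OF U(1) V(1) y(1) V(2)] by blast
    obtain a where a: "a \<epsilon> omega" "pair a y \<epsilon> b" "\<forall>z. pair a z \<epsilon> b \<longrightarrow> z \<epsilon> W"
      using base[OF W(1,2)] by blast
    let ?q = "upd q n a"
    have uq: "?q \<epsilon> baire_space" by (rule upd_baire[OF q(1) a(1)])
    obtain f j where f: "f \<epsilon> baire_space" "j \<epsilon> omega" "agree ?q f (succ n)"
      "\<forall>i. i \<epsilon> succ n \<longrightarrow> i \<epsilon> j" "\<forall>h. h \<epsilon> baire_space \<longrightarrow> agree f h j \<longrightarrow> h \<notin> M"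
      using rare_baire[OF M uq succ_omega[OF n]] by blast
    obtain z where z: "coded j f z" using coded_nonempty[OF f(2,1) q(2)] by blast
    obtain O' where O': "O' \<epsilon> T" "z \<epsilon> O'" "\<forall>w. w \<epsilon> O' \<longrightarrow> coded j f w"
      using coded_open[OF f(2) z] by blast
    have "w \<epsilon> U \<and> w \<notin> ?K" if w: "w \<epsilon> O'" for w
    proof
      have cj: "coded j f w" using O' w by blast
      have "coded (succ n) f w"
        by (rule coded_antimono[OF f(2) succ_omega[OF n] _ cj]) (use f(4) in blast)
      then have "coded (succ n) ?q w"
        using coded_agree[OF succ_omega[OF n] uq f(1,3)] by blast
      then have "pair a w \<epsilon> b" unfolding coded_upd[OF q(1) a(1) n y(3) a(2)] by blast
      then show "w \<epsilon> U" using a(3) W(3) by blast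
      have "agree q f n"
        using agree_upd[OF q(1) a(1) n] f(3) unfolding agree_def by simp
      moreover have "\<forall>i. i \<epsilon> n \<longrightarrow> i \<epsilon> j" using f(4) by simp
      \<comment> \<open>Functionality of \<open>Q\<close> matters here: \<open>k\<close> determines
        \<open>q\<close>, so the one extension found refutes every possible witness of
        badness.\<close>
      ultimately show "w \<notin> ?K" using f(1,2,5) cj Q[OF k y(2)] by blast
    qed
    then show ?thesis using O' by blast
  qed
qed


section \<open>Generic codes of points\<close>

definition avoids :: "'m \<Rightarrow> 'm \<Rightarrow> 'm \<Rightarrow> 'm \<Rightarrow> bool" where
  "avoids r m f j \<longleftrightarrow> (\<forall>h. h \<epsilon> baire_space \<longrightarrow> agree f h j \<longrightarrow> \<not> pair m h \<epsilon> r)"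

lemma dfn_avoids [dfn_intros]: "dft s \<Longrightarrow> dft m \<Longrightarrow> dft f \<Longrightarrow> dft j \<Longrightarrow>
    dfn (\<lambda>v. avoids (s v) (m v) (f v) (j v))"
  unfolding avoids_def by (intro dfn_intros dft_shift)

text \<open>Dependent choice along states \<open>(m, f, j)\<close>: the first \<open>j\<close>
  values of \<open>f\<close> are settled, and the requirements with index below \<open>m\<close> are
  met. Requirement \<open>m\<close> is \<open>good m f j\<close>: the cylinder misses the
  \<open>m\<close>-th rare set, and if \<open>x\<close> lies in the \<open>m\<close>-th basic set,
  the coded open set is contained in it. The second half makes \<open>x\<close> the only common
  point.\<close>

lemma generic_code:
  assumes n0: "n0 \<epsilon> omega" and x: "coded n0 g x"
    and step: "\<And>m f j. m \<epsilon> omega \<Longrightarrow> j \<epsilon> omega \<Longrightarrow> coded j f x \<Longrightarrow>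
      \<exists>f' j'. f' \<epsilon> baire_space \<and> j' \<epsilon> omega \<and> (\<forall>i. i \<epsilon> j \<longrightarrow> i \<epsilon> j') \<and> agree f f' j \<and>
        coded j' f' x \<and> avoids r m f' j'"
  shows "\<exists>f. f \<epsilon> baire_space \<and> agree g f n0 \<and> (\<forall>m. m \<epsilon> omega \<longrightarrow> \<not> pair m f \<epsilon> r) \<and>
    (\<forall>n. n \<epsilon> omega \<longrightarrow> coded n f x) \<and> (\<forall>y. (\<forall>n. n \<epsilon> omega \<longrightarrow> coded n f y) \<longrightarrow> y = x)"
proof -
  define good where "good m f j \<longleftrightarrow> avoids r m f j \<and>
    (pair m x \<epsilon> b \<longrightarrow> (\<forall>y. coded j f y \<longrightarrow> pair m y \<epsilon> b))" for m f j
  define ok where "ok m f j \<longleftrightarrow> m \<epsilon> omega \<and> j \<epsilon> omega \<and> coded j f x \<and> agree g f n0 \<and>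
    (\<forall>i. i \<epsilon> n0 \<longrightarrow> i \<epsilon> j) \<and> (\<forall>l. l \<epsilon> m \<longrightarrow> good l f j)" for m f j
  define A where "A = Sep (cprod omega (cprod baire_space omega))
    (\<lambda>p. \<exists>m f j. p = pair m (pair f j) \<and> ok m f j)"
  define R where "R p p' \<longleftrightarrow> (\<exists>m f j f' j'. p = pair m (pair f j) \<and> p' = pair (succ m) (pair f' j') \<and>
    agree f f' j \<and> j \<epsilon> j' \<and> (\<forall>i. i \<epsilon> j \<longrightarrow> i \<epsilon> j'))" for p p'
  have xX: "x \<epsilon> X" using coded_dom[OF n0 x] by blast
  have okB: "f \<epsilon> baire_space" if "ok m f j" for m f j
    using that coded_dom unfolding ok_def by blast
  have "p \<epsilon> A \<longleftrightarrow> p \<epsilon> cprod omega (cprod baire_space omega) \<and> (\<exists>m f j. p = pair m (pair f j) \<and> ok m f j)" for p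
    unfolding A_def ok_def good_def by (rule mem_Sep) (intro dfn_intros)
  then have mA: "p \<epsilon> A \<longleftrightarrow> (\<exists>m f j. p = pair m (pair f j) \<and> ok m f j)" for p
    using okB unfolding ok_def by auto
  \<comment> \<open>A requirement once met stays met, because a longer sequence has a smaller
    cylinder and a smaller open set.\<close>
  have good_mono: "good m f' j'" if "good m f j" "agree f f' j" "\<forall>i. i \<epsilon> j \<longrightarrow> i \<epsilon> j'"
    "j \<epsilon> omega" "j' \<epsilon> omega" "f \<epsilon> baire_space" "f' \<epsilon> baire_space" for m f j f' j'
  proof -
    have "agree f h j" if "agree f' h j'" for h
      using that \<open>agree f f' j\<close> \<open>\<forall>i. i \<epsilon> j \<longrightarrow> i \<epsilon> j'\<close> by (simp add: agree_def)
    moreover have "coded j f y" if "coded j' f' y" for y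
      using coded_antimono[OF \<open>j' \<epsilon> omega\<close> \<open>j \<epsilon> omega\<close> _ that] \<open>\<forall>i. i \<epsilon> j \<longrightarrow> i \<epsilon> j'\<close>
        coded_agree[OF \<open>j \<epsilon> omega\<close> \<open>f \<epsilon> baire_space\<close> \<open>f' \<epsilon> baire_space\<close> \<open>agree f f' j\<close>] by blast
    ultimately show ?thesis using that(1) unfolding good_def avoids_def by blast
  qed
  have total: "\<exists>p'. p' \<epsilon> A \<and> R p p'" if p: "p \<epsilon> A" for p
  proof -
    obtain m f j where p: "p = pair m (pair f j)" and k: "ok m f j" using p mA by blast
    have m: "m \<epsilon> omega" and j: "j \<epsilon> omega" and c: "coded j f x" using k unfolding ok_def by auto
    obtain f1 j1 where f1: "f1 \<epsilon> baire_space" "j1 \<epsilon> omega" "\<forall>i. i \<epsilon> j \<longrightarrow> i \<epsilon> j1" "agree f f1 j"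
      "coded j1 f1 x" "avoids r m f1 j1" using step[OF m j c] by blast
    \<comment> \<open>The appended value is \<open>m\<close> when \<open>x\<close> lies in the
      \<open>m\<close>-th basic set, and any index of a basic set around \<open>x\<close> otherwise.
      Either way \<open>x\<close> is kept and the sequence becomes longer.\<close>
    obtain a where a: "a \<epsilon> omega" "pair a x \<epsilon> b" "pair m x \<epsilon> b \<Longrightarrow> a = m"
      using base[OF open_space xX] m by blast
    define f2 where "f2 = upd f1 j1 a"
    have f2: "f2 \<epsilon> baire_space" unfolding f2_def by (rule upd_baire[OF f1(1) a(1)])
    have f12: "agree f1 f2 j1" unfolding f2_def by (rule agree_upd[OF f1(1) a(1) f1(2)])
    have ff2: "agree f f2 j" using f12 f1(3,4) by (simp add: agree_def)
    have c2: "coded (succ j1) f2 y \<longleftrightarrow> coded j1 f1 y \<and> pair a y \<epsilon> b" for y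
      unfolding f2_def by (rule coded_upd[OF f1(1) a(1) f1(2,5) a(2)])
    have gm: "good m f2 (succ j1)"
      unfolding good_def
    proof
      have "agree f1 h j1" if "agree f2 h (succ j1)" for h
        using that f12 by (simp add: agree_def)
      then show "avoids r m f2 (succ j1)" using f1(6) unfolding avoids_def by blast
      show "pair m x \<epsilon> b \<longrightarrow> (\<forall>y. coded (succ j1) f2 y \<longrightarrow> pair m y \<epsilon> b)"
        using c2 a(3) by blast
    qed
    have sub: "\<forall>i. i \<epsilon> j \<longrightarrow> i \<epsilon> succ j1" using f1(3) by simp
    have "good l f2 (succ j1)" if "l \<epsilon> m" for l
      using good_mono[OF _ ff2 sub j succ_omega[OF f1(2)] okB[OF k] f2, of l] that k
      unfolding ok_def by blast
    then have "\<forall>l. l \<epsilon> succ m \<longrightarrow> good l f2 (succ j1)" using gm by simp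
    moreover have "agree g f2 n0" using k ff2 unfolding ok_def by (simp add: agree_def)
    ultimately have "ok (succ m) f2 (succ j1)"
      using m f1(2,5) a(2) c2 k sub unfolding ok_def by simp
    then have "pair (succ m) (pair f2 (succ j1)) \<epsilon> A" using mA by blast
    moreover have "j \<epsilon> succ j1" using omega_subset[OF f1(2) j] f1(3) by auto
    ultimately show ?thesis using p ff2 sub unfolding R_def by blast
  qed
  have "ok nought g n0" unfolding ok_def using n0 x by simp
  then have a0: "pair nought (pair g n0) \<epsilon> A" using mA by blast
  have "dfn (\<lambda>v. R (v 0) (v 1))" unfolding R_def by (intro dfn_intros)
  from DC_ap[OF a0 total this] obtain F where F: "is_fun F omega A"
    "\<And>i. i \<epsilon> omega \<Longrightarrow> R (ap F i) (ap F (succ i))" by blast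
  have ent: "\<exists>m f j. ap F i = pair m (pair f j) \<and> ok m f j" if "i \<epsilon> omega" for i
    using is_fun_ap(2)[OF F(1) that] mA by blast
  have ok: "ok m f j" if "i \<epsilon> omega" "ap F i = pair m (pair f j)" for i m f j
    using ent[OF that(1)] that(2) by auto
  \<comment> \<open>\<open>DC\<close> does not prescribe the first state, so \<open>m\<close> at
    stage \<open>i\<close> need not equal \<open>i\<close>, and only lower bounds are available. For
    the same reason \<open>ok\<close> demands of every state that it agree with \<open>g\<close> up
    to \<open>n0\<close>.\<close>
  have size: "\<forall>m f j. ap F i = pair m (pair f j) \<longrightarrow> (\<forall>k. k \<epsilon> i \<longrightarrow> k \<epsilon> m \<and> k \<epsilon> j)"
    if i: "i \<epsilon> omega" for i
  proof (rule omega_induct[OF _ i])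
    show "dfn (\<lambda>v. \<forall>m f j. ap F (v 0) = pair m (pair f j) \<longrightarrow> (\<forall>k. k \<epsilon> v 0 \<longrightarrow> k \<epsilon> m \<and> k \<epsilon> j))"
      by (intro dfn_intros)
    fix i assume i: "i \<epsilon> omega"
      and IH: "\<forall>m f j. ap F i = pair m (pair f j) \<longrightarrow> (\<forall>k. k \<epsilon> i \<longrightarrow> k \<epsilon> m \<and> k \<epsilon> j)"
    show "\<forall>m f j. ap F (succ i) = pair m (pair f j) \<longrightarrow> (\<forall>k. k \<epsilon> succ i \<longrightarrow> k \<epsilon> m \<and> k \<epsilon> j)"
    proof (intro allI impI)
      fix m' f' j' k assume s: "ap F (succ i) = pair m' (pair f' j')" and k: "k \<epsilon> succ i"
      obtain m f j where e: "ap F i = pair m (pair f j)" "m' = succ m" "j \<epsilon> j'" "\<forall>i. i \<epsilon> j \<longrightarrow> i \<epsilon> j'"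
        using F(2)[OF i] s unfolding R_def by auto
      have mj: "m \<epsilon> omega" "j \<epsilon> omega" using ok[OF i e(1)] unfolding ok_def by auto
      have "\<forall>k. k \<epsilon> i \<longrightarrow> k \<epsilon> m \<and> k \<epsilon> j" using IH e(1) by blast
      then have "k \<epsilon> m \<or> k = m" "k \<epsilon> j \<or> k = j"
        using omega_subset[OF mj(1) i] omega_subset[OF mj(2) i] k by auto
      then show "k \<epsilon> m' \<and> k \<epsilon> j'" using e by auto
    qed
  qed simp
  have coh: "\<forall>i'. i' \<epsilon> i \<longrightarrow> (\<forall>m f j m' f' j'. ap F i = pair m (pair f j) \<and> ap F i' = pair m' (pair f' j') \<longrightarrow>
      (\<forall>k. k \<epsilon> j' \<longrightarrow> k \<epsilon> j \<and> ap f' k = ap f k))" if i: "i \<epsilon> omega" for i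
  proof (rule omega_induct[OF _ i])
    show "dfn (\<lambda>v. \<forall>i'. i' \<epsilon> v 0 \<longrightarrow> (\<forall>m f j m' f' j'. ap F (v 0) = pair m (pair f j) \<and>
      ap F i' = pair m' (pair f' j') \<longrightarrow> (\<forall>k. k \<epsilon> j' \<longrightarrow> k \<epsilon> j \<and> ap f' k = ap f k)))"
      by (intro dfn_intros)
    fix i assume i: "i \<epsilon> omega"
      and IH: "\<forall>i'. i' \<epsilon> i \<longrightarrow> (\<forall>m f j m' f' j'. ap F i = pair m (pair f j) \<and> ap F i' = pair m' (pair f' j') \<longrightarrow>
      (\<forall>k. k \<epsilon> j' \<longrightarrow> k \<epsilon> j \<and> ap f' k = ap f k))"
    show "\<forall>i'. i' \<epsilon> succ i \<longrightarrow> (\<forall>m f j m' f' j'. ap F (succ i) = pair m (pair f j) \<and>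
      ap F i' = pair m' (pair f' j') \<longrightarrow> (\<forall>k. k \<epsilon> j' \<longrightarrow> k \<epsilon> j \<and> ap f' k = ap f k))"
    proof (intro allI impI, elim conjE)
      fix i' m2 f2 j2 m' f' j' k
      assume i': "i' \<epsilon> succ i" and s: "ap F (succ i) = pair m2 (pair f2 j2)"
        and e': "ap F i' = pair m' (pair f' j')" and k: "k \<epsilon> j'"
      obtain m f j where e: "ap F i = pair m (pair f j)" "agree f f2 j" "\<forall>i. i \<epsilon> j \<longrightarrow> i \<epsilon> j2"
        using F(2)[OF i] s unfolding R_def by auto
      have "k \<epsilon> j \<and> ap f' k = ap f k"
      proof (cases "i' = i")
        case True
        then show ?thesis using e e' k by simp
      next
        case False
        then have "i' \<epsilon> i" using i' by simp
        then show ?thesis using IH e(1) e' k by blast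
      qed
      then show "k \<epsilon> j2 \<and> ap f' k = ap f2 k" using e(2,3) by (simp add: agree_def)
    qed
  qed simp
  \<comment> \<open>The limit of the states: value \<open>k\<close> is read off at any stage whose
    settled length exceeds \<open>k\<close>.\<close>
  define L where "L k y \<longleftrightarrow> (\<exists>i m f j. i \<epsilon> omega \<and> ap F i = pair m (pair f j) \<and> k \<epsilon> j \<and> y = ap f k)" for k y
  have dL: "dfn (\<lambda>v. L (v 0) (v 1))" unfolding L_def by (intro dfn_intros)
  define f where "f = rel omega omega L"
  have f: "is_fun f omega omega"
    unfolding f_def
  proof (rule is_fun_rel[OF dL])
    fix k assume k: "k \<epsilon> omega"
    obtain m h j where e: "ap F (succ k) = pair m (pair h j)" "ok m h j"
      using ent[OF succ_omega[OF k]] by blast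
    have "k \<epsilon> j" using size[OF succ_omega[OF k]] e(1) by simp
    then have "L k (ap h k)" unfolding L_def using e(1) succ_omega[OF k] by blast
    moreover have "ap h k \<epsilon> omega"
      using okB[OF e(2)] k is_fun_ap(2) unfolding mem_baire_space by blast
    moreover have "y = z" if y: "L k y" and z: "L k z" for y z
    proof -
      obtain i m f j where 1: "i \<epsilon> omega" "ap F i = pair m (pair f j)" "k \<epsilon> j" "y = ap f k"
        using y unfolding L_def by blast
      obtain i' m' f' j' where 2: "i' \<epsilon> omega" "ap F i' = pair m' (pair f' j')" "k \<epsilon> j'" "z = ap f' k"
        using z unfolding L_def by blast
      consider "i' \<epsilon> i" | "i' = i" | "i \<epsilon> i'" using omega_linear[OF 1(1) 2(1)] by blast
      then have "ap f k = ap f' k"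
      proof cases
        assume "i' \<epsilon> i"
        then have "ap f' k = ap f k" using coh[OF 1(1)] 1(2) 2(2,3) by blast
        then show ?thesis by simp
      next
        assume "i' = i"
        then show ?thesis using 1(2) 2(2) by simp
      next
        assume "i \<epsilon> i'"
        then show ?thesis using coh[OF 2(1)] 1(2,3) 2(2) by blast
      qed
      then show ?thesis using 1(4) 2(4) by simp
    qed
    ultimately show "\<exists>!y. y \<epsilon> omega \<and> L k y" by blast
  qed
  have fB: "f \<epsilon> baire_space" using f by (simp add: mem_baire_space)
  have ag: "agree h f j" if i: "i \<epsilon> omega" and e: "ap F i = pair m (pair h j)" for i m h j
    unfolding agree_def
  proof (intro allI impI)
    fix k assume k: "k \<epsilon> j"
    have o: "ok m h j" by (rule ok[OF i e])
    then have "j \<epsilon> omega" unfolding ok_def by blast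
    then have ko: "k \<epsilon> omega" using k omega_trans(2) by blast
    then have "ap h k \<epsilon> omega"
      using okB[OF o] is_fun_ap(2) unfolding mem_baire_space by blast
    moreover have "L k (ap h k)" unfolding L_def using i e k by blast
    ultimately have "pair k (ap h k) \<epsilon> f" unfolding f_def pair_mem_rel[OF dL] using ko by blast
    then show "ap h k = ap f k" unfolding is_fun_mem[OF f] by blast
  qed
  have good_f: "\<exists>j. j \<epsilon> omega \<and> good k f j" and coded_f: "coded k f x" if k: "k \<epsilon> omega" for k
  proof -
    obtain m h j where e: "ap F (succ k) = pair m (pair h j)" "ok m h j"
      using ent[OF succ_omega[OF k]] by blast
    have km: "k \<epsilon> m" "\<And>i. i \<epsilon> k \<Longrightarrow> i \<epsilon> j" using size[OF succ_omega[OF k]] e(1) by simp_all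
    have j: "j \<epsilon> omega" "coded j h x" "good k h j" using e(2) km(1) unfolding ok_def by blast+
    note a = ag[OF succ_omega[OF k] e(1)]
    have "good k f j" using good_mono[OF j(3) a _ j(1,1) okB[OF e(2)] fB] by blast
    then show "\<exists>j. j \<epsilon> omega \<and> good k f j" using j(1) by blast
    have c: "coded j f x" using coded_agree[OF j(1) okB[OF e(2)] fB a] j(2) by blast
    show "coded k f x" by (rule coded_antimono[OF j(1) k km(2) c])
  qed
  have "agree g f n0"
  proof -
    obtain m h j where e: "ap F nought = pair m (pair h j)" "ok m h j"
      using ent[OF zero_omega] by blast
    then have "agree g h n0" "\<forall>i. i \<epsilon> n0 \<longrightarrow> i \<epsilon> j" unfolding ok_def by blast+
    then show ?thesis using ag[OF zero_omega e(1)] by (simp add: agree_def)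
  qed
  moreover have "\<not> pair m f \<epsilon> r" if "m \<epsilon> omega" for m
    using good_f[OF that] fB agree_refl unfolding good_def avoids_def by blast
  moreover have "y = x" if y: "\<forall>n. n \<epsilon> omega \<longrightarrow> coded n f y" for y
  proof (rule ccontr)
    assume "y \<noteq> x"
    moreover have "y \<epsilon> X" using y coded_dom zero_omega by blast
    ultimately obtain U where U: "U \<epsilon> T" "x \<epsilon> U" "\<not> y \<epsilon> U" using separated[OF xX] by blast
    obtain k where k: "k \<epsilon> omega" "pair k x \<epsilon> b" "\<forall>y. pair k y \<epsilon> b \<longrightarrow> y \<epsilon> U"
      using base[OF U(1,2)] by blast
    then show False using good_f[OF k(1)] y U(3) unfolding good_def by blast
  qed
  ultimately show ?thesis using fB coded_f by blast
qed

text \<open>If \<open>x\<close> is bad for no length \<open>n\<close>, representative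
  \<open>k\<close> and rare set \<open>m\<close>, then every finite sequence whose open set contains
  \<open>x\<close> can be extended as \<open>generic_code\<close> requires. The exceptional points
  thus lie in countably many rare sets given by the one relation \<open>K\<close>.\<close>

lemma generic_code_comeager:
  assumes M: "topology.mgr mem baire_space baire_topology M" and n0: "n0 \<epsilon> omega"
  shows "mgr {x. coded n0 g x \<and> \<not> (\<exists>f. f \<epsilon> baire_space \<and> agree g f n0 \<and> f \<notin> M \<and>
    (\<forall>n. n \<epsilon> omega \<longrightarrow> coded n f x) \<and> (\<forall>y. (\<forall>n. n \<epsilon> omega \<longrightarrow> coded n f y) \<longrightarrow> y = x))}"
proof -
  interpret baire: topology mem baire_space baire_topology by (rule topology_baire)
  obtain r where r: "\<And>n. n \<epsilon> omega \<Longrightarrow> baire.rare {x. pair n x \<epsilon> r}"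
    and Mr: "M \<subseteq> {x. \<exists>n. n \<epsilon> omega \<and> pair n x \<epsilon> r}" using M unfolding baire.mgr_def by blast
  obtain Q where dQ: "\<And>n k f. dft n \<Longrightarrow> dft k \<Longrightarrow> dft f \<Longrightarrow> dfn (\<lambda>v. Q (n v) (k v) (f v))"
    and Q: "\<And>n k f g. n \<epsilon> omega \<Longrightarrow> k \<epsilon> omega \<Longrightarrow> Q n k f \<Longrightarrow> Q n k g \<Longrightarrow> f = g"
      "\<And>n k f. n \<epsilon> omega \<Longrightarrow> k \<epsilon> omega \<Longrightarrow> Q n k f \<Longrightarrow> f \<epsilon> baire_space"
      "\<And>n f. n \<epsilon> omega \<Longrightarrow> f \<epsilon> baire_space \<Longrightarrow> \<exists>k q. k \<epsilon> omega \<and> Q n k q \<and> agree f q n"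
    by (rule countable_dense_baire) blast
  define K where "K n k m x \<longleftrightarrow> (\<exists>q. Q n k q \<and> coded n q x \<and> \<not> (\<exists>f j. f \<epsilon> baire_space \<and>
    j \<epsilon> omega \<and> (\<forall>i. i \<epsilon> n \<longrightarrow> i \<epsilon> j) \<and> agree q f n \<and> coded j f x \<and> avoids r m f j))" for n k m x
  show ?thesis
  proof (rule mgr_family3[of K])
    show "dfn (\<lambda>v. K (n v) (k v) (m v) (x v))" if "dft n" "dft k" "dft m" "dft x" for n k m x
      unfolding K_def by (intro dfn_intros dQ that dft_shift)
    show "rare {x. K n k m x}" if "n \<epsilon> omega" "k \<epsilon> omega" "m \<epsilon> omega" for n k m
      using rare_bad[of "Q n" "{x. pair m x \<epsilon> r}" n k] Q(1) r that
      unfolding K_def avoids_def by simp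
    show "{x. coded n0 g x \<and> \<not> (\<exists>f. f \<epsilon> baire_space \<and> agree g f n0 \<and> f \<notin> M \<and>
        (\<forall>n. n \<epsilon> omega \<longrightarrow> coded n f x) \<and> (\<forall>y. (\<forall>n. n \<epsilon> omega \<longrightarrow> coded n f y) \<longrightarrow> y = x))}
      \<subseteq> {x \<in> ext X. \<exists>n k m. n \<epsilon> omega \<and> k \<epsilon> omega \<and> m \<epsilon> omega \<and> K n k m x}"
    proof (intro subsetI CollectI conjI, elim CollectE conjE)
      fix x assume "coded n0 g x"
      then show "x \<in> ext X" using coded_dom[OF n0] by simp
    next
      fix x assume "x \<in> {x. coded n0 g x \<and> \<not> (\<exists>f. f \<epsilon> baire_space \<and> agree g f n0 \<and> f \<notin> M \<and>
        (\<forall>n. n \<epsilon> omega \<longrightarrow> coded n f x) \<and> (\<forall>y. (\<forall>n. n \<epsilon> omega \<longrightarrow> coded n f y) \<longrightarrow> y = x))}"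
      then have x: "coded n0 g x" and no: "\<not> (\<exists>f. f \<epsilon> baire_space \<and> agree g f n0 \<and> f \<notin> M \<and>
        (\<forall>n. n \<epsilon> omega \<longrightarrow> coded n f x) \<and> (\<forall>y. (\<forall>n. n \<epsilon> omega \<longrightarrow> coded n f y) \<longrightarrow> y = x))"
        by blast+
      show "\<exists>n k m. n \<epsilon> omega \<and> k \<epsilon> omega \<and> m \<epsilon> omega \<and> K n k m x"
      proof (rule ccontr)
        assume nK: "\<not> (\<exists>n k m. n \<epsilon> omega \<and> k \<epsilon> omega \<and> m \<epsilon> omega \<and> K n k m x)"
        have "\<exists>f' j'. f' \<epsilon> baire_space \<and> j' \<epsilon> omega \<and> (\<forall>i. i \<epsilon> j \<longrightarrow> i \<epsilon> j') \<and> agree f f' j \<and>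
          coded j' f' x \<and> avoids r m f' j'" if m: "m \<epsilon> omega" and j: "j \<epsilon> omega" and c: "coded j f x" for m f j
        proof -
          have f: "f \<epsilon> baire_space" using coded_dom[OF j c] by blast
          \<comment> \<open>The representative \<open>q\<close> shares the first \<open>j\<close>
            values with \<open>f\<close>, so both code the same open set at that length.\<close>
          obtain k q where q: "k \<epsilon> omega" "Q j k q" "agree f q j" using Q(3)[OF j f] by blast
          have "coded j q x" using coded_agree[OF j f Q(2)[OF j q(1,2)] q(3)] c by blast
          then obtain f' j' where "f' \<epsilon> baire_space" "j' \<epsilon> omega" "\<forall>i. i \<epsilon> j \<longrightarrow> i \<epsilon> j'"
            "agree q f' j" "coded j' f' x" "avoids r m f' j'"
            using nK m j q(1,2) unfolding K_def by blast
          moreover have "agree f f' j" by (rule agree_trans[OF q(3) \<open>agree q f' j\<close>])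
          ultimately show ?thesis by blast
        qed
        from generic_code[OF n0 x this] show False using no Mr by blast
      qed
    qed
  qed
qed

text \<open>Write A* for \<open>A'\<close>; it equals an open \<open>O'\<close> up to the meager
  \<open>D\<close>. If A* meets \<open>O'\<close>, a cylinder inside \<open>O'\<close> codes an open
  set in which all but meagerly many points have a code in \<open>O'\<close> outside
  \<open>D\<close>, hence in A*, and so lie in \<open>A\<close>. If A* misses \<open>O'\<close>, no
  point of \<open>A\<close> has a singling-out code outside \<open>D\<close>, since that code would
  lie in both; then \<open>A\<close> is meager.\<close>

theorem nonmeager_comeager_somewhere:
  assumes BP and A: "ext A \<subseteq> ext X" and nm: "\<not> mgr (ext A)"
  shows "\<exists>W x. W \<epsilon> T \<and> x \<epsilon> W \<and> mgr (ext W - ext A)"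
proof -
  interpret baire: topology mem baire_space baire_topology by (rule topology_baire)
  define A' where "A' = Sep baire_space (\<lambda>f. \<exists>x. x \<epsilon> A \<and> (\<forall>n. n \<epsilon> omega \<longrightarrow> coded n f x) \<and>
    (\<forall>y. (\<forall>n. n \<epsilon> omega \<longrightarrow> coded n f y) \<longrightarrow> y = x))"
  have A': "f \<epsilon> A' \<longleftrightarrow> f \<epsilon> baire_space \<and> (\<exists>x. x \<epsilon> A \<and> (\<forall>n. n \<epsilon> omega \<longrightarrow> coded n f x) \<and>
    (\<forall>y. (\<forall>n. n \<epsilon> omega \<longrightarrow> coded n f y) \<longrightarrow> y = x))" for f
    unfolding A'_def by (rule mem_Sep) (intro dfn_intros)
  have "baire_property baire_space baire_topology A'"
    using \<open>BP\<close> A' unfolding BP_def by simp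
  then obtain O' D where O': "O' \<epsilon> baire_topology"
    and D: "ext D = (ext A' - ext O') \<union> (ext O' - ext A')" and mD: "baire.mgr (ext D)"
    unfolding baire_property_def baire.meager_iff by (meson mem_ext)
  have mem_D: "f \<epsilon> D \<longleftrightarrow> (f \<epsilon> A' \<longleftrightarrow> \<not> f \<epsilon> O')" for f
    using D mem_ext by blast
  note gen = generic_code_comeager[OF mD]
  show ?thesis
  proof (cases "\<exists>f. f \<epsilon> A' \<and> f \<epsilon> O'")
    case True
    then obtain f where f: "f \<epsilon> A'" "f \<epsilon> O'" by blast
    obtain n where n: "n \<epsilon> omega" "\<And>h. h \<epsilon> baire_space \<Longrightarrow> agree f h n \<Longrightarrow> h \<epsilon> O'"
      using O' f(2) unfolding mem_baire_topology by blast
    obtain x where x: "coded n f x" using f(1) n(1) A' by blast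
    obtain W where W: "W \<epsilon> T" "x \<epsilon> W" "\<forall>z. z \<epsilon> W \<longrightarrow> coded n f z"
      using coded_open[OF n(1) x] by blast
    have "mgr (ext W - ext A)"
    proof (rule mgr_subset[OF gen[OF n(1), of f]], rule subsetI, rule CollectI, rule conjI)
      fix z assume z: "z \<in> ext W - ext A"
      then show "coded n f z" using W(3) by simp
      show "\<not> (\<exists>h. h \<epsilon> baire_space \<and> agree f h n \<and> h \<notin> ext D \<and>
        (\<forall>n. n \<epsilon> omega \<longrightarrow> coded n h z) \<and> (\<forall>y. (\<forall>n. n \<epsilon> omega \<longrightarrow> coded n h y) \<longrightarrow> y = z))"
      proof (rule notI, elim exE conjE)
        fix h assume h: "h \<epsilon> baire_space" "agree f h n" "h \<notin> ext D"
          "\<forall>n. n \<epsilon> omega \<longrightarrow> coded n h z"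
        have "h \<epsilon> A'" using n(2)[OF h(1,2)] h(3) mem_D by simp
        then have "z \<epsilon> A" using A' h(4) by blast
        then show False using z by simp
      qed
    qed
    then show ?thesis using W by blast
  next
    case False
    \<comment> \<open>At length 0 every sequence codes all of \<open>X\<close>; the zero sequence is
      just some element of the Baire space.\<close>
    have "mgr (ext A)"
    proof (rule mgr_subset[OF gen[OF zero_omega, of "lam omega omega (\<lambda>_. nought)"]],
        rule subsetI, rule CollectI, rule conjI)
      let ?g = "lam omega omega (\<lambda>_. nought)"
      fix x assume "x \<in> ext A"
      then have x: "x \<epsilon> A" "x \<epsilon> X" using A by auto
      have "is_fun ?g omega omega" by (rule is_fun_lam) (auto intro!: dfn_intros)
      then show "coded nought ?g x" unfolding coded_nought mem_baire_space using x by blast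
      show "\<not> (\<exists>h. h \<epsilon> baire_space \<and> agree ?g h nought \<and> h \<notin> ext D \<and>
        (\<forall>n. n \<epsilon> omega \<longrightarrow> coded n h x) \<and> (\<forall>y. (\<forall>n. n \<epsilon> omega \<longrightarrow> coded n h y) \<longrightarrow> y = x))"
      proof (rule notI, elim exE conjE)
        fix h assume h: "h \<epsilon> baire_space" "h \<notin> ext D" "\<forall>n. n \<epsilon> omega \<longrightarrow> coded n h x"
          "\<forall>y. (\<forall>n. n \<epsilon> omega \<longrightarrow> coded n h y) \<longrightarrow> y = x"
        have "h \<epsilon> A'" unfolding A' by (intro conjI exI[of _ x] h x(1))
        moreover have "\<not> h \<epsilon> D" using h(2) by simp
        ultimately show False using False mem_D by blast
      qed
    qed
    then show ?thesis using nm by blast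
  qed
qed

end

section \<open>Separable metrizable spaces\<close>

text \<open>What the metric arguments take from the reals of the structure: an ordered abelian group
  in which positive elements can be halved. Rationals then need not be developed inside the
  structure.\<close>

locale halving_group =
  fixes C :: "'a set" and pls :: "'a \<Rightarrow> 'a \<Rightarrow> 'a" (infixl "\<boxplus>" 65) and z :: 'a
    and leq :: "'a \<Rightarrow> 'a \<Rightarrow> bool" (infix "\<preceq>" 50)
  assumes closed [simp]: "x \<in> C \<Longrightarrow> y \<in> C \<Longrightarrow> x \<boxplus> y \<in> C"
    and assoc: "x \<in> C \<Longrightarrow> y \<in> C \<Longrightarrow> w \<in> C \<Longrightarrow> x \<boxplus> y \<boxplus> w = x \<boxplus> (y \<boxplus> w)"
    and comm: "x \<in> C \<Longrightarrow> y \<in> C \<Longrightarrow> x \<boxplus> y = y \<boxplus> x"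
    and z_closed [simp]: "z \<in> C"
    and z_right [simp]: "x \<in> C \<Longrightarrow> x \<boxplus> z = x"
    and inverse: "x \<in> C \<Longrightarrow> \<exists>y\<in>C. x \<boxplus> y = z"
    and refl [simp]: "x \<in> C \<Longrightarrow> x \<preceq> x"
    and antisym: "x \<in> C \<Longrightarrow> y \<in> C \<Longrightarrow> x \<preceq> y \<Longrightarrow> y \<preceq> x \<Longrightarrow> x = y"
    and trans: "x \<in> C \<Longrightarrow> y \<in> C \<Longrightarrow> w \<in> C \<Longrightarrow> x \<preceq> y \<Longrightarrow> y \<preceq> w \<Longrightarrow> x \<preceq> w"
    and total: "x \<in> C \<Longrightarrow> y \<in> C \<Longrightarrow> x \<preceq> y \<or> y \<preceq> x"
    and translate: "x \<in> C \<Longrightarrow> y \<in> C \<Longrightarrow> w \<in> C \<Longrightarrow> x \<preceq> y \<Longrightarrow> x \<boxplus> w \<preceq> y \<boxplus> w"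
    and halve: "e \<in> C \<Longrightarrow> z \<preceq> e \<Longrightarrow> z \<noteq> e \<Longrightarrow> \<exists>h\<in>C. z \<preceq> h \<and> z \<noteq> h \<and> h \<boxplus> h \<preceq> e"
    and positive: "\<exists>e\<in>C. z \<preceq> e \<and> z \<noteq> e"
begin

definition lt :: "'a \<Rightarrow> 'a \<Rightarrow> bool" (infix "\<prec>" 50) where
  "x \<prec> y \<longleftrightarrow> x \<preceq> y \<and> x \<noteq> y"

lemma not_leq: "x \<in> C \<Longrightarrow> y \<in> C \<Longrightarrow> \<not> y \<preceq> x \<longleftrightarrow> x \<prec> y"
  unfolding lt_def using total antisym refl by blast

lemma lt_leq: "x \<prec> y \<Longrightarrow> x \<preceq> y"
  by (simp add: lt_def)

lemma lt_leq_trans: "x \<in> C \<Longrightarrow> y \<in> C \<Longrightarrow> w \<in> C \<Longrightarrow> x \<prec> y \<Longrightarrow> y \<preceq> w \<Longrightarrow> x \<prec> w"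
  unfolding lt_def using trans antisym by blast

lemma leq_lt_trans: "x \<in> C \<Longrightarrow> y \<in> C \<Longrightarrow> w \<in> C \<Longrightarrow> x \<preceq> y \<Longrightarrow> y \<prec> w \<Longrightarrow> x \<prec> w"
  unfolding lt_def using trans antisym by blast

lemma cancel_leq:
  assumes "x \<in> C" "y \<in> C" "w \<in> C" "x \<boxplus> w \<preceq> y \<boxplus> w"
  shows "x \<preceq> y"
proof -
  obtain v where v: "v \<in> C" "w \<boxplus> v = z" using inverse[OF assms(3)] by blast
  have "x \<boxplus> w \<boxplus> v \<preceq> y \<boxplus> w \<boxplus> v" using translate assms v(1) by simp
  then show ?thesis using assms v by (simp add: assoc)
qed

lemma add_mono:
  assumes "x \<in> C" "y \<in> C" "w \<in> C" "v \<in> C" "x \<preceq> y" "w \<preceq> v"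
  shows "x \<boxplus> w \<preceq> y \<boxplus> v"
proof -
  have "x \<boxplus> w \<preceq> y \<boxplus> w" using translate assms by simp
  moreover have "y \<boxplus> w \<preceq> y \<boxplus> v" using translate[of w v y] assms comm[of y] by simp
  ultimately show ?thesis using trans[of "x \<boxplus> w" "y \<boxplus> w" "y \<boxplus> v"] assms by simp
qed

lemma add_strict_mono:
  assumes "x \<in> C" "y \<in> C" "w \<in> C" "v \<in> C" "x \<prec> y" "w \<preceq> v"
  shows "x \<boxplus> w \<prec> y \<boxplus> v"
proof (rule ccontr)
  assume "\<not> x \<boxplus> w \<prec> y \<boxplus> v"
  then have "y \<boxplus> v \<preceq> x \<boxplus> w" using not_leq[of "x \<boxplus> w" "y \<boxplus> v"] assms by simp
  moreover have "x \<boxplus> w \<preceq> x \<boxplus> v" using add_mono assms by simp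
  ultimately have "y \<boxplus> v \<preceq> x \<boxplus> v" using trans[of "y \<boxplus> v" "x \<boxplus> w" "x \<boxplus> v"] assms by simp
  then have "y \<preceq> x" using cancel_leq assms by blast
  then show False using assms not_leq by blast
qed

lemma lt_diff:
  assumes "x \<in> C" "y \<in> C" "x \<prec> y"
  shows "\<exists>d\<in>C. z \<prec> d \<and> x \<boxplus> d = y"
proof -
  obtain v where v: "v \<in> C" "x \<boxplus> v = z" using inverse[OF assms(1)] by blast
  have "x \<boxplus> v \<prec> y \<boxplus> v" using add_strict_mono assms v(1) by simp
  moreover have "x \<boxplus> (y \<boxplus> v) = y"
    using assms v assoc[of y x v] assoc[of x y v] comm[of x y] by simp
  ultimately show ?thesis using v assms by auto
qed

end

section \<open>Metrics with values in such a group\<close>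

locale valued_metric = halving_group +
  fixes X :: "'b set" and D :: "'b \<Rightarrow> 'b \<Rightarrow> 'a"
  assumes D_closed [simp]: "x \<in> X \<Longrightarrow> y \<in> X \<Longrightarrow> D x y \<in> C"
    and D_pos: "x \<in> X \<Longrightarrow> y \<in> X \<Longrightarrow> z \<preceq> D x y"
    and D_zero: "x \<in> X \<Longrightarrow> y \<in> X \<Longrightarrow> D x y = z \<longleftrightarrow> x = y"
    and D_sym: "x \<in> X \<Longrightarrow> y \<in> X \<Longrightarrow> D x y = D y x"
    and D_triangle: "x \<in> X \<Longrightarrow> y \<in> X \<Longrightarrow> w \<in> X \<Longrightarrow> D x w \<preceq> D x y \<boxplus> D y w"
begin

lemma ball_open:
  assumes "p \<in> X" "y \<in> X" "e \<in> C" "D p y \<prec> e"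
  shows "\<exists>d\<in>C. z \<prec> d \<and> (\<forall>w\<in>X. D y w \<prec> d \<longrightarrow> D p w \<prec> e)"
proof -
  obtain d where d: "d \<in> C" "z \<prec> d" "D p y \<boxplus> d = e" using lt_diff assms D_closed by blast
  have "D p w \<prec> e" if w: "w \<in> X" "D y w \<prec> d" for w
  proof -
    have "D y w \<boxplus> D p y \<prec> d \<boxplus> D p y" using add_strict_mono assms d w by simp
    then have "D p y \<boxplus> D y w \<prec> e" using d assms w comm[of "D p y"] by simp
    then show ?thesis using leq_lt_trans[OF _ _ _ D_triangle[of p y w]] assms w by simp
  qed
  then show ?thesis using d by blast
qed

lemma lt_D: "x \<in> X \<Longrightarrow> y \<in> X \<Longrightarrow> x \<noteq> y \<Longrightarrow> z \<prec> D x y"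
  unfolding lt_def using D_pos D_zero by metis

lemma not_lt_z: "x \<in> X \<Longrightarrow> y \<in> X \<Longrightarrow> \<not> D x y \<prec> z"
  using D_pos not_leq[of "D x y" z] by simp

text \<open>Around a non-isolated point, distances between points of a dense set serve as radii.\<close>

lemma distances_as_radii:
  assumes x: "x \<in> X" and r: "r \<in> C" "z \<prec> r"
  shows "\<exists>h\<in>C. z \<prec> h \<and> (\<forall>q\<in>X. q \<noteq> x \<and> D x q \<prec> h \<longrightarrow> (\<exists>k\<in>C. z \<prec> k \<and>
    (\<forall>p\<in>X. D x p \<prec> k \<longrightarrow> D p x \<prec> D p q \<and> (\<forall>y\<in>X. D p y \<prec> D p q \<longrightarrow> D x y \<prec> r))))"
proof -
  obtain h where h: "h \<in> C" "z \<prec> h" "h \<boxplus> h \<preceq> r" using halve r unfolding lt_def by blast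
  have "\<exists>k\<in>C. z \<prec> k \<and> (\<forall>p\<in>X. D x p \<prec> k \<longrightarrow> D p x \<prec> D p q \<and>
      (\<forall>y\<in>X. D p y \<prec> D p q \<longrightarrow> D x y \<prec> r))" if q: "q \<in> X" "q \<noteq> x" "D x q \<prec> h" for q
  proof -
    \<comment> \<open>With \<open>2k \<le> D x q\<close>, a point \<open>p\<close> within
      \<open>k\<close> of \<open>x\<close> is closer to \<open>x\<close> than to \<open>q\<close>,
      for otherwise \<open>D x q < 2k\<close>.\<close>
    obtain k where k: "k \<in> C" "z \<prec> k" "k \<boxplus> k \<preceq> D x q"
      using halve[of "D x q"] lt_D[of x q] x q unfolding lt_def by auto
    have "D p x \<prec> D p q \<and> (\<forall>y\<in>X. D p y \<prec> D p q \<longrightarrow> D x y \<prec> r)"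
      if p: "p \<in> X" "D x p \<prec> k" for p
    proof
      have px: "D p x = D x p" using D_sym p x by blast
      show "D p x \<prec> D p q"
      proof (rule ccontr)
        assume "\<not> D p x \<prec> D p q"
        then have "D p q \<preceq> D p x" using not_leq[of "D p x" "D p q"] p q x by simp
        then have "D p q \<preceq> k"
          using trans[of "D p q" "D p x" k] px p q x k(1) lt_leq by simp
        then have "D x p \<boxplus> D p q \<prec> k \<boxplus> k" using add_strict_mono p q x k(1) by simp
        then have "D x p \<boxplus> D p q \<prec> D x q"
          using lt_leq_trans[of "D x p \<boxplus> D p q" "k \<boxplus> k" "D x q"] k p q x by simp
        then show False using D_triangle[of x p q] not_leq[of "D x p \<boxplus> D p q" "D x q"] p q x by simp
      qed
      \<comment> \<open>The chain is \<open>D x y < D p q + D x p \<le> 2 D x p + D x q \<le> 2 D x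
        q \<le> 2h \<le> r\<close>.\<close>
      show "\<forall>y\<in>X. D p y \<prec> D p q \<longrightarrow> D x y \<prec> r"
      proof (intro ballI impI)
        fix y assume y: "y \<in> X" "D p y \<prec> D p q"
        have a: "D p y \<boxplus> D x p \<prec> D p q \<boxplus> D x p"
          using add_strict_mono[OF _ _ _ _ y(2), of "D x p" "D x p"] p q x y by simp
        have "D x y \<preceq> D p y \<boxplus> D x p"
          using D_triangle[of x p y] comm[of "D x p" "D p y"] p x y by simp
        from leq_lt_trans[OF _ _ _ this a] have 1: "D x y \<prec> D p q \<boxplus> D x p" using p q x y by simp
        have "D p q \<preceq> D x p \<boxplus> D x q" using D_triangle[of p x q] px p q x by simp
        from translate[OF _ _ _ this, of "D x p"]
        have s1: "D p q \<boxplus> D x p \<preceq> D x p \<boxplus> D x p \<boxplus> D x q"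
          using p q x assoc[of "D x p" "D x q" "D x p"] comm[of "D x q" "D x p"]
            assoc[of "D x p" "D x p" "D x q"] by simp
        have s2: "D x p \<boxplus> D x p \<boxplus> D x q \<preceq> k \<boxplus> k \<boxplus> D x q"
          using add_mono lt_leq[OF p(2)] p q x k(1) by simp
        have s3: "k \<boxplus> k \<boxplus> D x q \<preceq> D x q \<boxplus> D x q"
          using add_mono[of "k \<boxplus> k" "D x q" "D x q" "D x q"] k q x by simp
        have s4: "D x q \<boxplus> D x q \<preceq> h \<boxplus> h"
          using add_mono lt_leq[OF q(3)] q x h(1) by simp
        have "D p q \<boxplus> D x p \<preceq> k \<boxplus> k \<boxplus> D x q"
          by (rule trans[OF _ _ _ s1 s2]) (use p q x k in simp_all)
        from trans[OF _ _ _ this s3] have "D p q \<boxplus> D x p \<preceq> D x q \<boxplus> D x q"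
          using p q x k by simp
        from trans[OF _ _ _ this s4] have "D p q \<boxplus> D x p \<preceq> h \<boxplus> h"
          using p q x h by simp
        from trans[OF _ _ _ this h(3)] have "D p q \<boxplus> D x p \<preceq> r"
          using p q x h r by simp
        then show "D x y \<prec> r" using lt_leq_trans[OF _ _ _ 1] p q x y r by simp
      qed
    qed
    then show ?thesis using k by blast
  qed
  then show ?thesis using h by blast
qed

end

section \<open>The reals of the structure and a countable base\<close>

context ZF
begin

lemma halving_group_reals:
  assumes "complete_ordered_field R a m z u l"
  shows "halving_group (ext R) (app2 a) z (le l)"
proof -
  note c = assms[unfolded complete_ordered_field_def]
  interpret K: field "ring_of R a m z u" using c by blast
  have K: "carrier (ring_of R a m z u) = ext R" "add (ring_of R a m z u) = app2 a"
    "zero (ring_of R a m z u) = z" "one (ring_of R a m z u) = u"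
    by (simp_all add: ring_of_def)
  let ?p = "app2 a"
  have cl: "?p x y \<in> ext R" if "x \<in> ext R" "y \<in> ext R" for x y
    using K.a_closed that unfolding K .
  have zR: "z \<in> ext R" and uR: "u \<in> ext R" and uz: "u \<noteq> z"
    using K.zero_closed K.one_closed K.one_not_zero unfolding K by auto
  have zl: "?p z x = x" if "x \<in> ext R" for x using K.l_zero that unfolding K by blast
  have "\<forall>x\<in>ext R. le l x x" using c by (elim conjE)
  then have refl: "le l x x" if "x \<in> ext R" for x using that by blast
  have "\<forall>x\<in>ext R. \<forall>y\<in>ext R. le l x y \<and> le l y x \<longrightarrow> x = y" using c by (elim conjE)
  then have anti: "x = y" if "x \<in> ext R" "y \<in> ext R" "le l x y" "le l y x" for x y
    using that by blast
  have "\<forall>x\<in>ext R. \<forall>y\<in>ext R. \<forall>w\<in>ext R. le l x y \<and> le l y w \<longrightarrow> le l x w"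
    using c by (elim conjE)
  then have tran: "le l x w"
    if "x \<in> ext R" "y \<in> ext R" "w \<in> ext R" "le l x y" "le l y w" for x y w
    using that by blast
  have "\<forall>x\<in>ext R. \<forall>y\<in>ext R. le l x y \<or> le l y x" using c by (elim conjE)
  then have tot: "le l x y \<or> le l y x" if "x \<in> ext R" "y \<in> ext R" for x y
    using that by blast
  have "\<forall>x\<in>ext R. \<forall>y\<in>ext R. \<forall>w\<in>ext R. le l x y \<longrightarrow> le l (app2 a x w) (app2 a y w)"
    using c by (elim conjE)
  then have tl: "le l (?p x w) (?p y w)"
    if "x \<in> ext R" "y \<in> ext R" "w \<in> ext R" "le l x y" for x y w
    using that by blast
  \<comment> \<open>If \<open>1 + 1\<close> were zero, adding \<open>1\<close> to either of
    \<open>1 \<le> 0\<close> and \<open>0 \<le> 1\<close> would give the other one. Dividing by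
    \<open>1 + 1\<close> is how elements are halved below.\<close>
  have two: "?p u u \<noteq> z"
  proof
    assume 0: "?p u u = z"
    from tot[OF uR zR] show False
    proof
      assume "le l u z"
      then have "le l z u" using tl[OF uR zR uR] 0 zl[OF uR] by simp
      then show False using \<open>le l u z\<close> anti uR zR uz by blast
    next
      assume "le l z u"
      then have "le l u z" using tl[OF zR uR uR] 0 zl[OF uR] by simp
      then show False using \<open>le l z u\<close> anti uR zR uz by blast
    qed
  qed
  have half: "\<exists>h\<in>ext R. ?p h h = e" if e: "e \<in> ext R" for e
  proof -
    let ?K = "ring_of R a m z u"
    have t: "u \<oplus>\<^bsub>?K\<^esub> u \<in> Units ?K" using two cl uR K.field_Units K by auto
    define i where "i = inv\<^bsub>?K\<^esub> (u \<oplus>\<^bsub>?K\<^esub> u)"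
    have i: "i \<in> carrier ?K" "i \<otimes>\<^bsub>?K\<^esub> (u \<oplus>\<^bsub>?K\<^esub> u) = u"
      using K.Units_inv_closed[OF t] K.Units_l_inv[OF t] K unfolding i_def by auto
    have c: "e \<in> carrier ?K" "u \<in> carrier ?K" using e uR K by auto
    have "(i \<otimes>\<^bsub>?K\<^esub> e) \<oplus>\<^bsub>?K\<^esub> (i \<otimes>\<^bsub>?K\<^esub> e) = (i \<oplus>\<^bsub>?K\<^esub> i) \<otimes>\<^bsub>?K\<^esub> e"
      using i(1) c by (simp add: K.l_distr)
    also have "i \<oplus>\<^bsub>?K\<^esub> i = i \<otimes>\<^bsub>?K\<^esub> (u \<oplus>\<^bsub>?K\<^esub> u)"
      using K.r_distr[OF c(2,2) i(1)] K.r_one[OF i(1)] K(4) by simp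
    also have "\<dots> \<otimes>\<^bsub>?K\<^esub> e = e" using i(2) K.l_one[OF c(1)] K(4) by simp
    finally show ?thesis using K.m_closed[OF i(1) c(1)] unfolding K by blast
  qed
  show ?thesis
  proof
    show "?p (?p x y) w = ?p x (?p y w)" if "x \<in> ext R" "y \<in> ext R" "w \<in> ext R" for x y w
      using K.a_assoc that unfolding K .
    show "?p x y = ?p y x" if "x \<in> ext R" "y \<in> ext R" for x y
      using K.a_comm that unfolding K .
    show "?p x z = x" if "x \<in> ext R" for x using K.r_zero that unfolding K .
    show "\<exists>y\<in>ext R. ?p x y = z" if "x \<in> ext R" for x
      using K.a_inv_closed[of x] K.r_neg[of x] that unfolding K by blast
    show "\<exists>h\<in>ext R. le l z h \<and> z \<noteq> h \<and> le l (?p h h) e"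
      if e: "e \<in> ext R" "le l z e" "z \<noteq> e" for e
    proof -
      obtain h where h: "h \<in> ext R" "?p h h = e" using half e by blast
      have "\<not> le l h z"
      proof
        assume hz: "le l h z"
        have "le l e h" using tl[OF h(1) zR h(1) hz] h zl by simp
        then have "le l e z" using tran[OF e(1) h(1) zR _ hz] by blast
        then show False using anti e zR by blast
      qed
      then have "le l z h" "z \<noteq> h" using tot[OF h(1) zR] refl[OF zR] by auto
      then show ?thesis using h refl[OF e(1)] by auto
    qed
    \<comment> \<open>Whichever of \<open>u\<close> and its negative is positive will do as
      witness.\<close>
    show "\<exists>e\<in>ext R. le l z e \<and> z \<noteq> e"
    proof (cases "le l z u")
      case True
      then show ?thesis using uR uz by blast
    next
      case False
      then have uz': "le l u z" using tot[OF uR zR] by blast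
      obtain v where v: "v \<in> ext R" "?p u v = z"
        using K.a_inv_closed[of u] K.r_neg[of u] uR unfolding K by blast
      have "le l z v" using tl[OF uR zR v(1) uz'] v zl by simp
      moreover have "z \<noteq> v" using v(2) uz K.r_zero[of u] uR unfolding K by auto
      ultimately show ?thesis using v(1) by blast
    qed
    show "?p x y \<in> ext R" if "x \<in> ext R" "y \<in> ext R" for x y using that by (rule cl)
    show "z \<in> ext R" by (rule zR)
    show "le l x x" if "x \<in> ext R" for x using that by (rule refl)
    show "x = y" if "x \<in> ext R" "y \<in> ext R" "le l x y" "le l y x" for x y
      using that by (rule anti)
    show "le l x w" if "x \<in> ext R" "y \<in> ext R" "w \<in> ext R" "le l x y" "le l y w" for x y w
      using that by (rule tran)
    show "le l x y \<or> le l y x" if "x \<in> ext R" "y \<in> ext R" for x y using that by (rule tot)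
    show "le l (?p x w) (?p y w)"
      if "x \<in> ext R" "y \<in> ext R" "w \<in> ext R" "le l x y" for x y w
      using that by (rule tl)
  qed
qed


text \<open>The basic open sets are indexed by pairs \<open>(p, q)\<close> from the countable dense
  set: the ball about \<open>p\<close> of radius \<open>D p q\<close>. This replaces rational radii.
  For \<open>p = q\<close> that ball is empty, and the index \<open>(p, p)\<close> is reused for the
  singleton of \<open>p\<close> when \<open>p\<close> is isolated.\<close>

lemma coded_space_exists:
  assumes "ZF_DC mem" "separable X S" "metrizable X S"
  shows "\<exists>b. coded_space mem X S b"
proof -
  interpret ZF_DC mem by fact
  obtain R a m z u l d where cof: "complete_ordered_field R a m z u l"
    and md: "metric_on R a z l X d" and mt: "metric_topology R z l X d S"
    using assms(3) unfolding metrizable_def by blast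
  note h = halving_group_reals[OF cof]
  define D where "D x y = ap d (pair x y)" for x y
  have fd: "is_fun d (cprod X X) R" using md unfolding metric_on_def by (elim conjE)
  have appD: "app2 d x y = D x y" if "x \<in> ext X" "y \<in> ext X" for x y
    using is_fun_ap(1)[OF fd, of "pair x y"] that unfolding app2_def D_def by simp
  interpret M: valued_metric "ext R" "app2 a" z "le l" "ext X" D
  proof (intro valued_metric.intro h valued_metric_axioms.intro)
    show "D x y \<in> ext R" if "x \<in> ext X" "y \<in> ext X" for x y
      using is_fun_ap(2)[OF fd, of "pair x y"] that unfolding D_def by simp
    have "\<forall>x\<in>ext X. \<forall>y\<in>ext X. le l z (app2 d x y)"
      using md unfolding metric_on_def by (elim conjE)
    then show "le l z (D x y)" if "x \<in> ext X" "y \<in> ext X" for x y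
      using appD[OF that] that by metis
    have "\<forall>x\<in>ext X. \<forall>y\<in>ext X. app2 d x y = z \<longleftrightarrow> x = y"
      using md unfolding metric_on_def by (elim conjE)
    then show "D x y = z \<longleftrightarrow> x = y" if "x \<in> ext X" "y \<in> ext X" for x y
      using appD[OF that] that by metis
    have "\<forall>x\<in>ext X. \<forall>y\<in>ext X. app2 d x y = app2 d y x"
      using md unfolding metric_on_def by (elim conjE)
    then show "D x y = D y x" if "x \<in> ext X" "y \<in> ext X" for x y
      using appD[OF that] appD[OF that(2,1)] that by metis
    have "\<forall>x\<in>ext X. \<forall>y\<in>ext X. \<forall>w\<in>ext X.
        le l (app2 d x w) (app2 a (app2 d x y) (app2 d y w))"
      using md unfolding metric_on_def by (elim conjE)
    then show "le l (D x w) (app2 a (D x y) (D y w))"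
      if "x \<in> ext X" "y \<in> ext X" "w \<in> ext X" for x y w
      using appD[OF that(1,2)] appD[OF that(2,3)] appD[OF that(1,3)] that by metis
  qed
  have lt: "less l = M.lt" unfolding less_def M.lt_def fun_eq_iff by blast
  have op: "U \<epsilon> S \<longleftrightarrow> (\<forall>x. x \<epsilon> U \<longrightarrow> x \<epsilon> X) \<and> (\<forall>x. x \<epsilon> U \<longrightarrow>
    (\<exists>r\<in>ext R. M.lt z r \<and> (\<forall>y\<in>ext X. M.lt (D x y) r \<longrightarrow> y \<epsilon> U)))" for U
  proof -
    have "U \<epsilon> S \<longleftrightarrow> ext U \<subseteq> ext X \<and> (\<forall>x\<in>ext U. \<exists>r\<in>ext R. M.lt z r \<and>
      (\<forall>y\<in>ext X. M.lt (app2 d x y) r \<longrightarrow> y \<epsilon> U))"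
      using mt unfolding metric_topology_def lt by blast
    also have "\<dots> \<longleftrightarrow> ext U \<subseteq> ext X \<and> (\<forall>x\<in>ext U. \<exists>r\<in>ext R. M.lt z r \<and>
      (\<forall>y\<in>ext X. M.lt (D x y) r \<longrightarrow> y \<epsilon> U))"
      using appD by (smt (verit) subsetD)
    finally show ?thesis by simp
  qed
  define ball where "ball p e = Sep X (\<lambda>y. M.lt (D p y) e)" for p e
  have dlt: "dft s \<Longrightarrow> dft t \<Longrightarrow> dfn (\<lambda>v. M.lt (s v) (t v))" for s t
    unfolding lt[symmetric] less_def le_def by (intro dfn_intros)
  have dD: "dft s \<Longrightarrow> dft t \<Longrightarrow> dft (\<lambda>v. D (s v) (t v))" for s t
    unfolding D_def by (intro dfn_intros)
  have ball: "y \<epsilon> ball p e \<longleftrightarrow> y \<epsilon> X \<and> M.lt (D p y) e" for y p e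
    unfolding ball_def by (rule mem_Sep) (intro dfn_intros dlt dD)
  have ball_S: "ball p e \<epsilon> S" if "p \<epsilon> X" "e \<epsilon> R" for p e
    unfolding op ball using M.ball_open[of p _ e] that by fastforce
  have ball_c: "x \<epsilon> ball x e" if "x \<epsilon> X" "M.lt z e" for x e
    using that M.D_zero[of x x] unfolding ball by simp
  have min: "\<exists>t\<in>ext R. M.lt z t \<and> (\<forall>x\<in>ext R. M.lt x t \<longrightarrow> M.lt x r \<and> M.lt x s)"
    if rs: "r \<in> ext R" "M.lt z r" "s \<in> ext R" "M.lt z s" for r s
  proof (cases "le l r s")
    case True
    then show ?thesis using M.lt_leq_trans[of _ r s] rs by blast
  next
    case False
    then have "le l s r" using M.total rs by blast
    then show ?thesis using M.lt_leq_trans[of _ s r] rs by blast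
  qed
  interpret topology mem X S
  proof
    show "x \<epsilon> X" if "U \<epsilon> S" "x \<epsilon> U" for U x using that op by blast
    obtain e where "e \<in> ext R" "M.lt z e" using M.positive unfolding M.lt_def by blast
    then show "X \<epsilon> S" unfolding op by auto
    show "V \<epsilon> S" if V: "\<And>x. x \<epsilon> V \<Longrightarrow> \<exists>U. U \<epsilon> S \<and> x \<epsilon> U \<and> (\<forall>y. y \<epsilon> U \<longrightarrow> y \<epsilon> V)" for V
      unfolding op
    proof (intro conjI allI impI)
      fix x assume "x \<epsilon> V"
      then obtain U where U: "U \<epsilon> S" "x \<epsilon> U" "\<forall>y. y \<epsilon> U \<longrightarrow> y \<epsilon> V" using V by blast
      show "x \<epsilon> X" using U(1,2) op by blast
      obtain r where "r\<in>ext R" "M.lt z r" "\<forall>y\<in>ext X. M.lt (D x y) r \<longrightarrow> y \<epsilon> U"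
        using U(1,2) op by blast
      then show "\<exists>r\<in>ext R. M.lt z r \<and> (\<forall>y\<in>ext X. M.lt (D x y) r \<longrightarrow> y \<epsilon> V)"
        using U(3) by blast
    qed
    show "\<exists>W. W \<epsilon> S \<and> x \<epsilon> W \<and> (\<forall>y. y \<epsilon> W \<longrightarrow> y \<epsilon> U \<and> y \<epsilon> V)"
      if UV: "U \<epsilon> S" "V \<epsilon> S" "x \<epsilon> U" "x \<epsilon> V" for U V x
    proof -
      obtain r where r: "r\<in>ext R" "M.lt z r" "\<forall>y\<in>ext X. M.lt (D x y) r \<longrightarrow> y \<epsilon> U"
        using UV(1,3) op by blast
      obtain s where s: "s\<in>ext R" "M.lt z s" "\<forall>y\<in>ext X. M.lt (D x y) s \<longrightarrow> y \<epsilon> V"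
        using UV(2,4) op by blast
      obtain t where t: "t \<in> ext R" "M.lt z t"
        "\<forall>x\<in>ext R. M.lt x t \<longrightarrow> M.lt x r \<and> M.lt x s" using min[OF r(1,2) s(1,2)] by blast
      have x: "x \<epsilon> X" using UV(1,3) op by blast
      have "y \<epsilon> U \<and> y \<epsilon> V" if "y \<epsilon> ball x t" for y
      proof -
        have y: "y \<in> ext X" "M.lt (D x y) t" using that unfolding ball by auto
        then have "M.lt (D x y) r \<and> M.lt (D x y) s"
          using t(3) M.D_closed[of x y] x by simp
        then show ?thesis using r(3) s(3) y(1) by blast
      qed
      then show ?thesis using ball_S[OF x, of t] ball_c[OF x t(2)] t(1) by auto
    qed
  qed
  obtain Q where Q: "ext Q \<subseteq> ext X" "countable_set Q" "cl X S Q = ext X"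
    using assms(2) unfolding separable_def by blast
  have dense: "\<exists>q. q \<epsilon> Q \<and> q \<epsilon> U" if "U \<epsilon> S" "x \<epsilon> U" for U x
  proof -
    have "x \<in> cl X S Q" using Q(3) that open_subset by simp
    then have "ext U \<inter> ext Q \<noteq> {}" using that unfolding cl_def by simp
    then show ?thesis by auto
  qed
  have QX: "q \<epsilon> X" if "q \<epsilon> Q" for q using Q(1) that by simp
  obtain f where f: "is_fun f Q omega" "inj_on (app f) (ext Q)"
    using Q(2) unfolding countable_set_def by blast
  have fo: "ap f q \<epsilon> omega" if "q \<epsilon> Q" for q using is_fun_ap(2)[OF f(1) that] .
  have f_inj: "p = q" if "p \<epsilon> Q" "q \<epsilon> Q" "ap f p = ap f q" for p q
    using inj_onD[OF f(2)] is_fun_ap(1)[OF f(1)] that by simp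
  define B where "B n y \<longleftrightarrow> (\<exists>p q. p \<epsilon> Q \<and> q \<epsilon> Q \<and> ap unpair n = pair (ap f p) (ap f q) \<and>
    (M.lt (D p y) (D p q) \<or> p = q \<and> y = p \<and> (\<exists>s. s \<epsilon> S \<and> (\<forall>w. w \<epsilon> s \<longleftrightarrow> w = p))))" for n y
  have dB: "dfn (\<lambda>v. B (v 0) (v 1))" unfolding B_def by (intro dfn_intros dlt dD)
  note mB = pair_mem_rel[OF dB, of _ _ omega X]
  have "coded_space mem X S (rel omega X B)"
  proof
    show "\<exists>U. U \<epsilon> S \<and> x \<epsilon> U \<and> \<not> y \<epsilon> U" if xy: "x \<epsilon> X" "y \<epsilon> X" "x \<noteq> y" for x y
    proof -
      have e: "D x y \<in> ext R" "M.lt z (D x y)" using M.lt_D[of x y] M.D_closed[of x y] xy by auto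
      have "\<not> y \<epsilon> ball x (D x y)" unfolding ball M.lt_def by simp
      then show ?thesis using ball_S[OF xy(1)] ball_c[OF xy(1) e(2)] e(1) by auto
    qed
    show "\<exists>U. U \<epsilon> S \<and> x \<epsilon> U \<and> (\<forall>y. y \<epsilon> U \<longrightarrow> pair n y \<epsilon> rel omega X B)"
      if nx: "pair n x \<epsilon> rel omega X B" for n x
    proof -
      have n: "n \<epsilon> omega" "x \<epsilon> X" using nx unfolding mB by auto
      obtain p q where pq: "p \<epsilon> Q" "q \<epsilon> Q" "ap unpair n = pair (ap f p) (ap f q)"
        and c: "M.lt (D p x) (D p q) \<or> p = q \<and> x = p \<and> (\<exists>s. s \<epsilon> S \<and> (\<forall>w. w \<epsilon> s \<longleftrightarrow> w = p))"
        using nx unfolding mB B_def by blast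
      from c show ?thesis
      proof
        assume "M.lt (D p x) (D p q)"
        then have "x \<epsilon> ball p (D p q)" using n unfolding ball by simp
        moreover have "ball p (D p q) \<epsilon> S"
          by (rule ball_S) (use pq QX M.D_closed[of p q] in auto)
        moreover have "pair n y \<epsilon> rel omega X B" if "y \<epsilon> ball p (D p q)" for y
          using that pq n unfolding mB B_def ball by blast
        ultimately show ?thesis by blast
      next
        assume "p = q \<and> x = p \<and> (\<exists>s. s \<epsilon> S \<and> (\<forall>w. w \<epsilon> s \<longleftrightarrow> w = p))"
        then obtain s where "s \<epsilon> S" "\<forall>w. w \<epsilon> s \<longleftrightarrow> w = x" by auto
        then show ?thesis using nx by (intro exI[of _ s]) simp
      qed
    qed
    show "\<exists>n. n \<epsilon> omega \<and> pair n x \<epsilon> rel omega X B \<and> (\<forall>y. pair n y \<epsilon> rel omega X B \<longrightarrow> y \<epsilon> U)"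
      if U: "U \<epsilon> S" "x \<epsilon> U" for U x
    proof -
      have x: "x \<epsilon> X" using U open_subset by blast
      \<comment> \<open>As \<open>f\<close> is injective, an index decodes to at most one pair
        \<open>(p, q)\<close>, so within \<open>X\<close> its section is exactly the class
        \<open>C\<close>.\<close>
      have idx: "\<exists>n. n \<epsilon> omega \<and> pair n x \<epsilon> rel omega X B \<and>
          (\<forall>y. pair n y \<epsilon> rel omega X B \<longrightarrow> y \<epsilon> U)"
        if pq: "p \<epsilon> Q" "q \<epsilon> Q" and C: "\<And>y. C y \<longleftrightarrow> M.lt (D p y) (D p q) \<or>
          p = q \<and> y = p \<and> (\<exists>s. s \<epsilon> S \<and> (\<forall>w. w \<epsilon> s \<longleftrightarrow> w = p))" "C x" "\<And>y. y \<epsilon> X \<Longrightarrow> C y \<Longrightarrow> y \<epsilon> U" for p q C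
      proof -
        obtain n where n: "n \<epsilon> omega" "ap unpair n = pair (ap f p) (ap f q)"
          using unpair_surj[OF fo[OF pq(1)] fo[OF pq(2)]] by blast
        have "B n y \<longleftrightarrow> C y" for y
        proof
          assume "B n y"
          then obtain p' q' where 1: "p' \<epsilon> Q" "q' \<epsilon> Q" "ap unpair n = pair (ap f p') (ap f q')"
            "M.lt (D p' y) (D p' q') \<or> p' = q' \<and> y = p' \<and> (\<exists>s. s \<epsilon> S \<and> (\<forall>w. w \<epsilon> s \<longleftrightarrow> w = p'))"
            unfolding B_def by blast
          have "pair (ap f p) (ap f q) = pair (ap f p') (ap f q')" using n(2) 1(3) by simp
          then have "p = p'" "q = q'" using f_inj pq 1(1,2) by auto
          then show "C y" unfolding C(1) using 1(4) by simp
        next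
          assume "C y"
          then show "B n y" unfolding B_def C(1) using pq n(2) by blast
        qed
        then show ?thesis using n(1) C(2,3) x unfolding mB by blast
      qed
      show ?thesis
      proof (cases "\<exists>s. s \<epsilon> S \<and> (\<forall>w. w \<epsilon> s \<longleftrightarrow> w = x)")
        case True
        then obtain s where s: "s \<epsilon> S" "\<forall>w. w \<epsilon> s \<longleftrightarrow> w = x" by blast
        \<comment> \<open>An isolated point belongs to every dense set.\<close>
        then have xQ: "x \<epsilon> Q" using dense[of s x] by auto
        have "\<not> M.lt (D x y) (D x x)" if "y \<epsilon> X" for y
          using M.not_lt_z[of x y] M.D_zero[of x x] x that by simp
        then show ?thesis
          by (intro idx[OF xQ xQ, of "\<lambda>y. M.lt (D x y) (D x x) \<or>
            x = x \<and> y = x \<and> (\<exists>s. s \<epsilon> S \<and> (\<forall>w. w \<epsilon> s \<longleftrightarrow> w = x))"]) (use s U(2) in blast)+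
      next
        case False
        obtain r where r: "r \<in> ext R" "M.lt z r" "\<forall>y\<in>ext X. M.lt (D x y) r \<longrightarrow> y \<epsilon> U"
          using U op by blast
        have xX: "x \<in> ext X" using x by simp
        obtain h where h: "h \<in> ext R" "M.lt z h"
          and hq: "\<And>q. q\<in>ext X \<Longrightarrow> q \<noteq> x \<Longrightarrow> M.lt (D x q) h \<Longrightarrow> \<exists>k\<in>ext R. M.lt z k \<and>
            (\<forall>p\<in>ext X. M.lt (D x p) k \<longrightarrow> M.lt (D p x) (D p q) \<and>
              (\<forall>y\<in>ext X. M.lt (D p y) (D p q) \<longrightarrow> M.lt (D x y) r))"
          using M.distances_as_radii[OF xX r(1,2)] by blast
        \<comment> \<open>The punctured ball is open, and nonempty because \<open>x\<close> is not
          isolated, so the dense set provides \<open>q \<noteq> x\<close> within \<open>h\<close> of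
          \<open>x\<close>. The distance to \<open>q\<close> from a dense point \<open>p\<close>
          sufficiently near \<open>x\<close> then serves as radius.\<close>
        define V where "V = Sep (ball x h) (\<lambda>y. y \<noteq> x)"
        have V: "y \<epsilon> V \<longleftrightarrow> y \<epsilon> ball x h \<and> y \<noteq> x" for y
          unfolding V_def by (rule mem_Sep) (intro dfn_intros)
        have bS: "ball x h \<epsilon> S" using ball_S[OF x] h(1) by simp
        have "V \<epsilon> S"
        proof (rule open_local)
          fix y assume "y \<epsilon> V"
          then have y: "y \<epsilon> ball x h" "y \<noteq> x" "y \<epsilon> X" unfolding V ball by auto
          have e: "D y x \<in> ext R" "M.lt z (D y x)" using M.lt_D[of y x] M.D_closed[of y x] x y by auto
          have "ball y (D y x) \<epsilon> S" "y \<epsilon> ball y (D y x)" "\<not> x \<epsilon> ball y (D y x)"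
            using ball_S[OF y(3), of "D y x"] ball_c[OF y(3) e(2)] e(1) unfolding ball M.lt_def by auto
          then show "\<exists>U. U \<epsilon> S \<and> y \<epsilon> U \<and> (\<forall>w. w \<epsilon> U \<longrightarrow> w \<epsilon> V)"
            using open_inter[OF bS, of "ball y (D y x)" y] y(1) unfolding V by metis
        qed
        moreover have "\<exists>w. w \<epsilon> V"
        proof (rule ccontr)
          assume "\<not> (\<exists>w. w \<epsilon> V)"
          then have "\<forall>w. w \<epsilon> ball x h \<longleftrightarrow> w = x" using V ball_c[OF x h(2)] by blast
          then show False using False bS by blast
        qed
        ultimately obtain q where q: "q \<epsilon> Q" "q \<epsilon> V" using dense by blast
        have q': "q \<in> ext X" "q \<noteq> x" "M.lt (D x q) h" using q(2) unfolding V ball by auto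
        obtain k where k: "k \<in> ext R" "M.lt z k" and kp: "\<And>p. p\<in>ext X \<Longrightarrow> M.lt (D x p) k \<Longrightarrow>
            M.lt (D p x) (D p q) \<and> (\<forall>y\<in>ext X. M.lt (D p y) (D p q) \<longrightarrow> M.lt (D x y) r)"
          using hq[OF q'] by blast
        obtain p where p: "p \<epsilon> Q" "p \<epsilon> ball x k"
          using dense[OF ball_S[OF x] ball_c[OF x k(2)]] k(1) by auto
        then have p': "p \<in> ext X" "M.lt (D x p) k" unfolding ball by auto
        have lt1: "M.lt (D p x) (D p q)" and
          lt2: "\<And>y. y\<in>ext X \<Longrightarrow> M.lt (D p y) (D p q) \<Longrightarrow> M.lt (D x y) r"
          using kp[OF p'] by blast+
        \<comment> \<open>With \<open>p \<noteq> q\<close> the clause for isolated points is void,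
          and the basic set is the plain ball.\<close>
        have pq: "p \<noteq> q"
          using lt1 M.not_lt_z[of p x] M.D_zero[of p p] p'(1) xX by auto
        show ?thesis
          by (rule idx[OF p(1) q(1), of "\<lambda>y. M.lt (D p y) (D p q)"])
            (use pq lt1 lt2 r(3) in auto)
      qed
    qed
  qed
  then show ?thesis by blast
qed

end

section \<open>Actions\<close>

locale group_action = ZF_DC mem + G: coded_space mem G T bG + X: coded_space mem X S bX
  for mem :: "'m \<Rightarrow> 'm \<Rightarrow> bool" (infix "\<epsilon>" 50) and G T bG X S bX +
  fixes m e \<alpha> :: 'm
  assumes sepG: "separable G T"
    and top_group: "topological_group G T m e"
    and action: "continuous_action G T m e X S \<alpha>"
    and trans: "transitive G X \<alpha>"
    and nonmeager: "\<not> meager X S X"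
begin

abbreviation mul :: "'m \<Rightarrow> 'm \<Rightarrow> 'm" (infixl "\<star>" 70) where
  "g \<star> h \<equiv> app2 m g h"

abbreviation iv :: "'m \<Rightarrow> 'm" where
  "iv g \<equiv> inv\<^bsub>group_of G m e\<^esub> g"

text \<open>\<open>ap\<close> in place of \<open>app\<close> makes the action a definable class
  function; for arguments in \<open>G\<close> and \<open>X\<close> the two agree.\<close>

definition act :: "'m \<Rightarrow> 'm \<Rightarrow> 'm" where
  "act g x = ap \<alpha> (pair g x)"

lemma dft_act [dfn_intros]: "dft s \<Longrightarrow> dft t \<Longrightarrow> dft (\<lambda>v. act (s v) (t v))"
  unfolding act_def by (intro dfn_intros)

section \<open>Group and action laws inside the structure\<close>

lemma group: "group (group_of G m e)"
  using top_group by (simp add: topological_group_def)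

lemma e_G: "e \<epsilon> G"
  using group.is_monoid[OF group, THEN monoid.one_closed] by (simp add: group_of_def)

lemma mul_closed: "g \<epsilon> G \<Longrightarrow> h \<epsilon> G \<Longrightarrow> g \<star> h \<epsilon> G"
  using group.is_monoid[OF group, THEN monoid.m_closed, of g h] by (simp add: group_of_def)

lemma iv_closed: "g \<epsilon> G \<Longrightarrow> iv g \<epsilon> G"
  using group.inv_closed[OF group, of g] by (simp add: group_of_def)

lemma e_mul: "g \<epsilon> G \<Longrightarrow> e \<star> g = g"
  using group.is_monoid[OF group, THEN monoid.l_one, of g] by (simp add: group_of_def)

lemma iv_mul: "g \<epsilon> G \<Longrightarrow> iv g \<star> g = e"
  using group.l_inv[OF group, of g] by (simp add: group_of_def)

lemma mul_iv: "g \<epsilon> G \<Longrightarrow> g \<star> iv g = e"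
  using group.r_inv[OF group, of g] by (simp add: group_of_def)

lemma iv_e: "iv e = e"
  using group.is_monoid[OF group, THEN monoid.inv_one] by (simp add: group_of_def)

lemma mul_continuous:
  assumes "g \<epsilon> G" "h \<epsilon> G" "W \<epsilon> T" "g \<star> h \<epsilon> W"
  shows "\<exists>U V. U \<epsilon> T \<and> V \<epsilon> T \<and> g \<epsilon> U \<and> h \<epsilon> V \<and> (\<forall>g' h'. g' \<epsilon> U \<longrightarrow> h' \<epsilon> V \<longrightarrow> g' \<star> h' \<epsilon> W)"
proof -
  have "continuous2 G T G T T (app2 m)" using top_group by (simp add: topological_group_def)
  from this[unfolded continuous2_def, rule_format, of g h W] show ?thesis using assms by auto
qed

lemma iv_continuous:
  assumes "g \<epsilon> G" "W \<epsilon> T" "iv g \<epsilon> W"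
  shows "\<exists>U. U \<epsilon> T \<and> g \<epsilon> U \<and> (\<forall>g'. g' \<epsilon> U \<longrightarrow> iv g' \<epsilon> W)"
proof -
  have "continuous G T T iv" using top_group by (simp add: topological_group_def)
  from this[unfolded continuous_def, rule_format, of g W] show ?thesis using assms by auto
qed

lemma app2_act:
  assumes "g \<epsilon> G" "x \<epsilon> X"
  shows "app2 \<alpha> g x = act g x" and act_closed: "act g x \<epsilon> X"
proof -
  have "is_fun \<alpha> (cprod G X) X" using action by (simp add: continuous_action_def)
  from is_fun_ap(1,2)[OF this, of "pair g x"]
  show "app2 \<alpha> g x = act g x" "act g x \<epsilon> X" using assms by (simp_all add: app2_def act_def)
qed

lemma act_e: "x \<epsilon> X \<Longrightarrow> act e x = x"
  using action app2_act[OF e_G, of x] by (simp add: continuous_action_def)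

lemma act_mul:
  assumes "g \<epsilon> G" "h \<epsilon> G" "x \<epsilon> X"
  shows "act (g \<star> h) x = act g (act h x)"
proof -
  have "app2 \<alpha> (g \<star> h) x = app2 \<alpha> g (app2 \<alpha> h x)"
    using action assms by (simp add: continuous_action_def)
  then show ?thesis
    using assms by (simp add: app2_act act_closed mul_closed)
qed

lemma act_iv: "g \<epsilon> G \<Longrightarrow> x \<epsilon> X \<Longrightarrow> act (iv g) (act g x) = x"
  and act_iv': "g \<epsilon> G \<Longrightarrow> x \<epsilon> X \<Longrightarrow> act g (act (iv g) x) = x"
  using act_mul[of "iv g" g x] act_mul[of g "iv g" x] by (simp_all add: iv_closed iv_mul mul_iv act_e)

lemma act_continuous:
  assumes "g \<epsilon> G" "x \<epsilon> X" "W \<epsilon> S" "act g x \<epsilon> W"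
  shows "\<exists>U V. U \<epsilon> T \<and> V \<epsilon> S \<and> g \<epsilon> U \<and> x \<epsilon> V \<and> (\<forall>g' x'. g' \<epsilon> U \<longrightarrow> x' \<epsilon> V \<longrightarrow> act g' x' \<epsilon> W)"
proof -
  have "continuous2 G T X S S (app2 \<alpha>)" using action by (simp add: continuous_action_def)
  from this[unfolded continuous2_def, rule_format, of g x W] obtain U V where
    UV: "U \<epsilon> T" "V \<epsilon> S" "g \<epsilon> U" "x \<epsilon> V" "\<forall>g'. g' \<epsilon> U \<longrightarrow> (\<forall>x'. x' \<epsilon> V \<longrightarrow> app2 \<alpha> g' x' \<epsilon> W)"
    using assms by (auto simp: app2_act)
  have "act g' x' \<epsilon> W" if "g' \<epsilon> U" "x' \<epsilon> V" for g' x'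
  proof -
    have "app2 \<alpha> g' x' = act g' x'"
      by (rule app2_act[OF G.open_subset[OF UV(1) that(1)] X.open_subset[OF UV(2) that(2)]])
    moreover have "app2 \<alpha> g' x' \<epsilon> W" using UV(5) that by blast
    ultimately show ?thesis by simp
  qed
  then show ?thesis using UV(1-4) by blast
qed

lemma preimage_open:
  assumes g: "g \<epsilon> G" and U: "U \<epsilon> S"
  shows "\<exists>V. V \<epsilon> S \<and> (\<forall>x. x \<epsilon> V \<longleftrightarrow> x \<epsilon> X \<and> act g x \<epsilon> U)"
proof -
  have m: "x \<epsilon> Sep X (\<lambda>x. act g x \<epsilon> U) \<longleftrightarrow> x \<epsilon> X \<and> act g x \<epsilon> U" for x
    by (rule mem_Sep) (intro dfn_intros)
  have "Sep X (\<lambda>x. act g x \<epsilon> U) \<epsilon> S"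
  proof (rule X.open_local)
    fix x assume "x \<epsilon> Sep X (\<lambda>x. act g x \<epsilon> U)"
    then have "x \<epsilon> X" "act g x \<epsilon> U" using m by blast+
    then obtain V where "V \<epsilon> S" "x \<epsilon> V" "\<forall>x'. x' \<epsilon> V \<longrightarrow> act g x' \<epsilon> U"
      using act_continuous[OF g _ U] by blast
    then show "\<exists>V. V \<epsilon> S \<and> x \<epsilon> V \<and> (\<forall>y. y \<epsilon> V \<longrightarrow> y \<epsilon> Sep X (\<lambda>x. act g x \<epsilon> U))"
      using m X.open_subset by blast
  qed
  then show ?thesis using m by blast
qed

text \<open>Translation by \<open>g\<close> is a homeomorphism of \<open>X\<close>. Open sets are
  moved in both directions as preimages: under \<open>g\<close> to pull \<open>U\<close> back, and
  under \<open>iv g\<close> to carry the smaller open set forward.\<close>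

lemma rare_translate:
  assumes g: "g \<epsilon> G" and A: "X.rare A"
  shows "X.rare {x. \<exists>y. y \<in> A \<and> y \<epsilon> X \<and> x = act g y}"
  unfolding X.rare_def
proof (intro allI impI, elim conjE)
  fix U x assume U: "U \<epsilon> S" "x \<epsilon> U"
  have x: "x \<epsilon> X" using X.open_subset U by blast
  obtain U' where U': "U' \<epsilon> S" "\<And>x. x \<epsilon> U' \<longleftrightarrow> x \<epsilon> X \<and> act g x \<epsilon> U"
    using preimage_open[OF g U(1)] by blast
  have "act (iv g) x \<epsilon> U'"
    unfolding U'(2) using act_iv'[OF g x] act_closed[OF iv_closed[OF g] x] U(2) by simp
  then obtain V y where V: "V \<epsilon> S" "y \<epsilon> V" "\<And>z. z \<epsilon> V \<Longrightarrow> z \<epsilon> U' \<and> z \<notin> A"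
    using A U'(1) unfolding X.rare_def by blast
  have y: "y \<epsilon> X" using X.open_subset V(1,2) by blast
  obtain V' where V': "V' \<epsilon> S" "\<And>x. x \<epsilon> V' \<longleftrightarrow> x \<epsilon> X \<and> act (iv g) x \<epsilon> V"
    using preimage_open[OF iv_closed[OF g] V(1)] by blast
  have "act g y \<epsilon> V'" unfolding V'(2) using act_iv[OF g y] act_closed[OF g y] V(2) by simp
  moreover have "w \<epsilon> U \<and> w \<notin> {x. \<exists>y. y \<in> A \<and> y \<epsilon> X \<and> x = act g y}" if "w \<epsilon> V'" for w
  proof
    have w: "w \<epsilon> X" "act (iv g) w \<epsilon> V" using that V'(2) by blast+
    then have "act g (act (iv g) w) \<epsilon> U" using V(3) U'(2) by blast
    then show "w \<epsilon> U" using act_iv'[OF g w(1)] by simp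
    have "y \<notin> A" if "y \<epsilon> X" "w = act g y" for y
      using V(3)[OF w(2)] act_iv[OF g that(1)] that(2) by simp
    then show "w \<notin> {x. \<exists>y. y \<in> A \<and> y \<epsilon> X \<and> x = act g y}" by blast
  qed
  ultimately show "\<exists>V y. V \<epsilon> S \<and> y \<epsilon> V \<and>
      (\<forall>z. z \<epsilon> V \<longrightarrow> z \<epsilon> U \<and> z \<notin> {x. \<exists>y. y \<in> A \<and> y \<epsilon> X \<and> x = act g y})"
    using V'(1) by blast
qed

section \<open>Orbits of neighborhoods of the identity\<close>

definition orb :: "'m \<Rightarrow> 'm \<Rightarrow> 'm" where
  "orb V x = Sep X (\<lambda>y. \<exists>g. g \<epsilon> V \<and> y = act g x)"

lemma mem_orb: "y \<epsilon> orb V x \<longleftrightarrow> y \<epsilon> X \<and> (\<exists>g. g \<epsilon> V \<and> y = act g x)"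
  unfolding orb_def by (rule mem_Sep) (intro dfn_intros)

text \<open>The translates are taken over a countable dense \<open>Q\<close> in \<open>G\<close>: if
  \<open>x = g y\<close>, an element \<open>d\<close> of \<open>Q\<close> close to \<open>g\<close>
  has \<open>iv d \<star> g\<close> in \<open>V\<close>, so \<open>x\<close> lies in the translate
  of \<open>V y\<close> by \<open>d\<close>. One cover \<open>r\<close> of \<open>V y\<close> is
  moved by all \<open>d\<close> at once, which yields a definable double family and spares a choice
  of covers.\<close>

lemma orb_nonmeager:
  assumes V: "V \<epsilon> T" "e \<epsilon> V" and y: "y \<epsilon> X"
  shows "\<not> X.mgr (ext (orb V y))"
proof
  assume "X.mgr (ext (orb V y))"
  then obtain r where r: "\<And>n. n \<epsilon> omega \<Longrightarrow> X.rare {x. pair n x \<epsilon> r}"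
    and Vr: "ext (orb V y) \<subseteq> {x. \<exists>n. n \<epsilon> omega \<and> pair n x \<epsilon> r}"
    unfolding X.mgr_def by blast
  obtain Q where Q: "ext Q \<subseteq> ext G" "countable_set Q" "cl G T Q = ext G"
    using sepG unfolding separable_def by blast
  have QG: "d \<epsilon> G" if "d \<epsilon> Q" for d using Q(1) that by simp
  obtain f where f: "is_fun f Q omega" "inj_on (app f) (ext Q)"
    using Q(2) unfolding countable_set_def by blast
  have f_inj: "p = q" if "p \<epsilon> Q" "q \<epsilon> Q" "ap f p = ap f q" for p q
    using inj_onD[OF f(2)] is_fun_ap(1)[OF f(1)] that by simp
  let ?R = "\<lambda>n k x. \<exists>d y. d \<epsilon> Q \<and> ap f d = n \<and> y \<epsilon> X \<and> pair k y \<epsilon> r \<and> x = act d y"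
  have "X.mgr (ext X)"
  proof (rule X.mgr_family2)
    show "dfn (\<lambda>v. ?R (v 0) (v 1) (v 2))" by (intro dfn_intros)
    show "X.rare {x. ?R n k x}" if k: "k \<epsilon> omega" for n k
    proof (cases "\<exists>d. d \<epsilon> Q \<and> ap f d = n")
      case True
      then obtain d where d: "d \<epsilon> Q" "ap f d = n" by blast
      show ?thesis
        by (rule X.rare_subset[OF rare_translate[OF QG[OF d(1)] r[OF k]]])
          (use f_inj d in blast)
    next
      case False
      then show ?thesis by (intro X.rare_subset[OF X.rare_empty]) blast
    qed
    show "ext X \<subseteq> {x \<in> ext X. \<exists>n k. n \<epsilon> omega \<and> k \<epsilon> omega \<and> ?R n k x}"
    proof
      fix x assume "x \<in> ext X"
      then have x: "x \<epsilon> X" by simp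
      then obtain g where g: "g \<epsilon> G" "act g y = x"
        using trans y app2_act unfolding transitive_def by auto
      \<comment> \<open>Multiplication is continuous at \<open>(iv g, g)\<close>, whose product
        \<open>e\<close> lies in \<open>V\<close>; the element \<open>d\<close> is then chosen so
        that \<open>iv d\<close> stays in \<open>U1\<close>.\<close>
      obtain U1 U2 where U1: "U1 \<epsilon> T" "iv g \<epsilon> U1" "g \<epsilon> U2"
        "\<forall>g' h'. g' \<epsilon> U1 \<longrightarrow> h' \<epsilon> U2 \<longrightarrow> g' \<star> h' \<epsilon> V"
        using mul_continuous[OF iv_closed[OF g(1)] g(1) V(1)] iv_mul[OF g(1)] V(2) by auto
      obtain U0 where U0: "U0 \<epsilon> T" "g \<epsilon> U0" "\<forall>h. h \<epsilon> U0 \<longrightarrow> iv h \<epsilon> U1"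
        using iv_continuous[OF g(1) U1(1,2)] by blast
      have "g \<in> cl G T Q" using Q(3) g(1) by simp
      then have "ext U0 \<inter> ext Q \<noteq> {}" using U0 unfolding cl_def by simp
      then obtain d where d: "d \<epsilon> U0" "d \<epsilon> Q" by auto
      have v: "iv d \<star> g \<epsilon> V" using U0(3) U1(3,4) d(1) by blast
      have dG: "d \<epsilon> G" by (rule QG[OF d(2)])
      have eq: "act (iv d \<star> g) y = act (iv d) x"
        using act_mul[OF iv_closed[OF dG] g(1) y] g(2) by simp
      have dx: "act (iv d) x \<epsilon> X" using act_closed[OF iv_closed[OF dG] x] .
      then have "act (iv d) x \<epsilon> orb V y" unfolding mem_orb using v eq[symmetric] by blast
      then obtain k where k: "k \<epsilon> omega" "pair k (act (iv d) x) \<epsilon> r" using Vr by auto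
      have "?R (ap f d) k x" using d(2) dx k(2) act_iv'[OF dG x] by metis
      moreover have "ap f d \<epsilon> omega" using is_fun_ap(2)[OF f(1) d(2)] .
      ultimately show "x \<in> {x \<in> ext X. \<exists>n k. n \<epsilon> omega \<and> k \<epsilon> omega \<and> ?R n k x}"
        using k(1) x by auto
    qed
  qed
  then show False using nonmeager X.meager_iff by blast
qed

lemma small_orb:
  assumes "U \<epsilon> S" "x \<epsilon> U"
  shows "\<exists>V. V \<epsilon> T \<and> e \<epsilon> V \<and> (\<forall>g. g \<epsilon> V \<longrightarrow> act g x \<epsilon> U)"
  using act_continuous[OF e_G _ assms(1), of x] act_e X.open_subset[OF assms] assms by force

text \<open>Transitivity makes the nonmeager \<open>X\<close> a Baire space: a nonempty open set
  contains a piece \<open>V x\<close> of the orbit, which is nonmeager.\<close>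

lemma open_nonmeager:
  assumes "U \<epsilon> S" "x \<epsilon> U"
  shows "\<not> X.mgr (ext U)"
proof -
  obtain V where V: "V \<epsilon> T" "e \<epsilon> V" "\<forall>g. g \<epsilon> V \<longrightarrow> act g x \<epsilon> U"
    using small_orb[OF assms] by blast
  then have "ext (orb V x) \<subseteq> ext U" by (auto simp: mem_orb)
  then show ?thesis
    using orb_nonmeager[OF V(1,2) X.open_subset[OF assms]] X.mgr_subset by blast
qed

text \<open>Continuity at the identity is applied to one factor at a time, and the resulting
  neighborhoods are intersected into a single one.\<close>

lemma group_small:
  assumes "W \<epsilon> T" "e \<epsilon> W"
  shows "\<exists>V. V \<epsilon> T \<and> e \<epsilon> V \<and> (\<forall>a b c. a \<epsilon> V \<longrightarrow> b \<epsilon> V \<longrightarrow> c \<epsilon> V \<longrightarrow> iv a \<star> (iv b \<star> c) \<epsilon> W)"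
proof -
  obtain V1 V2 where V1: "V1 \<epsilon> T" "V2 \<epsilon> T" "e \<epsilon> V1" "e \<epsilon> V2"
    "\<forall>g h. g \<epsilon> V1 \<longrightarrow> h \<epsilon> V2 \<longrightarrow> g \<star> h \<epsilon> W"
    using mul_continuous[OF e_G e_G assms(1)] e_mul[OF e_G] assms(2) by auto
  obtain V3 V4 where V3: "V3 \<epsilon> T" "V4 \<epsilon> T" "e \<epsilon> V3" "e \<epsilon> V4"
    "\<forall>g h. g \<epsilon> V3 \<longrightarrow> h \<epsilon> V4 \<longrightarrow> g \<star> h \<epsilon> V2"
    using mul_continuous[OF e_G e_G V1(2)] e_mul[OF e_G] V1(4) by auto
  obtain V5 where V5: "V5 \<epsilon> T" "e \<epsilon> V5" "\<forall>h. h \<epsilon> V5 \<longrightarrow> iv h \<epsilon> V1"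
    using iv_continuous[OF e_G V1(1)] iv_e V1(3) by auto
  obtain V6 where V6: "V6 \<epsilon> T" "e \<epsilon> V6" "\<forall>h. h \<epsilon> V6 \<longrightarrow> iv h \<epsilon> V3"
    using iv_continuous[OF e_G V3(1)] iv_e V3(3) by auto
  obtain V7 where V7: "V7 \<epsilon> T" "e \<epsilon> V7" "\<forall>h. h \<epsilon> V7 \<longrightarrow> h \<epsilon> V5 \<and> h \<epsilon> V6"
    using G.open_inter[OF V5(1) V6(1) V5(2) V6(2)] by blast
  obtain V where V: "V \<epsilon> T" "e \<epsilon> V" "\<forall>h. h \<epsilon> V \<longrightarrow> h \<epsilon> V4 \<and> h \<epsilon> V7"
    using G.open_inter[OF V3(2) V7(1) V3(4) V7(2)] by blast
  have "iv a \<star> (iv b \<star> c) \<epsilon> W" if "a \<epsilon> V" "b \<epsilon> V" "c \<epsilon> V" for a b c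
  proof -
    have "iv a \<epsilon> V1" using that(1) V(3) V7(3) V5(3) by simp
    moreover have "iv b \<epsilon> V3" "c \<epsilon> V4" using that(2,3) V(3) V7(3) V6(3) by simp_all
    ultimately show ?thesis using V1(5) V3(5) by simp
  qed
  then show ?thesis using V(1,2) by blast
qed

theorem micro_transitive:
  assumes BP
  shows "micro_transitive G T e X S \<alpha>"
  unfolding micro_transitive_def
proof (intro ballI allI impI)
  fix x U assume "x \<in> ext X" and U: "nhood G T e (ext U)"
  then have x: "x \<epsilon> X" by simp
  obtain W0 where W0: "W0 \<epsilon> T" "e \<epsilon> W0" "\<And>g. g \<epsilon> W0 \<Longrightarrow> g \<epsilon> U" and UG: "\<And>g. g \<epsilon> U \<Longrightarrow> g \<epsilon> G"
    using U unfolding nhood_def by auto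
  obtain V where V: "V \<epsilon> T" "e \<epsilon> V"
    "\<And>a b c. a \<epsilon> V \<Longrightarrow> b \<epsilon> V \<Longrightarrow> c \<epsilon> V \<Longrightarrow> iv a \<star> (iv b \<star> c) \<epsilon> W0"
    using group_small[OF W0(1,2)] by blast
  have VG: "g \<epsilon> G" if "g \<epsilon> V" for g using G.open_subset V(1) that by blast
  let ?A = "orb V x"
  have orb_X: "ext (orb V' y) \<subseteq> ext X" for V' y by (simp add: mem_orb)
  obtain W w where W: "W \<epsilon> S" "w \<epsilon> W" "X.mgr (ext W - ext ?A)"
    using X.nonmeager_comeager_somewhere[OF \<open>BP\<close> orb_X orb_nonmeager[OF V(1,2) x]] by blast
  \<comment> \<open>\<open>W\<close> is nonmeager and all but a meager part of it lies in
    \<open>V x\<close>, so it contains some \<open>v x\<close> with \<open>v\<close> in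
    \<open>V\<close>; this \<open>v\<close> later carries \<open>W\<close> back to a neighborhood of
    \<open>x\<close>.\<close>
  have "\<exists>p. p \<epsilon> W \<and> p \<epsilon> ?A"
  proof (rule ccontr)
    assume "\<not> (\<exists>p. p \<epsilon> W \<and> p \<epsilon> ?A)"
    then have "ext W - ext ?A = ext W" by auto
    then show False using W open_nonmeager by simp
  qed
  then obtain v where v: "v \<epsilon> V" "act v x \<epsilon> W" unfolding mem_orb by blast
  have claim: "\<exists>a b. a \<epsilon> V \<and> b \<epsilon> V \<and> act a q = act b x" if q: "q \<epsilon> W" for q
  proof -
    have qX: "q \<epsilon> X" using X.open_subset W(1) q by blast
    obtain V1 where V1: "V1 \<epsilon> T" "e \<epsilon> V1" "\<forall>g. g \<epsilon> V1 \<longrightarrow> act g q \<epsilon> W"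
      using small_orb[OF W(1) q] by blast
    obtain V' where V': "V' \<epsilon> T" "e \<epsilon> V'" "\<forall>g. g \<epsilon> V' \<longrightarrow> g \<epsilon> V1 \<and> g \<epsilon> V"
      using G.open_inter[OF V1(1) V(1) V1(2) V(2)] by blast
    let ?B = "orb V' q"
    obtain W' w' where W': "W' \<epsilon> S" "w' \<epsilon> W'" "X.mgr (ext W' - ext ?B)"
      using X.nonmeager_comeager_somewhere[OF \<open>BP\<close> orb_X orb_nonmeager[OF V'(1,2) qX]] by blast
    have BW: "y \<epsilon> W" if "y \<epsilon> ?B" for y using that V1(3) V'(3) unfolding mem_orb by blast
    have "\<exists>p. p \<epsilon> W' \<and> p \<epsilon> ?B"
    proof (rule ccontr)
      assume "\<not> (\<exists>p. p \<epsilon> W' \<and> p \<epsilon> ?B)"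
      then have "ext W' - ext ?B = ext W'" by auto
      then show False using W' open_nonmeager by simp
    qed
    \<comment> \<open>The set \<open>W'\<close> as obtained need not lie inside \<open>W\<close>,
      but it meets \<open>V' q\<close>, which does. In the open \<open>W2\<close> inside both, the
      two orbit pieces are comeager, so they share a point.\<close>
    then obtain p where p: "p \<epsilon> W'" "p \<epsilon> W" using BW by blast
    obtain W2 where W2: "W2 \<epsilon> S" "p \<epsilon> W2" "\<forall>y. y \<epsilon> W2 \<longrightarrow> y \<epsilon> W' \<and> y \<epsilon> W"
      using X.open_inter[OF W'(1) W(1) p] by blast
    have "\<exists>y. y \<epsilon> ?A \<and> y \<epsilon> ?B"
    proof (rule ccontr)
      assume "\<not> (\<exists>y. y \<epsilon> ?A \<and> y \<epsilon> ?B)"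
      then have "ext W2 \<subseteq> (ext W - ext ?A) \<union> (ext W' - ext ?B)" using W2(3) by auto
      then show False
        using X.mgr_subset[OF X.mgr_union[OF W(3) W'(3)]] open_nonmeager[OF W2(1,2)] by blast
    qed
    then show ?thesis using V'(3) unfolding mem_orb by metis
  qed
  obtain N where N: "N \<epsilon> S" "\<And>t. t \<epsilon> N \<longleftrightarrow> t \<epsilon> X \<and> act v t \<epsilon> W"
    using preimage_open[OF VG[OF v(1)] W(1)] by blast
  have sub: "\<exists>g. g \<epsilon> U \<and> t = app2 \<alpha> g x" if "t \<epsilon> N" for t
  proof -
    have t: "t \<epsilon> X" "act v t \<epsilon> W" using that N(2) by blast+
    obtain a b where ab: "a \<epsilon> V" "b \<epsilon> V" "act a (act v t) = act b x" using claim[OF t(2)] by blast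
    note Gs = VG[OF v(1)] VG[OF ab(1)] VG[OF ab(2)]
    have "act (iv v \<star> (iv a \<star> b)) x = act (iv v) (act (iv a) (act b x))"
      using Gs x by (simp add: act_mul mul_closed iv_closed act_closed)
    also have "\<dots> = t"
      unfolding ab(3)[symmetric] using Gs t(1) by (simp add: act_iv act_closed)
    finally have "act (iv v \<star> (iv a \<star> b)) x = t" .
    moreover have "iv v \<star> (iv a \<star> b) \<epsilon> U" by (rule W0(3)[OF V(3)[OF v(1) ab(1,2)]])
    ultimately show ?thesis using app2_act[OF UG x] by metis
  qed
  show "nhood X S x ((\<lambda>g. app2 \<alpha> g x) ` ext U)"
    unfolding nhood_def
  proof
    show "(\<lambda>g. app2 \<alpha> g x) ` ext U \<subseteq> ext X" using app2_act act_closed UG x by auto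
    have "x \<epsilon> N" using N(2) x v(2) by blast
    moreover have "ext N \<subseteq> (\<lambda>g. app2 \<alpha> g x) ` ext U" using sub by (force simp: image_iff)
    ultimately show "\<exists>W\<in>ext S. x \<epsilon> W \<and> ext W \<subseteq> (\<lambda>g. app2 \<alpha> g x) ` ext U"
      using N(1) by auto
  qed
qed

end

theorem corollary4p4:
  fixes mem :: "'m \<Rightarrow> 'm \<Rightarrow> bool"
  assumes "ZF_DC mem"
    and "set_structure.BP mem"
  shows "\<forall>G T m e.
    set_structure.separable mem G T \<and> set_structure.metrizable mem G T \<and>
    set_structure.topological_group mem G T m e \<longrightarrow>
    set_structure.effros mem G T m e"
proof -
  interpret ZF_DC mem by fact
  show ?thesis
    unfolding effros_def
  proof (intro allI impI, elim conjE)
    fix G T m e X S \<alpha>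
    assume G: "separable G T" "metrizable G T" "topological_group G T m e"
      and X: "separable X S" "metrizable X S" "\<not> meager X S X"
      and a: "continuous_action G T m e X S \<alpha>" "transitive G X \<alpha>"
    obtain bG where bG: "coded_space mem G T bG" using coded_space_exists[OF assms(1) G(1,2)] by blast
    obtain bX where bX: "coded_space mem X S bX" using coded_space_exists[OF assms(1) X(1,2)] by blast
    have "group_action mem G T bG X S bX m e \<alpha>"
      by (intro group_action.intro group_action_axioms.intro assms(1) bG bX G a X)
    then show "micro_transitive G T e X S \<alpha>" using assms(2) by (rule group_action.micro_transitive)
  qed
qed

end
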